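(* Let $K\subset\mathbb{R}^d$, $d>2$, be a porous compact set, and let $\omega$ be a modulus of continuity. Let $f$ be a continuous function on $K$. Then $f\in\mathrm{Lip}_\omega(K)$ if and only if for any $\delta>0$ there is a function $\mathcal{F}_\delta$, harmonic in the $\delta$-neighborhood $K_\delta$ of $K$, such that $$\sup_{K}|f-\mathcal{F}_\delta|\le C_1\,\|f\|_\omega\,\omega(\delta)$$ and $$\sup_{K_\delta}|\nabla\mathcal{F}_\delta|\le C_2\,\|f\|_\omega\,\frac{\omega(\delta)}{\delta},$$ where the constants $C_1$ and $C_2$ are independent of $\delta$ and $f$.
   Context: A bounded closed set $K\subset\mathbb{R}^d$ is called porous if there is a constant $0<c<1$ such that for each ball $B\subset\mathbb{R}^d$ there exists a ball $B'\subset B$ with $B'\cap K=\emptyset$ and $|B'|\ge c|B|$, where $|E|$ denotes the $d$-dimensional Lebesgue measure of a set $E$. A modulus of continuity is a continuous increasing concave function $\omega:[0,\infty)\to[0,\infty)$ with $\omega(0)=0$. The space $\mathrm{Lip}_\omega(K)$ consists of those continuous functions $f$ on $K$ for which the semi-norm $\|f\|_\omega=\sup_{x,y\in K,\ x\ne y}\frac{|f(x)-f(y)|}{\omega(|x-y|)}$ is finite. For $\delta>0$, $K_\delta=\{x\in\mathbb{R}^d:\ \inf_{y\in K}|x-y|<\delta\}$.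
   Formalization: In the "if" direction the factors C₁‖f‖_ω and C₂‖f‖_ω are replaced by arbitrary finite constants independent of δ, since for f outside Lip_ω(K) one has ‖f‖_ω=∞ and the bounds as written hold trivially; the "only if" direction keeps the bounds as stated. *)

theory Defs
  imports "HOL-Analysis.Analysis"
begin

definition porous :: "'a::euclidean_space set \<Rightarrow> bool" where
  "porous K \<longleftrightarrow> bounded K \<and> closed K \<and>
     (\<exists>c. 0 < c \<and> c < 1 \<and>
       (\<forall>x r. 0 < r \<longrightarrow>
         (\<exists>y s. 0 < s \<and> ball y s \<subseteq> ball x r \<and> ball y s \<inter> K = {} \<and>
            c * measure lebesgue (ball x r) \<le> measure lebesgue (ball y s))))"

text \<open>``Increasing'' is read in the weak sense, so that moduli such as \<open>min t 1\<close> are included;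
  positivity away from \<open>0\<close> then only excludes the zero function, for which the quotients in the
  seminorm below make no sense. Only the values of \<open>\<omega>\<close> on \<open>{0..}\<close> matter.\<close>

definition modulus_of_continuity :: "(real \<Rightarrow> real) \<Rightarrow> bool" where
  "modulus_of_continuity \<omega> \<longleftrightarrow>
     continuous_on {0..} \<omega> \<and> mono_on {0..} \<omega> \<and> concave_on {0..} \<omega> \<and>
     \<omega> 0 = 0 \<and> (\<forall>t>0. 0 < \<omega> t)"

text \<open>Suprema are taken in the extended nonnegative reals: an unbounded supremum is \<open>\<infinity>\<close>, and
  the supremum over the empty set (for instance when \<open>K\<close> is a single point) is \<open>0\<close>.\<close>

definition lip_seminorm :: "(real \<Rightarrow> real) \<Rightarrow> 'a::euclidean_space set \<Rightarrow> ('a \<Rightarrow> real) \<Rightarrow> ennreal" where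
  "lip_seminorm \<omega> K f =
     (SUP x\<in>K. SUP y\<in>K - {x}. ennreal (\<bar>f x - f y\<bar> / \<omega> (dist x y)))"

definition Lip :: "(real \<Rightarrow> real) \<Rightarrow> 'a::euclidean_space set \<Rightarrow> ('a \<Rightarrow> real) set" where
  "Lip \<omega> K = {f. continuous_on K f \<and> lip_seminorm \<omega> K f < \<infinity>}"

text \<open>For \<open>K = {}\<close> this is the whole space, since \<^term>\<open>infdist x {} = 0\<close>.\<close>

definition nbhd :: "'a::euclidean_space set \<Rightarrow> real \<Rightarrow> 'a set" where
  "nbhd K \<delta> = {x. infdist x K < \<delta>}"

definition grad :: "('a::euclidean_space \<Rightarrow> real) \<Rightarrow> 'a \<Rightarrow> 'a" where
  "grad u x = (\<Sum>b\<in>Basis. frechet_derivative u (at x) b *\<^sub>R b)"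

definition laplacian :: "('a::euclidean_space \<Rightarrow> real) \<Rightarrow> 'a \<Rightarrow> real" where
  "laplacian u x = (\<Sum>b\<in>Basis. frechet_derivative (grad u) (at x) b \<bullet> b)"

text \<open>The first four conjuncts say that \<open>u\<close> is twice continuously differentiable on the open
  set \<open>U\<close>.\<close>

definition harmonic_on :: "('a::euclidean_space \<Rightarrow> real) \<Rightarrow> 'a set \<Rightarrow> bool" where
  "harmonic_on u U \<longleftrightarrow>
     open U \<and> u differentiable_on U \<and> grad u differentiable_on U \<and>
     (\<forall>b\<in>Basis. continuous_on U (\<lambda>x. frechet_derivative (grad u) (at x) b)) \<and>
     (\<forall>x\<in>U. laplacian u x = 0)"

definition harmonic_approx ::
    "(real \<Rightarrow> real) \<Rightarrow> 'a::euclidean_space set \<Rightarrow> ('a \<Rightarrow> real) \<Rightarrow> ennreal \<Rightarrow> ennreal \<Rightarrow> bool" where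
  "harmonic_approx \<omega> K f A\<^sub>1 A\<^sub>2 \<longleftrightarrow>
     (\<forall>\<delta>>0. \<exists>F. harmonic_on F (nbhd K \<delta>) \<and>
        (SUP x\<in>K. ennreal \<bar>f x - F x\<bar>) \<le> A\<^sub>1 * ennreal (\<omega> \<delta>) \<and>
        (SUP x\<in>nbhd K \<delta>. ennreal (norm (grad F x))) \<le> A\<^sub>2 * ennreal (\<omega> \<delta> / \<delta>))"

end

theory Submission
  imports Defs
begin

text \<open>
  By scaling it suffices to work at scale \<open>\<delta> = 1\<close>. Extend \<open>f\<close> to a compactly supported function with the same
  modulus and mollify it twice; up to a constant factor the result is the potential of the density \<open>\<rho>\<close>, the Laplacian of the
  first mollification, for a regularized Newton kernel \<open>N\<close>, and \<open>\<rho>\<close> is bounded by the oscillation of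
  the extension. Every point \<open>q\<close> has near it a hole of \<open>K\<close>, so \<open>N(x - q)\<close> can be replaced by a quadratic
  extrapolation from three poles in that hole; the error decays like \<open>|x - q|\<close> to the power \<open>- (d + 1)\<close>,
  hence is integrable over the whole space. After discretizing \<open>\<rho>\<close> one obtains a finite sum of
  Newton kernels with poles far from \<open>K\<close>, uniformly close to \<open>f\<close>, and the mean value property
  turns closeness into the gradient bound. Conversely, apply the approximation with
  \<open>\<delta> = |x - y|\<close>: the segment from \<open>x\<close> to \<open>y\<close> lies in the \<open>\<delta>\<close>-neighborhood of \<open>K\<close>.
\<close>

section \<open>Second differences and radial functions\<close>

text \<open>The obstacle is that nothing bounds the total mass of \<rho>: it may spread over a
  region much larger than the unit scale, whereas the constants must not see the diameter of
  \<open>K\<close>. Only a pointwise bound of \<rho> is available, so the error of replacing a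
  kernel has to be integrable in the pole q over the whole space. The Newton kernel is |x| to the
  power 2 - d, and extrapolation of degree j from nodes at bounded distance gains j + 1 powers. A
  linear one would give - d, which just fails to be integrable, so degree two is the least that
  works. The code writes 2 * a for d - 2, and the exponent appears as 2 * a + 3. The regularization
  is there because q may lie in \<open>K\<close> itself; the poles finally used are far enough away
  for the regularized and the true kernel to coincide near \<open>K\<close>. Distances to
  \<open>K\<close> at unit scale are tiered: hole centers at 4, poles at 3, uniform approximation
  within 2, Lipschitz bound within 1. The unit lost at each tier pays for the spread of the nodes,
  the radius of regularization and the averaging over unit balls.\<close>

text \<open>The Laplacian is taken as the limit of second differences: integration by parts then reduces to
  translation invariance of the Lebesgue measure and dominated convergence.\<close>

definition second_diff :: "nat \<Rightarrow> ('a::euclidean_space \<Rightarrow> real) \<Rightarrow> 'a \<Rightarrow> real" where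
  "second_diff n u y = (\<Sum>b\<in>Basis. (u (y + b /\<^sub>R Suc n) + u (y - b /\<^sub>R Suc n) - 2 * u y) * (real (Suc n))\<^sup>2)"

text \<open>The bound, uniform in \<open>n\<close> and \<open>y\<close>, is the dominating constant
  wherever a limit is taken under an integral. As a pointwise limit, \<open>U\<close> is measurable
  as soon as \<open>u\<close> is.\<close>

definition has_weak_laplacian :: "('a::euclidean_space \<Rightarrow> real) \<Rightarrow> ('a \<Rightarrow> real) \<Rightarrow> bool" where
  "has_weak_laplacian u U \<longleftrightarrow>
     (\<exists>B. \<forall>n y. \<bar>second_diff n u y\<bar> \<le> B) \<and> (\<forall>y. (\<lambda>n. second_diff n u y) \<longlonglongrightarrow> U y)"

lemma has_weak_laplacian_const: "has_weak_laplacian (\<lambda>_. c) (\<lambda>_. 0)"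
  unfolding has_weak_laplacian_def second_diff_def by auto

lemma has_weak_laplacian_diff:
  assumes "has_weak_laplacian u U" "has_weak_laplacian v V"
  shows "has_weak_laplacian (\<lambda>x. u x - v x) (\<lambda>x. U x - V x)"
proof -
  have eq: "second_diff n (\<lambda>x. u x - v x) y = second_diff n u y - second_diff n v y" for n y
    unfolding second_diff_def sum_subtractf[symmetric] by (simp add: algebra_simps)
  obtain A B where AB: "\<And>n y. \<bar>second_diff n u y\<bar> \<le> A" "\<And>n y. \<bar>second_diff n v y\<bar> \<le> B"
    using assms unfolding has_weak_laplacian_def by blast
  have "\<bar>second_diff n (\<lambda>x. u x - v x) y\<bar> \<le> A + B" for n y
    unfolding eq using AB(1)[of n y] AB(2)[of n y] by linarith
  moreover have "(\<lambda>n. second_diff n (\<lambda>x. u x - v x) y) \<longlonglongrightarrow> U y - V y" for y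
    unfolding eq using assms unfolding has_weak_laplacian_def by (intro tendsto_diff) auto
  ultimately show ?thesis unfolding has_weak_laplacian_def by blast
qed

lemma has_weak_laplacian_reflect:
  assumes "has_weak_laplacian u U"
  shows "has_weak_laplacian (\<lambda>y. u (x - y)) (\<lambda>y. U (x - y))"
proof -
  have eq: "second_diff n (\<lambda>y. u (x - y)) y = second_diff n u (x - y)" for n y
    unfolding second_diff_def
    by (intro sum.cong refl) (simp add: algebra_simps)
  show ?thesis using assms unfolding has_weak_laplacian_def eq by blast
qed

text \<open>Taylor expansion at 0 with Lagrange remainder, once to each side: the first-order terms
  cancel, and each side contributes its own intermediate point.\<close>

lemma second_difference_mean_value:
  fixes \<phi> \<phi>' \<phi>'' :: "real \<Rightarrow> real"
  assumes "\<And>s. (\<phi> has_real_derivative \<phi>' s) (at s)"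
    and "\<And>s. (\<phi>' has_real_derivative \<phi>'' s) (at s)" and "0 < h"
  shows "\<exists>\<xi> \<xi>'. \<bar>\<xi>\<bar> \<le> h \<and> \<bar>\<xi>'\<bar> \<le> h \<and> \<phi> h + \<phi> (- h) - 2 * \<phi> 0 = h\<^sup>2 / 2 * (\<phi>'' \<xi> + \<phi>'' \<xi>')"
proof -
  define D where "D = (\<lambda>n::nat. if n = 0 then \<phi> else if n = 1 then \<phi>' else \<phi>'')"
  have D: "\<forall>m t. m < 2 \<and> P t \<longrightarrow> (D m has_real_derivative D (Suc m) t) (at t)" for P
    using assms by (auto simp: D_def less_Suc_eq numeral_2_eq_2)
  obtain t where t: "0 < t" "t < h" "\<phi> h = (\<Sum>m<2. D m 0 / fact m * h ^ m) + D 2 t / fact 2 * h ^ 2"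
    using Maclaurin[of h 2 D \<phi>] D assms(3) by (auto simp: D_def)
  obtain t' where t': "- h < t'" "t' < 0" "\<phi> (-h) = (\<Sum>m<2. D m 0 / fact m * (-h) ^ m) + D 2 t' / fact 2 * (-h) ^ 2"
    using Maclaurin_minus[of "-h" 2 D \<phi>] D assms(3) by (auto simp: D_def)
  show ?thesis
    using t t' by (intro exI[of _ t] exI[of _ t']) (auto simp: D_def numeral_2_eq_2 algebra_simps)
qed

text \<open>With s the squared norm, the second derivative along a coordinate vector b is g''(s) *
  (2 (x . b))^2 + 2 g'(s). Summing over the basis gives the Laplacian, and (x . b)^2 <= s explains
  the quantity bounded by \<open>B\<close>. Working with s instead of the norm avoids a singularity
  at the origin.\<close>

lemma has_weak_laplacian_radial:
  fixes g g' g'' :: "real \<Rightarrow> real"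
  assumes g: "\<And>s. (g has_real_derivative g' s) (at s)"
    and g': "\<And>s. (g' has_real_derivative g'' s) (at s)"
    and cont: "\<And>s. isCont g'' s"
    and B: "\<And>s. 0 \<le> s \<Longrightarrow> 4 * s * \<bar>g'' s\<bar> + 2 * \<bar>g' s\<bar> \<le> B"
  shows "has_weak_laplacian (\<lambda>x::'a::euclidean_space. g (x \<bullet> x))
           (\<lambda>x. 4 * (x \<bullet> x) * g'' (x \<bullet> x) + 2 * DIM('a) * g' (x \<bullet> x))"
proof -
  let ?u = "\<lambda>x::'a. g (x \<bullet> x)"
  define q where "q = (\<lambda>(y::'a) b s. (y + s *\<^sub>R b) \<bullet> (y + s *\<^sub>R b))"
  define \<Phi> where "\<Phi> = (\<lambda>y b s. g'' (q y b s) * (2 * ((y + s *\<^sub>R b) \<bullet> b))\<^sup>2 + 2 * g' (q y b s))"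
  have ex: "\<exists>\<xi> \<xi>'. \<bar>\<xi>\<bar> \<le> inverse (Suc n) \<and> \<bar>\<xi>'\<bar> \<le> inverse (Suc n) \<and>
      (?u (y + b /\<^sub>R Suc n) + ?u (y - b /\<^sub>R Suc n) - 2 * ?u y) * (real (Suc n))\<^sup>2 = (\<Phi> y b \<xi> + \<Phi> y b \<xi>') / 2"
    if b: "b \<in> Basis" for y b n
  proof -
    have qd: "((\<lambda>s. q y b s) has_real_derivative 2 * ((y + s *\<^sub>R b) \<bullet> b)) (at s)" for s
      unfolding q_def using b
      by (auto intro!: derivative_eq_intros simp: has_field_derivative_def inner_add_left inner_add_right inner_commute algebra_simps
          intro!: ext)
    have q2: "((\<lambda>s. 2 * ((y + s *\<^sub>R b) \<bullet> b)) has_real_derivative 2) (at s)" for s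
      using b by (auto intro!: derivative_eq_intros simp: inner_add_left)
    have d1: "((\<lambda>s. g (q y b s)) has_real_derivative g' (q y b s) * (2 * ((y + s *\<^sub>R b) \<bullet> b))) (at s)" for s
      using DERIV_chain2[OF g qd] .
    have d2: "((\<lambda>s. g' (q y b s) * (2 * ((y + s *\<^sub>R b) \<bullet> b))) has_real_derivative \<Phi> y b s) (at s)" for s
      using DERIV_mult[OF DERIV_chain2[OF g' qd] q2, of s]
      by (simp add: \<Phi>_def power2_eq_square algebra_simps)
    obtain \<xi> \<xi>' where x: "\<bar>\<xi>\<bar> \<le> inverse (Suc n)" "\<bar>\<xi>'\<bar> \<le> inverse (Suc n)"
      "g (q y b (inverse (Suc n))) + g (q y b (- inverse (Suc n))) - 2 * g (q y b 0) = (inverse (real (Suc n)))\<^sup>2 / 2 * (\<Phi> y b \<xi> + \<Phi> y b \<xi>')"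
      using second_difference_mean_value[OF d1 d2, of "inverse (Suc n)"] by auto
    have "(?u (y + b /\<^sub>R Suc n) + ?u (y - b /\<^sub>R Suc n) - 2 * ?u y) = (inverse (real (Suc n)))\<^sup>2 / 2 * (\<Phi> y b \<xi> + \<Phi> y b \<xi>')"
      using x(3) by (simp add: q_def)
    moreover have "(inverse (real (Suc n)))\<^sup>2 / 2 * c * (real (Suc n))\<^sup>2 = c / 2" for c
      by (simp add: power2_eq_square field_simps del: of_nat_Suc)
    ultimately show ?thesis using x(1,2) by metis
  qed
  have bd: "\<bar>\<Phi> y b s\<bar> \<le> B" if b: "b \<in> Basis" for y b s
  proof -
    let ?w = "y + s *\<^sub>R b"
    have "(?w \<bullet> b)\<^sup>2 \<le> ?w \<bullet> ?w"
      using Cauchy_Schwarz_ineq[of ?w b] b by simp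
    then have "\<bar>g'' (q y b s) * (2 * (?w \<bullet> b))\<^sup>2\<bar> \<le> \<bar>g'' (q y b s)\<bar> * (4 * q y b s)"
      unfolding abs_mult by (intro mult_left_mono) (auto simp: q_def power_mult_distrib)
    then have *: "\<bar>g'' (q y b s) * (2 * (?w \<bullet> b))\<^sup>2\<bar> \<le> 4 * q y b s * \<bar>g'' (q y b s)\<bar>"
      by (simp only: mult_ac)
    have "\<bar>\<Phi> y b s\<bar> \<le> 4 * q y b s * \<bar>g'' (q y b s)\<bar> + 2 * \<bar>g' (q y b s)\<bar>"
      unfolding \<Phi>_def by (rule order_trans[OF abs_triangle_ineq add_mono[OF *]]) simp
    also have "\<dots> \<le> B" by (intro B) (simp add: q_def)
    finally show ?thesis .
  qed
  have "\<bar>second_diff n ?u y\<bar> \<le> DIM('a) * B" for n y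
  proof -
    have "\<bar>second_diff n ?u y\<bar> \<le> (\<Sum>b\<in>(Basis::'a set). B)"
      unfolding second_diff_def
    proof (rule order_trans[OF sum_abs sum_mono])
      fix b :: 'a assume b: "b \<in> Basis"
      obtain \<xi> \<xi>' where x: "(?u (y + b /\<^sub>R Suc n) + ?u (y - b /\<^sub>R Suc n) - 2 * ?u y) * (real (Suc n))\<^sup>2 = (\<Phi> y b \<xi> + \<Phi> y b \<xi>') / 2"
        using ex[OF b] by blast
      show "\<bar>(?u (y + b /\<^sub>R Suc n) + ?u (y - b /\<^sub>R Suc n) - 2 * ?u y) * (real (Suc n))\<^sup>2\<bar> \<le> B"
        unfolding x using bd[OF b, of y \<xi>] bd[OF b, of y \<xi>'] by simp
    qed
    then show ?thesis by simp
  qed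
  moreover have "(\<lambda>n. second_diff n ?u y) \<longlonglongrightarrow> 4 * (y \<bullet> y) * g'' (y \<bullet> y) + 2 * DIM('a) * g' (y \<bullet> y)" for y :: 'a
  proof -
    have "(\<lambda>n. second_diff n ?u y) \<longlonglongrightarrow> (\<Sum>b\<in>Basis. \<Phi> y b 0)"
      unfolding second_diff_def
    proof (intro tendsto_sum)
      fix b :: 'a assume b: "b \<in> Basis"
      obtain \<xi> \<xi>' where x: "\<And>n. \<bar>\<xi> n\<bar> \<le> inverse (Suc n)" "\<And>n. \<bar>\<xi>' n\<bar> \<le> inverse (Suc n)"
        "\<And>n. (?u (y + b /\<^sub>R Suc n) + ?u (y - b /\<^sub>R Suc n) - 2 * ?u y) * (real (Suc n))\<^sup>2 = (\<Phi> y b (\<xi> n) + \<Phi> y b (\<xi>' n)) / 2"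
        using ex[OF b, of _ y] by metis
      have g'c: "isCont g' s" for s using g' DERIV_isCont by blast
      have qc: "isCont (q y b) 0" unfolding q_def by (intro continuous_intros)
      have "isCont (\<Phi> y b) 0"
        unfolding \<Phi>_def
        by (intro continuous_intros isCont_o2[OF qc] g'c cont)
      moreover have "\<xi> \<longlonglongrightarrow> 0" "\<xi>' \<longlonglongrightarrow> 0"
        using x(1,2) by (auto intro!: Lim_null_comparison[OF _ LIMSEQ_inverse_real_of_nat])
      ultimately have "(\<lambda>n. \<Phi> y b (\<xi> n)) \<longlonglongrightarrow> \<Phi> y b 0" "(\<lambda>n. \<Phi> y b (\<xi>' n)) \<longlonglongrightarrow> \<Phi> y b 0"
        by (auto intro: isCont_tendsto_compose)
      from tendsto_divide[OF tendsto_add[OF this] tendsto_const[of 2]]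
      show "(\<lambda>n. (?u (y + b /\<^sub>R Suc n) + ?u (y - b /\<^sub>R Suc n) - 2 * ?u y) * (real (Suc n))\<^sup>2) \<longlonglongrightarrow> \<Phi> y b 0"
        unfolding x(3) by simp
    qed
    also have "(\<Sum>b\<in>Basis. \<Phi> y b 0) = (\<Sum>b\<in>Basis. g'' (y \<bullet> y) * (4 * (y \<bullet> b)\<^sup>2)) + (\<Sum>b\<in>(Basis::'a set). 2 * g' (y \<bullet> y))"
      unfolding sum.distrib[symmetric] by (simp add: \<Phi>_def q_def power_mult_distrib)
    also have "\<dots> = g'' (y \<bullet> y) * (4 * (\<Sum>b\<in>Basis. (y \<bullet> b)\<^sup>2)) + 2 * DIM('a) * g' (y \<bullet> y)"
      by (simp add: sum_distrib_left)
    also have "(\<Sum>b\<in>Basis. (y \<bullet> b)\<^sup>2) = y \<bullet> y"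
      by (subst euclidean_inner[of y y]) (simp add: power2_eq_square)
    finally show ?thesis by (simp add: algebra_simps)
  qed
  ultimately show ?thesis unfolding has_weak_laplacian_def by blast
qed

section \<open>Integration by parts and convolution\<close>

lemma integrable_bounded_support:
  fixes w :: "'a::euclidean_space \<Rightarrow> real"
  assumes [measurable]: "w \<in> borel_measurable borel"
    and B: "\<And>x. \<bar>w x\<bar> \<le> B" and r: "\<And>x. r < norm x \<Longrightarrow> w x = 0"
  shows "integrable lborel w"
proof -
  have "integrable lborel (\<lambda>x. indicator (cball 0 r) x * B)"
    by (intro integrable_mult_left integrable_real_indicator) (use emeasure_lborel_cball_finite in auto)
  then show ?thesis
    by (rule Bochner_Integration.integrable_bound)
      (measurable, intro AE_I2, use B r order_trans[OF B abs_ge_self] in \<open>auto simp: indicator_def not_le\<close>)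
qed

lemma lborel_integral_translate:
  fixes f :: "'a::euclidean_space \<Rightarrow> real"
  assumes [measurable]: "f \<in> borel_measurable borel"
  shows "(\<integral>y. f (y + c) \<partial>lborel) = (\<integral>y. f y \<partial>lborel)"
proof -
  have "(\<integral>y. f y \<partial>lborel) = (\<integral>y. f y \<partial>distr lborel borel ((+) c))"
    by (simp add: lborel_distr_plus)
  also have "\<dots> = (\<integral>y. f (c + y) \<partial>lborel)"
    by (subst integral_distr) auto
  finally show ?thesis by (simp add: add.commute)
qed

lemma borel_measurable_second_diff [measurable]:
  assumes [measurable]: "u \<in> borel_measurable borel"
  shows "second_diff n u \<in> borel_measurable borel"
  unfolding second_diff_def by measurable

lemma has_weak_laplacian_measurable:
  assumes "has_weak_laplacian u U" and [measurable]: "u \<in> borel_measurable borel"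
  shows "U \<in> borel_measurable borel"
proof (rule borel_measurable_LIMSEQ_real)
  show "(\<lambda>n. second_diff n u x) \<longlonglongrightarrow> U x" for x
    using assms unfolding has_weak_laplacian_def by blast
qed measurable

text \<open>The step 1 / Suc n is at most 1, so \<open>r + 1\<close> is a support radius valid for
  all \<open>n\<close> at once; dominated convergence needs this uniformity.\<close>

lemma second_diff_eq_0:
  assumes "\<And>x. r < norm x \<Longrightarrow> u x = 0" and "r + 1 < norm x"
  shows "second_diff n u x = 0"
proof -
  have n: "norm (b /\<^sub>R real (Suc n)) \<le> 1" if "b \<in> Basis" for b :: 'a
    using that by (simp add: divide_simps)
  have "u (x + b /\<^sub>R Suc n) = 0" "u (x - b /\<^sub>R Suc n) = 0" "u x = 0" if "b \<in> Basis" for b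
    using n[OF that] assms(2) norm_triangle_ineq4[of "x + b /\<^sub>R Suc n" "b /\<^sub>R Suc n"]
       norm_triangle_ineq[of "x - b /\<^sub>R Suc n" "b /\<^sub>R Suc n"]
    by (auto intro!: assms(1))
  then show ?thesis unfolding second_diff_def by (intro sum.neutral) auto
qed

text \<open>For each \<open>n\<close> the identity for second differences is exact, because
  translation invariance moves every shift from \<open>u\<close> to \<open>v\<close>; only the limit
  requires analysis. Compact support is asked of \<open>u\<close> alone, so that \<open>v\<close>
  may be a constant or a Newton kernel.\<close>

lemma weak_laplacian_ibp:
  fixes u v :: "'a::euclidean_space \<Rightarrow> real"
  assumes u: "has_weak_laplacian u U" and v: "has_weak_laplacian v V"
    and meas [measurable]: "u \<in> borel_measurable borel" "v \<in> borel_measurable borel"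
    and Bu: "\<And>x. \<bar>u x\<bar> \<le> Bu" and Bv: "\<And>x. \<bar>v x\<bar> \<le> Bv"
    and supp: "\<And>x. r < norm x \<Longrightarrow> u x = 0"
  shows "(\<integral>y. U y * v y \<partial>lborel) = (\<integral>y. u y * V y \<partial>lborel)"
proof -
  note [measurable] = has_weak_laplacian_measurable[OF u] has_weak_laplacian_measurable[OF v]
  obtain BU where BU: "\<And>n y. \<bar>second_diff n u y\<bar> \<le> BU"
    using u unfolding has_weak_laplacian_def by blast
  obtain BV where BV: "\<And>n y. \<bar>second_diff n v y\<bar> \<le> BV"
    using v unfolding has_weak_laplacian_def by blast
  have Bu0: "0 \<le> Bu" and BU0: "0 \<le> BU" and Bv0: "0 \<le> Bv"
    using Bu[of 0] BU[of 0 0] Bv[of 0] by linarith+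
  have int: "integrable lborel (\<lambda>y. u (y + c) * v (y + c'))" for c c'
  proof (rule integrable_bounded_support[where B = "Bu * Bv" and r = "r + norm c"])
    show "\<bar>u (x + c) * v (x + c')\<bar> \<le> Bu * Bv" for x
      unfolding abs_mult by (intro mult_mono Bu Bv) (use Bu0 in auto)
    show "u (x + c) * v (x + c') = 0" if "r + norm c < norm x" for x
      using that norm_triangle_ineq4[of "x + c" c] by (simp add: supp)
  qed measurable
  have int': "integrable lborel (\<lambda>y. u (y + c) * v y)" "integrable lborel (\<lambda>y. u (y - c) * v y)"
    "integrable lborel (\<lambda>y. u y * v (y + c))" "integrable lborel (\<lambda>y. u y * v (y - c))"
    "integrable lborel (\<lambda>y. u y * v y)" for c
    using int[of c 0] int[of "-c" 0] int[of 0 c] int[of 0 "-c"] int[of 0 0] by simp_all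
  have sh: "(\<integral>y. u (y + c) * v y \<partial>lborel) = (\<integral>y. u y * v (y - c) \<partial>lborel)"
    "(\<integral>y. u (y - c) * v y \<partial>lborel) = (\<integral>y. u y * v (y + c) \<partial>lborel)" for c
    using lborel_integral_translate[of "\<lambda>y. u y * v (y - c)" c]
      lborel_integral_translate[of "\<lambda>y. u y * v (y + c)" "-c"] by simp_all
  have eq: "(\<integral>y. second_diff n u y * v y \<partial>lborel) = (\<integral>y. u y * second_diff n v y \<partial>lborel)" for n
  proof -
    let ?N = "(real (Suc n))\<^sup>2"
    have "(\<integral>y. second_diff n u y * v y \<partial>lborel)
       = (\<integral>y. (\<Sum>b\<in>Basis. (u (y + b /\<^sub>R Suc n) * v y + u (y - b /\<^sub>R Suc n) * v y - 2 * (u y * v y)) * ?N) \<partial>lborel)"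
      unfolding second_diff_def sum_distrib_right
      by (intro Bochner_Integration.integral_cong sum.cong refl) (simp add: algebra_simps)
    also have "\<dots> = (\<Sum>b\<in>Basis. ((\<integral>y. u (y + b /\<^sub>R Suc n) * v y \<partial>lborel) + (\<integral>y. u (y - b /\<^sub>R Suc n) * v y \<partial>lborel)
         - 2 * (\<integral>y. u y * v y \<partial>lborel)) * ?N)"
      by (simp add: int' del: of_nat_Suc)
    also have "\<dots> = (\<Sum>b\<in>Basis. ((\<integral>y. u y * v (y + b /\<^sub>R Suc n) \<partial>lborel) + (\<integral>y. u y * v (y - b /\<^sub>R Suc n) \<partial>lborel)
         - 2 * (\<integral>y. u y * v y \<partial>lborel)) * ?N)"
      unfolding sh by (simp add: algebra_simps)
    also have "\<dots> = (\<integral>y. (\<Sum>b\<in>Basis. (u y * v (y + b /\<^sub>R Suc n) + u y * v (y - b /\<^sub>R Suc n) - 2 * (u y * v y)) * ?N) \<partial>lborel)"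
      by (simp add: int' del: of_nat_Suc)
    also have "\<dots> = (\<integral>y. u y * second_diff n v y \<partial>lborel)"
      unfolding second_diff_def sum_distrib_left
      by (intro Bochner_Integration.integral_cong sum.cong refl) (simp add: algebra_simps)
    finally show ?thesis .
  qed
  have "(\<lambda>n. \<integral>y. second_diff n u y * v y \<partial>lborel) \<longlonglongrightarrow> (\<integral>y. U y * v y \<partial>lborel)"
  proof (rule integral_dominated_convergence[where w = "\<lambda>y. indicator (cball 0 (r + 1)) y * (BU * Bv)"])
    show "integrable lborel (\<lambda>y::'a. indicator (cball 0 (r + 1)) y * (BU * Bv))"
      by (intro integrable_mult_left integrable_real_indicator) (use emeasure_lborel_cball_finite in auto)
    show "AE y in lborel. (\<lambda>n. second_diff n u y * v y) \<longlonglongrightarrow> U y * v y"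
      using u unfolding has_weak_laplacian_def by (intro AE_I2 tendsto_mult) auto
    show "AE y in lborel. norm (second_diff n u y * v y) \<le> indicator (cball 0 (r + 1)) y * (BU * Bv)" for n
    proof (rule AE_I2)
      fix y :: 'a
      show "norm (second_diff n u y * v y) \<le> indicator (cball 0 (r + 1)) y * (BU * Bv)"
      proof (cases "norm y \<le> r + 1")
        case True
        then show ?thesis by (auto simp: abs_mult intro!: mult_mono BU Bv BU0)
      next
        case False
        then show ?thesis using second_diff_eq_0[of r u y n] supp by auto
      qed
    qed
  qed measurable
  moreover have "(\<lambda>n. \<integral>y. u y * second_diff n v y \<partial>lborel) \<longlonglongrightarrow> (\<integral>y. u y * V y \<partial>lborel)"
  proof (rule integral_dominated_convergence[where w = "\<lambda>y. \<bar>u y\<bar> * BV"])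
    show "integrable lborel (\<lambda>y. \<bar>u y\<bar> * BV)"
      by (intro integrable_mult_left integrable_abs integrable_bounded_support[where B = Bu and r = r] Bu supp) measurable
    show "AE y in lborel. (\<lambda>n. u y * second_diff n v y) \<longlonglongrightarrow> u y * V y"
      using v unfolding has_weak_laplacian_def by (intro AE_I2 tendsto_mult) auto
    show "AE y in lborel. norm (u y * second_diff n v y) \<le> \<bar>u y\<bar> * BV" for n
      using BV by (intro AE_I2) (auto simp: abs_mult intro!: mult_left_mono)
  qed measurable
  ultimately show ?thesis unfolding eq by (rule LIMSEQ_unique)
qed

text \<open>All differences fall on the kernel \<open>e\<close>, so integrability of
  \<open>f\<close> is enough; in this way a merely continuous function acquires a Laplacian after
  mollification.\<close>

lemma has_weak_laplacian_convolution:
  fixes e f :: "'a::euclidean_space \<Rightarrow> real"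
  assumes e: "has_weak_laplacian e E"
    and [measurable]: "e \<in> borel_measurable borel" and Be: "\<And>x. \<bar>e x\<bar> \<le> Be"
    and f: "integrable lborel f"
  shows "has_weak_laplacian (\<lambda>y. \<integral>w. f w * e (y - w) \<partial>lborel) (\<lambda>y. \<integral>w. f w * E (y - w) \<partial>lborel)"
proof -
  note [measurable] = has_weak_laplacian_measurable[OF e]
  have [measurable]: "f \<in> borel_measurable borel" using f by simp
  obtain B where B: "\<And>n y. \<bar>second_diff n e y\<bar> \<le> B"
    using e unfolding has_weak_laplacian_def by blast
  have int: "integrable lborel (\<lambda>w. f w * e (y - w))" for y
    by (rule Bochner_Integration.integrable_bound[where f = "\<lambda>w. f w * Be"])
      (use f in \<open>auto simp: abs_mult intro!: mult_mono order_trans[OF Be]\<close>)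
  have eq: "second_diff n (\<lambda>y. \<integral>w. f w * e (y - w) \<partial>lborel) y = (\<integral>w. f w * second_diff n e (y - w) \<partial>lborel)" for n y
  proof -
    have "(\<integral>w. f w * second_diff n e (y - w) \<partial>lborel) = (\<integral>w. (\<Sum>b\<in>Basis. (f w * e (y + b /\<^sub>R Suc n - w) 
        + f w * e (y - b /\<^sub>R Suc n - w) - 2 * (f w * e (y - w))) * (real (Suc n))\<^sup>2) \<partial>lborel)"
      unfolding second_diff_def sum_distrib_left
      by (intro Bochner_Integration.integral_cong sum.cong refl) (simp add: algebra_simps)
    then show ?thesis by (simp add: int second_diff_def del: of_nat_Suc)
  qed
  have intB: "integrable lborel (\<lambda>w. \<bar>f w\<bar> * B)" using f by simp
  have bd: "norm (f w * second_diff n e (y - w)) \<le> \<bar>f w\<bar> * B" for n w y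
    by (auto simp: abs_mult intro!: mult_left_mono B)
  have "\<bar>second_diff n (\<lambda>y. \<integral>w. f w * e (y - w) \<partial>lborel) y\<bar> \<le> (\<integral>w. \<bar>f w\<bar> * B \<partial>lborel)" for n y
  proof -
    have "integrable lborel (\<lambda>w. f w * second_diff n e (y - w))"
      by (rule Bochner_Integration.integrable_bound[OF intB])
        (measurable, intro AE_I2, use order_trans[OF bd abs_ge_self] in simp)
    then have "\<bar>\<integral>w. f w * second_diff n e (y - w) \<partial>lborel\<bar> \<le> (\<integral>w. \<bar>f w\<bar> * B \<partial>lborel)"
      using bd[of _ n y] by (intro integral_abs_bound_integral intB) auto
    then show ?thesis unfolding eq by simp
  qed
  moreover have "(\<lambda>n. second_diff n (\<lambda>y. \<integral>w. f w * e (y - w) \<partial>lborel) y) \<longlonglongrightarrow> (\<integral>w. f w * E (y - w) \<partial>lborel)" for y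
    unfolding eq
  proof (rule integral_dominated_convergence[OF _ _ intB])
    show "AE w in lborel. (\<lambda>n. f w * second_diff n e (y - w)) \<longlonglongrightarrow> f w * E (y - w)"
      using e unfolding has_weak_laplacian_def by (intro AE_I2 tendsto_mult) auto
    show "AE w in lborel. norm (f w * second_diff n e (y - w)) \<le> \<bar>f w\<bar> * B" for n
      using bd by (intro AE_I2)
  qed measurable
  ultimately show ?thesis unfolding has_weak_laplacian_def by blast
qed

section \<open>The regularized Newton kernel\<close>

text \<open>\<open>f\<close> is differentiable on the positive axis only, since it will be a real
  power. At the joint the two one-sided difference quotients have the same limit.\<close>

lemma DERIV_glue:
  fixes f g f' g' :: "real \<Rightarrow> real"
  assumes f: "\<And>s. 0 < s \<Longrightarrow> (f has_real_derivative f' s) (at s)"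
    and g: "\<And>s. (g has_real_derivative g' s) (at s)"
    and eq: "f 1 = g 1" "f' 1 = g' 1"
  shows "((\<lambda>s. if 1 \<le> s then f s else g s) has_real_derivative (if 1 \<le> s then f' s else g' s)) (at s)"
proof -
  let ?h = "\<lambda>s. if 1 \<le> s then f s else g s"
  consider "s < 1" | "1 < s" | "s = 1" by linarith
  then show ?thesis
  proof cases
    case 1
    then have "(?h has_real_derivative g' s) (at s)"
      by (intro has_field_derivative_transform_within_open[OF g, where S = "{..<1}"]) auto
    then show ?thesis using 1 by simp
  next
    case 2
    then have "(?h has_real_derivative f' s) (at s)"
      by (intro has_field_derivative_transform_within_open[OF f, where S = "{1<..}"]) auto
    then show ?thesis using 2 by simp
  next
    case 3
    have f1: "((\<lambda>y. (f y - f 1) / (y - 1)) \<longlongrightarrow> f' 1) (at 1)"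
      using f[of 1] by (simp add: has_field_derivative_iff)
    have g1: "((\<lambda>y. (g y - g 1) / (y - 1)) \<longlongrightarrow> g' 1) (at 1)"
      using g[of 1] by (simp add: has_field_derivative_iff)
    have "((\<lambda>y. (?h y - ?h 1) / (y - 1)) \<longlongrightarrow> f' 1) (at_right 1)"
      by (rule Lim_transform_eventually[OF filterlim_mono[OF f1 order_refl at_le]])
        (auto simp: eventually_at_filter)
    moreover have "((\<lambda>y. (?h y - ?h 1) / (y - 1)) \<longlongrightarrow> f' 1) (at_left 1)"
      unfolding eq(2)
      by (rule Lim_transform_eventually[OF filterlim_mono[OF g1 order_refl at_le]])
        (auto simp: eventually_at_filter eq)
    ultimately have "((\<lambda>y. (?h y - ?h 1) / (y - 1)) \<longlongrightarrow> f' 1) (at 1)"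
      by (simp add: filterlim_split_at)
    then show ?thesis using 3 by (simp add: has_field_derivative_iff)
  qed
qed

lemma isCont_glue:
  fixes f g :: "real \<Rightarrow> real"
  assumes f: "\<And>s. 0 < s \<Longrightarrow> isCont f s" and g: "\<And>s. isCont g s" and eq: "f 1 = g 1"
  shows "isCont (\<lambda>s. if 1 \<le> s then f s else g s) s"
proof -
  let ?h = "\<lambda>s. if 1 \<le> s then f s else g s"
  have "continuous_on ({1..} \<union> {..1}) ?h"
    using assms
    by (intro continuous_on_cases)
      (auto intro!: continuous_at_imp_continuous_on f g eq dest: order_antisym)
  moreover have "{1..} \<union> {..1} = (UNIV :: real set)" by auto
  ultimately show ?thesis by (simp add: continuous_on_eq_continuous_at)
qed

text \<open>Below \<open>1\<close> the power \<open>s powr (- a)\<close> is continued by its second-order Taylor polynomial at \<open>1\<close>, which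
  keeps it of class \<open>C\<^sup>2\<close>.\<close>

definition reg_power :: "real \<Rightarrow> real \<Rightarrow> real" where
  "reg_power a s = (if 1 \<le> s then s powr (- a) else 1 - a * (s - 1) + a * (a + 1) / 2 * (s - 1)\<^sup>2)"

definition reg_power' :: "real \<Rightarrow> real \<Rightarrow> real" where
  "reg_power' a s = (if 1 \<le> s then - a * s powr (- a - 1) else - a + a * (a + 1) * (s - 1))"

definition reg_power'' :: "real \<Rightarrow> real \<Rightarrow> real" where
  "reg_power'' a s = (if 1 \<le> s then a * (a + 1) * s powr (- a - 2) else a * (a + 1))"

lemma reg_power_deriv: "(reg_power a has_real_derivative reg_power' a s) (at s)"
  unfolding reg_power_def reg_power'_def
  by (rule DERIV_glue) (auto intro!: derivative_eq_intros simp: field_simps)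

lemma reg_power'_deriv: "(reg_power' a has_real_derivative reg_power'' a s) (at s)"
  unfolding reg_power'_def reg_power''_def
  by (rule DERIV_glue) (auto intro!: derivative_eq_intros simp: field_simps)

lemma reg_power''_cont: "isCont (reg_power'' a) s"
  unfolding reg_power''_def
  by (rule isCont_glue) (auto intro!: continuous_intros)

lemma reg_power_cont: "isCont (reg_power a) s" "isCont (reg_power' a) s"
  using reg_power_deriv reg_power'_deriv DERIV_isCont by blast+

text \<open>If \<open>2 * a + 2\<close> is the dimension and \<open>s\<close> the squared norm, the
  left side is the Laplacian given by \<open>has_weak_laplacian_radial\<close>. Beyond 1 it
  vanishes, the power being harmonic there; inside, for positive \<open>a\<close>, it has one sign.
  Smoothing the kernel thus spreads the point mass at its pole over the unit ball.\<close>

lemma reg_power_laplacian: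
  "4 * s * reg_power'' a s + 2 * (2 * a + 2) * reg_power' a s = - 4 * a * (a + 1) * (a + 2) * max 0 (1 - s)"
proof (cases "1 \<le> s")
  case True
  moreover have "- a - 1 = 1 + (- a - 2)" by simp
  ultimately have "s * s powr (- a - 2) = s powr (- a - 1)"
    by (metis powr_mult_base order_trans zero_le_one)
  then have "s * (a * (a + 1) * s powr (- a - 2)) = a * (a + 1) * s powr (- a - 1)" by simp
  then show ?thesis using True unfolding reg_power'_def reg_power''_def by (simp add: algebra_simps)
next
  case False
  then show ?thesis unfolding reg_power'_def reg_power''_def by (simp add: algebra_simps)
qed

text \<open>The last two bounds are what the boundedness hypothesis of
  \<open>has_weak_laplacian_radial\<close> comes down to. The constants are crude sums of Taylor
  coefficients at 1.\<close>

lemma reg_power_bounds: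
  assumes "0 < a" "0 \<le> s"
  shows "0 < reg_power a s" "reg_power a s \<le> 1 + a + a * (a + 1)"
    "\<bar>reg_power' a s\<bar> \<le> a + a * (a + 1)" "s * \<bar>reg_power'' a s\<bar> \<le> a * (a + 1)"
proof -
  have le1: "s powr (- b) \<le> 1" if "1 \<le> s" "0 \<le> b" for b
    using that powr_mono[of "-b" 0 s] by simp
  have sq: "(s - 1)\<^sup>2 \<le> 1" if "s < 1" using that assms by (simp add: abs_square_le_1)
  show "0 < reg_power a s" 
  proof (cases "1 \<le> s")
    case False
    have "a * (s - 1) \<le> 0" "0 \<le> a * (a + 1) / 2 * (s - 1)\<^sup>2"
      using False assms by (auto intro!: mult_nonneg_nonpos)
    then show ?thesis using False by (simp add: reg_power_def)
  qed (auto simp: reg_power_def)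
  show "reg_power a s \<le> 1 + a + a * (a + 1)"
  proof (cases "1 \<le> s")
    case True
    then show ?thesis using le1[of a] assms by (simp add: reg_power_def add_increasing2)
  next
    case False
    have "- a * (s - 1) \<le> a" using assms by (simp add: algebra_simps)
    moreover have "a * (a + 1) / 2 * (s - 1)\<^sup>2 \<le> a * (a + 1) * 1"
      using False sq assms by (intro mult_mono) auto
    ultimately show ?thesis using False by (simp add: reg_power_def)
  qed
  show "\<bar>reg_power' a s\<bar> \<le> a + a * (a + 1)"
  proof (cases "1 \<le> s")
    case True
    have "\<bar>- a * s powr (- a - 1)\<bar> \<le> a * 1" using le1[of "a + 1"] True assms by (simp add: abs_mult)
    then show ?thesis using True assms by (simp add: reg_power'_def add_increasing2)
  next
    case False
    have "\<bar>a * (a + 1) * (s - 1)\<bar> \<le> a * (a + 1) * 1" 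
      unfolding abs_mult using False assms by (intro mult_mono) auto
    then show ?thesis using False assms by (simp add: reg_power'_def)
  qed
  show "s * \<bar>reg_power'' a s\<bar> \<le> a * (a + 1)"
  proof (cases "1 \<le> s")
    case True
    then have "s * s powr (- a - 2) = s powr (- (a + 1))"
      using powr_mult_base[of s "- a - 2"] by (simp add: algebra_simps)
    then have "s * (a * (a + 1) * s powr (- a - 2)) = a * (a + 1) * s powr (-(a + 1))" by simp
    also have "\<dots> \<le> a * (a + 1) * 1" using le1[of "a + 1"] True assms by (intro mult_left_mono) auto
    finally show ?thesis using True assms by (simp add: reg_power''_def abs_mult)
  next
    case False
    then show ?thesis using assms by (simp add: reg_power''_def abs_mult mult_left_le_one_le)
  qed
qed

text \<open>The scaling is such that outside the ball of radius \<open>t\<close> the value is |x| to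
  the power - 2 * a for every \<open>t\<close>, so two of these kernels differ only on a bounded
  set.\<close>

definition reg_newton :: "real \<Rightarrow> real \<Rightarrow> 'a::euclidean_space \<Rightarrow> real" where
  "reg_newton a t x = t powr (- 2 * a) * reg_power a ((x \<bullet> x) / t\<^sup>2)"

text \<open>Minus the Laplacian of \<open>reg_newton a t\<close> in dimension 2 * a + 2: a
  continuous density on the ball of radius \<open>t\<close> in place of a multiple of the point
  mass.\<close>

definition reg_mass :: "real \<Rightarrow> real \<Rightarrow> 'a::euclidean_space \<Rightarrow> real" where
  "reg_mass a t x = t powr (- 2 * a) / t\<^sup>2 * (4 * a * (a + 1) * (a + 2) * max 0 (1 - (x \<bullet> x) / t\<^sup>2))"

lemma reg_newton_eq:
  assumes "0 < t" "t \<le> norm x"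
  shows "reg_newton a t x = (x \<bullet> x) powr (- a)"
proof -
  have "t\<^sup>2 \<le> x \<bullet> x" using assms by (simp add: dot_square_norm)
  then have "reg_power a ((x \<bullet> x) / t\<^sup>2) = (x \<bullet> x) powr (- a) / (t\<^sup>2) powr (- a)"
    using assms by (simp add: reg_power_def powr_divide)
  also have "(t\<^sup>2) powr (- a) = t powr (- 2 * a)"
    using assms by (simp add: powr_powr flip: powr_numeral)
  finally show ?thesis using assms by (simp add: reg_newton_def)
qed

lemma reg_mass_eq_0: "0 < t \<Longrightarrow> t \<le> norm x \<Longrightarrow> reg_mass a t x = 0"
  by (auto simp: reg_mass_def dot_square_norm)

lemma reg_mass_nonneg: "0 < a \<Longrightarrow> 0 \<le> reg_mass a t x"
  by (simp add: reg_mass_def)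

lemma reg_newton_continuous: "continuous_on A (reg_newton a t)"
proof -
  have *: "continuous_on UNIV (reg_power a)"
    by (simp add: reg_power_cont continuous_at_imp_continuous_on)
  show ?thesis unfolding reg_newton_def
    unfolding divide_inverse by (intro continuous_intros continuous_on_compose2[OF *]) auto
qed

lemma reg_mass_continuous: "continuous_on A (reg_mass a t)"
  unfolding reg_mass_def divide_inverse by (intro continuous_intros)

lemma reg_newton_bounded:
  assumes "0 < a"
  shows "\<bar>reg_newton a t x\<bar> \<le> t powr (- 2 * a) * (1 + a + a * (a + 1))"
  using reg_power_bounds[of a "(x \<bullet> x) / t\<^sup>2"] assms
  by (auto simp: reg_newton_def abs_mult intro!: mult_left_mono)

lemma reg_newton_laplacian:
  fixes a t :: real
  assumes "0 < a" "0 < t" and dim: "2 * a + 2 = DIM('a::euclidean_space)"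
  shows "has_weak_laplacian (reg_newton a t :: 'a \<Rightarrow> real) (\<lambda>x. - reg_mass a t x)"
proof -
  let ?c = "t powr (- 2 * a)"
  have d: "((\<lambda>s. ?c * reg_power a (s / t\<^sup>2)) has_real_derivative ?c / t\<^sup>2 * reg_power' a (s / t\<^sup>2)) (at s)" for s
    using DERIV_cmult[OF DERIV_chain2[OF reg_power_deriv DERIV_cdivide[OF DERIV_ident, of "t\<^sup>2"]], of ?c a] by (simp add: mult_ac)
  have d': "((\<lambda>s. ?c / t\<^sup>2 * reg_power' a (s / t\<^sup>2)) has_real_derivative ?c / t\<^sup>2 / t\<^sup>2 * reg_power'' a (s / t\<^sup>2)) (at s)" for s
    using DERIV_cmult[OF DERIV_chain2[OF reg_power'_deriv DERIV_cdivide[OF DERIV_ident, of "t\<^sup>2"]], of "?c / t\<^sup>2" a] by (simp add: mult_ac)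
  have "has_weak_laplacian (\<lambda>x::'a. ?c * reg_power a ((x \<bullet> x) / t\<^sup>2))
     (\<lambda>x. 4 * (x \<bullet> x) * (?c / t\<^sup>2 / t\<^sup>2 * reg_power'' a ((x \<bullet> x) / t\<^sup>2)) + 2 * DIM('a) * (?c / t\<^sup>2 * reg_power' a ((x \<bullet> x) / t\<^sup>2)))"
  proof (rule has_weak_laplacian_radial[OF d d'])
    show "isCont (\<lambda>s. ?c / t\<^sup>2 / t\<^sup>2 * reg_power'' a (s / t\<^sup>2)) s" for s
      unfolding divide_inverse by (intro continuous_intros isCont_o2[OF _ reg_power''_cont])
    show "4 * s * \<bar>?c / t\<^sup>2 / t\<^sup>2 * reg_power'' a (s / t\<^sup>2)\<bar> + 2 * \<bar>?c / t\<^sup>2 * reg_power' a (s / t\<^sup>2)\<bar>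
      \<le> ?c / t\<^sup>2 * (4 * (a * (a + 1))) + ?c / t\<^sup>2 * (2 * (a + a * (a + 1)))" if "0 \<le> s" for s
    proof (rule add_mono)
      have "4 * s * \<bar>?c / t\<^sup>2 / t\<^sup>2 * reg_power'' a (s / t\<^sup>2)\<bar> = ?c / t\<^sup>2 * (4 * ((s / t\<^sup>2) * \<bar>reg_power'' a (s / t\<^sup>2)\<bar>))"
        by (simp add: abs_mult)
      also have "\<dots> \<le> ?c / t\<^sup>2 * (4 * (a * (a + 1)))"
        using that assms by (intro mult_left_mono reg_power_bounds) auto
      finally show "4 * s * \<bar>?c / t\<^sup>2 / t\<^sup>2 * reg_power'' a (s / t\<^sup>2)\<bar> \<le> ?c / t\<^sup>2 * (4 * (a * (a + 1)))" .
      have "2 * \<bar>?c / t\<^sup>2 * reg_power' a (s / t\<^sup>2)\<bar> = ?c / t\<^sup>2 * (2 * \<bar>reg_power' a (s / t\<^sup>2)\<bar>)"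
        by (simp add: abs_mult)
      also have "\<dots> \<le> ?c / t\<^sup>2 * (2 * (a + a * (a + 1)))"
        using that assms by (intro mult_left_mono reg_power_bounds) auto
      finally show "2 * \<bar>?c / t\<^sup>2 * reg_power' a (s / t\<^sup>2)\<bar> \<le> ?c / t\<^sup>2 * (2 * (a + a * (a + 1)))" .
    qed
  qed
  moreover have "4 * s * (?c / t\<^sup>2 / t\<^sup>2 * reg_power'' a (s / t\<^sup>2)) + 2 * DIM('a) * (?c / t\<^sup>2 * reg_power' a (s / t\<^sup>2))
     = - (?c / t\<^sup>2 * (4 * a * (a + 1) * (a + 2) * max 0 (1 - s / t\<^sup>2)))" for s
    using arg_cong[OF reg_power_laplacian[of "s / t\<^sup>2" a], of "\<lambda>z. ?c / t\<^sup>2 * z"]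
    by (simp add: dim[symmetric] algebra_simps add_divide_distrib)
  ultimately show ?thesis unfolding reg_newton_def reg_mass_def by simp
qed

text \<open>The cube is the smallest integer power of the truncation that is twice continuously
  differentiable. The bump is not normalized; its integral appears later as \<eta>.\<close>

definition bump :: "'a::euclidean_space \<Rightarrow> real" where
  "bump x = (max 0 (1 - x \<bullet> x)) ^ 3"

definition bump_laplacian :: "'a::euclidean_space \<Rightarrow> real" where
  "bump_laplacian x = 24 * (x \<bullet> x) * max 0 (1 - x \<bullet> x) - 6 * DIM('a) * (max 0 (1 - x \<bullet> x))\<^sup>2"

lemma bump_laplacian: "has_weak_laplacian (bump :: 'a::euclidean_space \<Rightarrow> real) bump_laplacian"
proof -
  let ?g = "\<lambda>s::real. (max 0 (1 - s)) ^ 3" 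
  let ?g' = "\<lambda>s::real. - 3 * (max 0 (1 - s))\<^sup>2" 
  let ?g'' = "\<lambda>s::real. 6 * max 0 (1 - s)"
  have eq: "?g = (\<lambda>s. if 1 \<le> s then 0 else (1 - s) ^ 3)" "?g' = (\<lambda>s. if 1 \<le> s then 0 else - 3 * (1 - s)\<^sup>2)"
    "?g'' = (\<lambda>s. if 1 \<le> s then 0 else 6 * (1 - s))"
    by (auto simp: max_def)
  have d: "(?g has_real_derivative ?g' s) (at s)" for s
    unfolding eq(1) fun_cong[OF eq(2), of s]
    by (rule DERIV_glue[where f' = "\<lambda>_. 0" and g' = "\<lambda>s. - 3 * (1 - s)\<^sup>2"])
      (auto intro!: derivative_eq_intros)
  have d': "(?g' has_real_derivative ?g'' s) (at s)" for s
    unfolding eq(2) fun_cong[OF eq(3), of s]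
    by (rule DERIV_glue[where f' = "\<lambda>_. 0" and g' = "\<lambda>s. 6 * (1 - s)"])
      (auto intro!: derivative_eq_intros)
  have "has_weak_laplacian (\<lambda>x::'a. ?g (x \<bullet> x)) (\<lambda>x. 4 * (x \<bullet> x) * ?g'' (x \<bullet> x) + 2 * DIM('a) * ?g' (x \<bullet> x))"
  proof (rule has_weak_laplacian_radial[OF d d', where B = 30])
    show "isCont ?g'' s" for s by (intro continuous_intros)
    show "4 * s * \<bar>?g'' s\<bar> + 2 * \<bar>?g' s\<bar> \<le> 30" if "0 \<le> s" for s
    proof (cases "s \<le> 1")
      case True
      have "s * (1 - s) \<le> 1 * 1" "(1 - s)\<^sup>2 \<le> 1" using True that by (intro mult_mono power_le_one; simp)+
      moreover have "4 * s * (6 - 6 * s) = 24 * (s * (1 - s))" by (simp add: algebra_simps)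
      ultimately have "4 * s * (6 - 6 * s) + 6 * (1 - s)\<^sup>2 \<le> 30" by linarith
      then show ?thesis using True that by (simp add: abs_mult max_def)
    qed (simp add: max_def)
  qed
  then show ?thesis by (simp add: bump_def[abs_def] bump_laplacian_def[abs_def] algebra_simps)
qed

lemma bump_nonneg: "0 \<le> bump x" by (simp add: bump_def)

lemma bump_bounded: "\<bar>bump x\<bar> \<le> 1" by (auto simp: bump_def intro!: power_le_one)

lemma bump_eq_0: "1 \<le> norm x \<Longrightarrow> bump x = 0" "1 \<le> norm x \<Longrightarrow> bump_laplacian x = 0"
  by (auto simp: bump_def bump_laplacian_def dot_square_norm)

lemma bump_continuous: "continuous_on A bump" "continuous_on A bump_laplacian"
  unfolding bump_def bump_laplacian_def by (intro continuous_intros)+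

lemma bump_laplacian_bounded: "\<bar>bump_laplacian (x :: 'a::euclidean_space)\<bar> \<le> 24 + 6 * DIM('a)"
proof (cases "norm x \<le> 1")
  case True
  let ?s = "x \<bullet> x"
  have s: "0 \<le> ?s" "?s \<le> 1" using True by (auto simp: dot_square_norm abs_square_le_1)
  have "?s * (1 - ?s) \<le> 1 * 1" "(1 - ?s)\<^sup>2 \<le> 1" using s by (intro mult_mono power_le_one; simp)+
  then have *: "\<bar>24 * ?s * (1 - ?s)\<bar> \<le> 24" "\<bar>6 * DIM('a) * (1 - ?s)\<^sup>2\<bar> \<le> 6 * DIM('a)"
    using s by (auto simp: abs_mult mult_left_le)
  moreover have "max 0 (1 - ?s) = 1 - ?s" using s by simp
  ultimately show ?thesis unfolding bump_laplacian_def
    using order_trans[OF abs_triangle_ineq4 add_mono[OF *]] by simp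
next
  case False
  then show ?thesis using bump_eq_0[of x] by simp
qed

lemma integral_pos_of_continuous:
  fixes f :: "'a::euclidean_space \<Rightarrow> real"
  assumes cont: "continuous_on UNIV f" and int: "integrable lborel f"
    and nonneg: "\<And>x. 0 \<le> f x" and pos: "0 < f x0"
  shows "0 < (\<integral>x. f x \<partial>lborel)"
proof -
  have "open (f -` {f x0 / 2<..})"
    using cont by (intro open_vimage) (auto simp: continuous_on_open_vimage)
  then obtain r where r: "0 < r" "ball x0 r \<subseteq> f -` {f x0 / 2<..}"
    using pos openE[of "f -` {f x0 / 2<..}" x0] by auto
  have "0 < measure lborel (ball x0 r) * (f x0 / 2)"
    using r pos content_ball_pos[of r x0] by simp
  also have "\<dots> = (\<integral>x. indicator (ball x0 r) x * (f x0 / 2) \<partial>lborel)"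
    by simp
  also have "\<dots> \<le> (\<integral>x. f x \<partial>lborel)"
  proof (rule integral_mono[OF _ int])
    show "integrable lborel (\<lambda>x. indicator (ball x0 r) x * (f x0 / 2))"
      by (intro integrable_mult_left integrable_real_indicator) (use emeasure_lborel_ball_finite in auto)
    show "indicator (ball x0 r) x * (f x0 / 2) \<le> f x" for x
      using r(2) nonneg[of x] by (auto simp: indicator_def subset_iff)
  qed
  finally show ?thesis .
qed

lemma continuous_borel: "continuous_on UNIV f \<Longrightarrow> f \<in> borel_measurable borel"
  by (rule borel_measurable_continuous_onI)

lemma reg_newton_measurable [measurable]: "reg_newton a t \<in> borel_measurable borel"
  by (intro continuous_borel reg_newton_continuous)

lemma reg_mass_measurable [measurable]: "reg_mass a t \<in> borel_measurable borel"
  by (intro continuous_borel reg_mass_continuous)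

lemma bump_measurable [measurable]: "bump \<in> borel_measurable borel" "bump_laplacian \<in> borel_measurable borel"
  by (intro continuous_borel bump_continuous)+

lemma reg_mass_bounded: 
  assumes "0 < a"
  shows "\<bar>reg_mass a t x\<bar> \<le> t powr (- 2 * a) / t\<^sup>2 * (4 * a * (a + 1) * (a + 2))"
proof -
  have "\<bar>reg_mass a t x\<bar> = t powr (- 2 * a) / t\<^sup>2 * (4 * a * (a + 1) * (a + 2) * max 0 (1 - (x \<bullet> x) / t\<^sup>2))"
    using abs_of_nonneg[OF reg_mass_nonneg[OF assms, of t x]] by (simp add: reg_mass_def)
  also have "\<dots> \<le> t powr (- 2 * a) / t\<^sup>2 * (4 * a * (a + 1) * (a + 2) * 1)"
    using assms by (intro mult_left_mono) auto
  finally show ?thesis by simp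
qed

lemma reg_mass_integrable: "0 < a \<Longrightarrow> 0 < t \<Longrightarrow> integrable lborel (reg_mass a t)"
  by (rule integrable_bounded_support[OF _ reg_mass_bounded, where r = t])
    (auto intro: reg_mass_eq_0)

lemma bump_integrable:
  "integrable lborel (bump :: 'a::euclidean_space \<Rightarrow> real)"
  "integrable lborel (bump_laplacian :: 'a \<Rightarrow> real)"
proof -
  show "integrable lborel (bump :: 'a \<Rightarrow> real)"
    by (rule integrable_bounded_support[where B = 1 and r = 1])
      (auto simp: bump_eq_0 bump_bounded)
  show "integrable lborel (bump_laplacian :: 'a \<Rightarrow> real)"
    by (rule integrable_bounded_support[OF _ bump_laplacian_bounded, where r = 1])
      (auto simp: bump_eq_0)
qed

lemma reg_mass_integral_pos: "0 < a \<Longrightarrow> 0 < integral\<^sup>L lborel (reg_mass a 1 :: 'a::euclidean_space \<Rightarrow> real)"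
  by (rule integral_pos_of_continuous[OF reg_mass_continuous reg_mass_integrable, where ?x0.0 = 0])
    (auto intro: reg_mass_nonneg simp: reg_mass_def)

lemma bump_integral_pos: "0 < integral\<^sup>L lborel (bump :: 'a::euclidean_space \<Rightarrow> real)"
  by (rule integral_pos_of_continuous[OF bump_continuous(1) bump_integrable(1), where ?x0.0 = 0])
    (auto intro: bump_nonneg simp: bump_def)

text \<open>Integration by parts against the constant 1. Because of this zero mean, convolution with
  the Laplacian of the bump measures the oscillation of a function and not its size.\<close>

lemma bump_laplacian_integral: "integral\<^sup>L lborel (bump_laplacian :: 'a::euclidean_space \<Rightarrow> real) = 0"
  using weak_laplacian_ibp[OF bump_laplacian has_weak_laplacian_const[of 1], where Bu = 1 and Bv = 1 and r = 1, where 'a = 'a]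
    by (auto simp: bump_eq_0 bump_bounded)

text \<open>The difference \<open>reg_newton a t - reg_newton a 1\<close> has compact support, so integrating it against a function
  harmonic near the origin shows that the averages with weights \<open>reg_mass a t\<close> do not depend on \<open>t\<close>.\<close>

lemma reg_newton_mean_value:
  fixes a :: real and w :: "'a::euclidean_space"
  assumes a: "0 < a" and dim: "2 * a + 2 = DIM('a)" and w: "2 \<le> norm w"
  shows "(\<integral>y. reg_mass a 1 y * reg_newton a 1 (w - y) \<partial>lborel) = integral\<^sup>L lborel (reg_mass a 1 :: 'a \<Rightarrow> real) * reg_newton a 1 w"
proof -
  let ?\<kappa> = "integral\<^sup>L lborel (reg_mass a 1 :: 'a \<Rightarrow> real)"
  let ?N = "reg_newton a 1 :: 'a \<Rightarrow> real"
  let ?I = "\<integral>y. reg_mass a 1 y * ?N (w - y) \<partial>lborel"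
  let ?B = "1 + a + a * (a + 1)"
  have bdN: "\<bar>?N x\<bar> \<le> ?B" for x using reg_newton_bounded[OF a, of 1 x] by simp
  have int: "integrable lborel (\<lambda>y. reg_mass a t y * ?N (w - y))" if "0 < t" for t
  proof (rule Bochner_Integration.integrable_bound)
    show "integrable lborel (\<lambda>y::'a. reg_mass a t y * ?B)"
      using reg_mass_integrable[OF a that, where 'a = 'a] by simp
    show "AE y in lborel. norm (reg_mass a t y * ?N (w - y)) \<le> norm (reg_mass a t y * ?B)"
      using a bdN by (auto simp: abs_mult intro!: AE_I2 mult_left_mono order_trans[OF bdN])
  qed measurable
  have sub: "(\<integral>y. (reg_mass a 1 y - reg_mass a t y) * v y \<partial>lborel) = (\<integral>y. (reg_newton a t y - ?N y) * V y \<partial>lborel)"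
    if "0 < t" "t \<le> 1" "has_weak_laplacian v V" "v \<in> borel_measurable borel" "\<And>x. \<bar>v x\<bar> \<le> C" for t v V C
  proof -
    have "has_weak_laplacian (\<lambda>y::'a. reg_newton a t y - ?N y) (\<lambda>y. reg_mass a 1 y - reg_mass a t y)"
      using has_weak_laplacian_diff[OF reg_newton_laplacian[OF a that(1) dim] reg_newton_laplacian[OF a _ dim, of 1]] by simp
    then show ?thesis
    proof (rule weak_laplacian_ibp[OF _ that(3) _ that(4) _ that(5)])
      show "\<bar>reg_newton a t x - ?N x\<bar> \<le> t powr (- 2 * a) * ?B + ?B" for x
        using reg_newton_bounded[OF a, of t x] bdN[of x] by linarith
      show "reg_newton a t x - ?N x = 0" if "1 < norm x" for x :: 'a
        using that \<open>0 < t\<close> \<open>t \<le> 1\<close> by (simp add: reg_newton_eq)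
    qed measurable
  qed
  have "\<bar>?I - ?\<kappa> * ?N w\<bar> \<le> e" if e: "0 < e" for e
  proof -
    have "0 < ?\<kappa>" using reg_mass_integral_pos[OF a] .
    then have e': "0 < e / ?\<kappa>" using e by simp
    have "continuous_on UNIV ?N" by (rule reg_newton_continuous)
    then have "isCont ?N w" by (simp add: continuous_on_eq_continuous_at)
    then obtain d where d: "0 < d" "\<And>x. dist x w < d \<Longrightarrow> dist (?N x) (?N w) < e / ?\<kappa>"
      using e' unfolding continuous_at_eps_delta by blast
    \<comment> \<open>Once the mass sits in the ball of radius t, continuity of the kernel at
      \<open>w\<close> brings the average close to the value there. \<open>t \<le> 1\<close> makes
      the kernels for t and for 1 agree outside the unit ball.\<close>
    define t where "t = min 1 (d / 2)"
    have t: "0 < t" "t \<le> 1" "t < d" using d by (auto simp: t_def)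
    have "(\<integral>y. (reg_mass a 1 y - reg_mass a t y) * ?N (w - y) \<partial>lborel)
       = (\<integral>y. (reg_newton a t y - ?N y) * - reg_mass a 1 (w - y) \<partial>lborel)"
      using has_weak_laplacian_reflect[OF reg_newton_laplacian[OF a _ dim, of 1], of w] bdN
      by (intro sub[OF t(1,2)]) auto
    also have "\<dots> = integral\<^sup>L lborel (\<lambda>_::'a. 0)"
    proof (intro Bochner_Integration.integral_cong refl)
      fix y :: 'a
      \<comment> \<open>The factors have disjoint supports: the kernels differ only for y in the
        unit ball, and then \<open>2 \<le> norm w\<close> keeps \<open>w - y\<close> outside of
        it.\<close>
      show "(reg_newton a t y - ?N y) * - reg_mass a 1 (w - y) = 0"
      proof (cases "1 \<le> norm y")
        case True
        then show ?thesis using t by (simp add: reg_newton_eq)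
      next
        case False
        then have "1 \<le> norm (w - y)" using w norm_triangle_ineq2[of w y] by linarith
        then show ?thesis by (simp add: reg_mass_eq_0)
      qed
    qed
    finally have I: "?I = (\<integral>y. reg_mass a t y * ?N (w - y) \<partial>lborel)"
      using int t by (simp add: left_diff_distrib)
    \<comment> \<open>Testing against the constant 1 shows that the total mass is the same for t as
      for 1.\<close>
    have K: "?\<kappa> = integral\<^sup>L lborel (reg_mass a t :: 'a \<Rightarrow> real)"
      using sub[OF t(1,2) has_weak_laplacian_const[of 1], of 1] reg_mass_integrable[OF a, where 'a='a] t by simp
    have "?I - ?\<kappa> * ?N w = (\<integral>y. reg_mass a t y * (?N (w - y) - ?N w) \<partial>lborel)"
      unfolding I K using int[OF t(1)] reg_mass_integrable[OF a t(1), where 'a='a] by (simp add: right_diff_distrib)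
    also have "\<bar>\<dots>\<bar> \<le> integral\<^sup>L lborel (\<lambda>y::'a. reg_mass a t y * (e / ?\<kappa>))"
    proof (rule integral_abs_bound_integral)
      show "integrable lborel (\<lambda>y. reg_mass a t y * (?N (w - y) - ?N w))"
        using int[OF t(1)] reg_mass_integrable[OF a t(1), where 'a='a] by (simp add: right_diff_distrib)
      show "integrable lborel (\<lambda>y::'a. reg_mass a t y * (e / ?\<kappa>))"
        using reg_mass_integrable[OF a t(1), where 'a='a] by simp
      fix y :: 'a
      show "\<bar>reg_mass a t y * (?N (w - y) - ?N w)\<bar> \<le> reg_mass a t y * (e / ?\<kappa>)"
      proof (cases "t \<le> norm y")
        case True
        then show ?thesis using t by (simp add: reg_mass_eq_0)
      next
        case False
        then have "\<bar>?N (w - y) - ?N w\<bar> \<le> e / ?\<kappa>" using d(2)[of "w - y"] t by (simp add: dist_norm)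
        then show ?thesis
          by (simp only: abs_mult abs_of_nonneg[OF reg_mass_nonneg[OF a]] mult_left_mono reg_mass_nonneg[OF a])
      qed
    qed
    also have "\<dots> = e" using K \<open>0 < ?\<kappa>\<close> by simp
    finally show ?thesis .
  qed
  then have "\<bar>?I - ?\<kappa> * ?N w\<bar> \<le> 0" by (rule field_le_epsilon[of _ 0, simplified])
  then show ?thesis by simp
qed

section \<open>Extrapolating the Newton kernel\<close>

lemma powr_inner_eq_norm: "0 < norm x \<Longrightarrow> (x \<bullet> x) powr s = norm x powr (2 * s)"
  by (simp add: dot_square_norm powr_powr flip: powr_numeral)

text \<open>Each derivative along the segment costs a factor |v| / r, with r the distance to the
  singularity at the origin, so the third one is of order |v|^3 times r to the power - (2 * a + 3).
  The coefficients stay existential because the extrapolation reproduces every quadratic.\<close>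

lemma newton_line_taylor:
  fixes w v :: "'a::euclidean_space"
  assumes a: "0 < a" and m: "0 < m" "\<And>\<tau>. 0 \<le> \<tau> \<Longrightarrow> \<tau> \<le> 1 \<Longrightarrow> m \<le> norm (w + \<tau> *\<^sub>R v)"
  defines "\<phi> \<equiv> \<lambda>\<tau>. ((w + \<tau> *\<^sub>R v) \<bullet> (w + \<tau> *\<^sub>R v)) powr (- a)"
  shows "\<exists>c\<^sub>1 c\<^sub>2. \<forall>\<tau>. 0 \<le> \<tau> \<longrightarrow> \<tau> \<le> 1 \<longrightarrow> \<bar>\<phi> \<tau> - (\<phi> 0 + c\<^sub>1 * \<tau> + c\<^sub>2 * \<tau>\<^sup>2)\<bar>
     \<le> (12 * a * (a + 1) + 8 * a * (a + 1) * (a + 2)) * norm v ^ 3 * m powr - (2 * a + 3)"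
proof -
  define q where "q = (\<lambda>t. (w + t *\<^sub>R v) \<bullet> (w + t *\<^sub>R v))"
  define q' where "q' = (\<lambda>t. 2 * ((w + t *\<^sub>R v) \<bullet> v))"
  have dq: "(q has_real_derivative q' t) (at t)" for t
    unfolding q_def q'_def
    by (auto intro!: derivative_eq_intros ext
        simp: has_field_derivative_def inner_add_left inner_add_right inner_commute algebra_simps)
  have dq': "(q' has_real_derivative 2 * (v \<bullet> v)) (at t)" for t
    unfolding q'_def by (auto intro!: derivative_eq_intros simp: inner_add_left)
  have qpos: "0 < q t" if "0 \<le> t" "t \<le> 1" for t
    using m(2)[OF that] m(1) unfolding q_def inner_gt_zero_iff by auto
  have dp: "((\<lambda>t. q t powr r) has_real_derivative r * q t powr (r - 1) * q' t) (at t)" if "0 \<le> t" "t \<le> 1" for t r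
    using DERIV_chain2[OF has_real_derivative_powr[OF qpos[OF that]] dq] .
  define D3 where "D3 = (\<lambda>t. 6 * a * (a + 1) * (v \<bullet> v) * (q' t * q t powr (- a - 2)) - a * (a + 1) * (a + 2) * (q' t ^ 3 * q t powr (- a - 3)))"
  define D where "D = (\<lambda>n::nat. if n = 0 then \<phi> else if n = 1 then (\<lambda>t. - a * (q' t * q t powr (- a - 1)))
     else if n = 2 then (\<lambda>t. - 2 * a * (v \<bullet> v) * q t powr (- a - 1) + a * (a + 1) * (q' t ^ 2 * q t powr (- a - 2)))
     else D3)"
  have D: "(D n has_real_derivative D (Suc n) t) (at t)" if n: "n < 3" and t: "0 \<le> t" "t \<le> 1" for n t
  proof -
    consider "n = 0" | "n = 1" | "n = 2" using n by linarith
    then show ?thesis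
    proof cases
      case 1
      have "\<phi> = (\<lambda>t. q t powr (- a))" by (simp add: \<phi>_def q_def)
      then show ?thesis using 1 dp[OF t, of "- a"] by (simp add: D_def mult_ac)
    next
      case 2
      have "((\<lambda>t. - a * (q' t * q t powr (- a - 1))) has_real_derivative
         - a * (2 * (v \<bullet> v) * q t powr (- a - 1) + ((- a - 1) * q t powr (- a - 1 - 1) * q' t) * q' t)) (at t)"
        by (intro DERIV_cmult DERIV_mult dq' dp t)
      then show ?thesis using 2 by (simp add: D_def algebra_simps power2_eq_square)
    next
      case 3
      have "((\<lambda>t. - 2 * a * (v \<bullet> v) * q t powr (- a - 1) + a * (a + 1) * (q' t ^ 2 * q t powr (- a - 2))) has_real_derivative
         - 2 * a * (v \<bullet> v) * ((- a - 1) * q t powr (- a - 1 - 1) * q' t) +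
         a * (a + 1) * (of_nat 2 * (2 * (v \<bullet> v) * q' t ^ (2 - Suc 0)) * q t powr (- a - 2) + ((- a - 2) * q t powr (- a - 2 - 1) * q' t) * q' t ^ 2)) (at t)"
        by (intro DERIV_add DERIV_cmult DERIV_mult DERIV_power dq' dp t)
      then show ?thesis using 3 by (simp add: D_def D3_def algebra_simps power2_eq_square power3_eq_cube)
    qed
  qed
  \<comment> \<open>12 = 6 * 2 and 8 = 2 ^ 3, since |q'| is at most 2 r |v| in the two terms of
    \<open>D3\<close>. The factor 1/6 of the Taylor remainder is dropped.\<close>
  define B where "B = (12 * a * (a + 1) + 8 * a * (a + 1) * (a + 2)) * norm v ^ 3 * m powr - (2 * a + 3)"
  have bd: "\<bar>D3 t\<bar> \<le> B" if t: "0 \<le> t" "t \<le> 1" for t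
  proof -
    define r where "r = norm (w + t *\<^sub>R v)"
    have r: "m \<le> r" "0 < r" using m(2)[OF t] m(1) by (auto simp: r_def)
    have qr: "q t powr s = r powr (2 * s)" for s
      using r powr_inner_eq_norm unfolding q_def r_def by blast
    have q'r: "\<bar>q' t\<bar> \<le> 2 * r * norm v"
      using Cauchy_Schwarz_ineq2[of "w + t *\<^sub>R v" v] by (simp add: q'_def r_def)
    have rm: "r powr - (2 * a + 3) \<le> m powr - (2 * a + 3)"
      using powr_mono2'[of "- (2 * a + 3)" m r] a m(1) r by simp
    have e1: "r * r powr (2 * (- a - 2)) = r powr - (2 * a + 3)"
      using powr_mult_base[of r "2 * (- a - 2)"] r by (simp add: algebra_simps)
    have e2: "r ^ 3 * r powr (2 * (- a - 3)) = r powr - (2 * a + 3)"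
      using powr_add[of r 3 "2 * (- a - 3)"] r by (simp add: algebra_simps)
    have "\<bar>q' t * q t powr (- a - 2)\<bar> \<le> 2 * r * norm v * r powr (2 * (- a - 2))"
      unfolding abs_mult qr using q'r by (intro mult_mono) auto
    also have "\<dots> = 2 * norm v * (r * r powr (2 * (- a - 2)))" by simp
    also have "\<dots> \<le> 2 * norm v * m powr - (2 * a + 3)"
      unfolding e1 using rm by (intro mult_left_mono) auto
    finally have 1: "\<bar>6 * a * (a + 1) * (v \<bullet> v) * (q' t * q t powr (- a - 2))\<bar>
       \<le> 6 * a * (a + 1) * (norm v)\<^sup>2 * (2 * norm v * m powr - (2 * a + 3))"
      unfolding abs_mult[of "6 * a * (a + 1) * (v \<bullet> v)"] using a by (intro mult_mono) (auto simp: dot_square_norm)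
    have "\<bar>q' t ^ 3 * q t powr (- a - 3)\<bar> \<le> (2 * r * norm v) ^ 3 * r powr (2 * (- a - 3))"
      unfolding abs_mult qr power_abs using q'r r by (intro mult_mono power_mono) auto
    also have "\<dots> = 8 * norm v ^ 3 * (r ^ 3 * r powr (2 * (- a - 3)))" by (simp add: power_mult_distrib)
    also have "\<dots> \<le> 8 * norm v ^ 3 * m powr - (2 * a + 3)"
      unfolding e2 using rm by (intro mult_left_mono) auto
    finally have 2: "\<bar>a * (a + 1) * (a + 2) * (q' t ^ 3 * q t powr (- a - 3))\<bar>
       \<le> a * (a + 1) * (a + 2) * (8 * norm v ^ 3 * m powr - (2 * a + 3))"
      unfolding abs_mult[of "a * (a + 1) * (a + 2)"] using a by (intro mult_mono) auto
    have "\<bar>D3 t\<bar> \<le> 6 * a * (a + 1) * (norm v)\<^sup>2 * (2 * norm v * m powr - (2 * a + 3)) + a * (a + 1) * (a + 2) * (8 * norm v ^ 3 * m powr - (2 * a + 3))"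
      unfolding D3_def by (rule order_trans[OF abs_triangle_ineq4 add_mono[OF 1 2]])
    also have "\<dots> = B" by (simp add: B_def algebra_simps power2_eq_square power3_eq_cube)
    finally show ?thesis .
  qed
  have B0: "0 \<le> B" using bd[of 0] by simp
  have "\<bar>\<phi> \<tau> - (\<phi> 0 + D 1 0 * \<tau> + D 2 0 / 2 * \<tau>\<^sup>2)\<bar> \<le> B" if \<tau>: "0 \<le> \<tau>" "\<tau> \<le> 1" for \<tau>
  proof (cases "\<tau> = 0")
    case True
    then show ?thesis using B0 by simp
  next
    case False
    obtain t where t: "0 < t" "t < \<tau>" "\<phi> \<tau> = (\<Sum>m<3. D m 0 / fact m * \<tau> ^ m) + D 3 t / fact 3 * \<tau> ^ 3"
      using Maclaurin[of \<tau> 3 D \<phi>] D \<tau> False by (auto simp: D_def)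
    have "\<phi> \<tau> - (\<phi> 0 + D 1 0 * \<tau> + D 2 0 / 2 * \<tau>\<^sup>2) = D3 t * (\<tau> ^ 3 / 6)"
      unfolding t(3) by (simp add: D_def eval_nat_numeral)
    moreover have "\<bar>D3 t * (\<tau> ^ 3 / 6)\<bar> \<le> B * 1"
    proof -
      have "\<tau> ^ 3 \<le> 1" using \<tau> by (simp add: power_le_one)
      then show ?thesis unfolding abs_mult using bd[of t] t \<tau> B0 by (intro mult_mono) auto
    qed
    ultimately show ?thesis by simp
  qed
  then show ?thesis unfolding B_def by blast
qed

text \<open>Lagrange coefficients for quadratic extrapolation to \<open>1\<close> from the nodes \<open>0\<close>, \<open>1 / M\<close>, \<open>2 / M\<close>.\<close>

definition extrapolation_coeff :: "real \<Rightarrow> nat \<Rightarrow> real" where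
  "extrapolation_coeff M k = (if k = 0 then (M - 1) * (M - 2) / 2 else if k = 1 then - M * (M - 2) else M * (M - 1) / 2)"

text \<open>Quadratics are reproduced exactly, so only the remainder is extrapolated.
  \<open>2 \<le> M\<close> keeps the three nodes in the unit interval.\<close>

lemma extrapolation_error:
  assumes M: "2 \<le> M" and \<phi>: "\<And>\<tau>. 0 \<le> \<tau> \<Longrightarrow> \<tau> \<le> 1 \<Longrightarrow> \<bar>\<phi> \<tau> - (c\<^sub>0 + c\<^sub>1 * \<tau> + c\<^sub>2 * \<tau>\<^sup>2)\<bar> \<le> B"
  shows "\<bar>\<phi> 1 - (\<Sum>k<3. extrapolation_coeff M k * \<phi> (k / M))\<bar> \<le> (1 + (\<Sum>k<3. \<bar>extrapolation_coeff M k\<bar>)) * B"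
proof -
  define r where "r = (\<lambda>\<tau>. \<phi> \<tau> - (c\<^sub>0 + c\<^sub>1 * \<tau> + c\<^sub>2 * \<tau>\<^sup>2))"
  have r: "\<bar>r (k / M)\<bar> \<le> B" if "k < 3" for k :: nat
    unfolding r_def using M that by (intro \<phi>) (auto simp: divide_simps)
  have r1: "\<bar>r 1\<bar> \<le> B" unfolding r_def by (intro \<phi>) auto
  have 3: "(\<Sum>k<3. g k) = g 0 + g 1 + g (2::nat)" for g :: "nat \<Rightarrow> real" by (simp add: eval_nat_numeral)
  have "(\<Sum>k<3. extrapolation_coeff M k * (c\<^sub>0 + c\<^sub>1 * (k / M) + c\<^sub>2 * (k / M)\<^sup>2)) = c\<^sub>0 + c\<^sub>1 + c\<^sub>2"
    using M unfolding 3 by (simp add: extrapolation_coeff_def field_simps power2_eq_square)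
  then have "\<phi> 1 - (\<Sum>k<3. extrapolation_coeff M k * \<phi> (k / M)) = r 1 - (\<Sum>k<3. extrapolation_coeff M k * r (k / M))"
    unfolding r_def right_diff_distrib sum_subtractf by simp
  also have "\<bar>\<dots>\<bar> \<le> B + (\<Sum>k<3. \<bar>extrapolation_coeff M k\<bar> * B)"
    by (intro order_trans[OF abs_triangle_ineq4] add_mono r1 order_trans[OF sum_abs] sum_mono)
      (use r in \<open>auto simp: abs_mult intro!: mult_left_mono\<close>)
  also have "\<dots> = (1 + (\<Sum>k<3. \<bar>extrapolation_coeff M k\<bar>)) * B"
    by (simp add: sum_distrib_right distrib_right)
  finally show ?thesis .
qed

text \<open>Far from q, every point of the segment from z to q has distance comparable to 1 + |x -
  q| from x, and the Taylor bound applies. Near q all kernels are bounded, and so is the decay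
  factor from below. The choice M = 2 * R places the nodes within distance 1 of z.\<close>

lemma newton_extrapolation:
  fixes a R :: real
  assumes a: "0 < a" and R: "1 \<le> R"
  shows "\<exists>C\<ge>0. \<forall>x q z :: 'a::euclidean_space. norm (q - z) \<le> R \<longrightarrow>
     (\<forall>k<3. 1 \<le> norm (x - (z + (real k / (2 * R)) *\<^sub>R (q - z)))) \<longrightarrow>
     \<bar>reg_newton a 1 (x - q) - (\<Sum>k<3. extrapolation_coeff (2 * R) k * reg_newton a 1 (x - (z + (real k / (2 * R)) *\<^sub>R (q - z))))\<bar>
      \<le> C * (1 + norm (x - q)) powr - (2 * a + 3)"
proof -
  define E where "E = (\<Sum>k<3. \<bar>extrapolation_coeff (2 * R) k\<bar>)"
  define BN where "BN = 1 + a + a * (a + 1)"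
  define L where "L = (12 * a * (a + 1) + 8 * a * (a + 1) * (a + 2)) * R ^ 3"
  define C1 where "C1 = (1 + E) * (L * 2 powr (2 * a + 3))"
  define C2 where "C2 = (1 + E) * BN * (1 + 4 * R) powr (2 * a + 3)"
  have E0: "0 \<le> E" unfolding E_def by (intro sum_nonneg) auto
  have BN0: "0 < BN" using a by (simp add: BN_def add_pos_pos)
  have L0: "0 \<le> L" using a R by (simp add: L_def)
  have C0: "0 \<le> C1" "0 \<le> C2" using E0 BN0 L0 R by (auto simp: C1_def C2_def)
  show ?thesis
  proof (intro exI[of _ "C1 + C2"] conjI allI impI)
    show "0 \<le> C1 + C2" using C0 by simp
    fix x q z :: 'a
    assume qz: "norm (q - z) \<le> R" and far: "\<forall>k<3. 1 \<le> norm (x - (z + (real k / (2 * R)) *\<^sub>R (q - z)))"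
    define D where "D = norm (x - q)"
    let ?p = "\<lambda>k. z + (real k / (2 * R)) *\<^sub>R (q - z)"
    let ?err = "reg_newton a 1 (x - q) - (\<Sum>k<3. extrapolation_coeff (2 * R) k * reg_newton a 1 (x - ?p k))"
    have "\<bar>?err\<bar> \<le> C1 * (1 + D) powr - (2 * a + 3) \<or> \<bar>?err\<bar> \<le> C2 * (1 + D) powr - (2 * a + 3)"
    proof (cases "4 * R \<le> D")
      case True
      \<comment> \<open>Moving from q towards z loses at most R of the distance D, and D - R is at
        least (1 + D) / 2 once D is at least 2 * R + 1; the threshold 4 * R ensures this because R
        is at least 1.\<close>
      define m where "m = (1 + D) / 2"
      define w where "w = x - z"
      define v where "v = - (q - z)"
      define \<phi> where "\<phi> = (\<lambda>\<tau>. ((w + \<tau> *\<^sub>R v) \<bullet> (w + \<tau> *\<^sub>R v)) powr (- a))"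
      have mpos: "0 < m" using True R by (simp add: m_def)
      have nv: "norm v \<le> R" using qz by (simp add: v_def norm_minus_commute)
      have ml: "m \<le> norm (w + \<tau> *\<^sub>R v)" if "0 \<le> \<tau>" "\<tau> \<le> 1" for \<tau>
      proof -
        have "w + \<tau> *\<^sub>R v = (x - q) - (1 - \<tau>) *\<^sub>R v"
          by (simp add: w_def v_def algebra_simps)
        then have "norm (w + \<tau> *\<^sub>R v) \<ge> D - norm ((1 - \<tau>) *\<^sub>R v)"
          unfolding D_def using norm_triangle_ineq2 by metis
        moreover have "norm ((1 - \<tau>) *\<^sub>R v) \<le> 1 * R"
          unfolding norm_scaleR using that nv by (intro mult_mono) auto
        ultimately show ?thesis using True R by (simp add: m_def)
      qed
      obtain c\<^sub>1 c\<^sub>2 where c: "\<And>\<tau>. 0 \<le> \<tau> \<Longrightarrow> \<tau> \<le> 1 \<Longrightarrow> \<bar>\<phi> \<tau> - (\<phi> 0 + c\<^sub>1 * \<tau> + c\<^sub>2 * \<tau>\<^sup>2)\<bar>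
        \<le> (12 * a * (a + 1) + 8 * a * (a + 1) * (a + 2)) * norm v ^ 3 * m powr - (2 * a + 3)"
        using newton_line_taylor[OF a mpos ml] unfolding \<phi>_def by blast
      have \<phi>1: "\<phi> 1 = reg_newton a 1 (x - q)"
        using True R by (subst reg_newton_eq) (auto simp: \<phi>_def w_def v_def D_def)
      have \<phi>k: "\<phi> (k / (2 * R)) = reg_newton a 1 (x - ?p k)" if "k < 3" for k :: nat
      proof (subst reg_newton_eq)
        have "w + (k / (2 * R)) *\<^sub>R v = x - ?p k" by (simp add: w_def v_def algebra_simps)
        then show "\<phi> (k / (2 * R)) = ((x - ?p k) \<bullet> (x - ?p k)) powr - a" by (simp add: \<phi>_def)
      qed (use far that in auto)
      have "\<bar>?err\<bar> = \<bar>\<phi> 1 - (\<Sum>k<3. extrapolation_coeff (2 * R) k * \<phi> (k / (2 * R)))\<bar>"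
        by (simp add: \<phi>1 \<phi>k)
      also have "\<dots> \<le> (1 + E) * ((12 * a * (a + 1) + 8 * a * (a + 1) * (a + 2)) * norm v ^ 3 * m powr - (2 * a + 3))"
        unfolding E_def by (rule extrapolation_error[OF _ c]) (use R in auto)
      also have "\<dots> \<le> (1 + E) * (L * m powr - (2 * a + 3))"
        unfolding L_def using E0 a nv by (intro mult_left_mono mult_right_mono power_mono) auto
      also have "m powr - (2 * a + 3) = 2 powr (2 * a + 3) * (1 + D) powr - (2 * a + 3)"
        unfolding m_def powr_minus[of 2] powr_minus[of "(1 + D) / 2"] powr_minus[of "1 + D"]
        using True R by (subst powr_divide) (auto simp: field_simps)
      finally show ?thesis by (simp add: C1_def mult_ac)
    next
      case False
      have bN: "\<bar>reg_newton a 1 y\<bar> \<le> BN" for y :: 'a using reg_newton_bounded[OF a, of 1 y] by (simp add: BN_def)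
      have "\<bar>?err\<bar> \<le> BN + (\<Sum>k<3. \<bar>extrapolation_coeff (2 * R) k\<bar> * BN)"
        by (intro order_trans[OF abs_triangle_ineq4] add_mono bN order_trans[OF sum_abs] sum_mono)
          (use bN in \<open>auto simp: abs_mult intro!: mult_left_mono\<close>)
      also have "\<dots> = (1 + E) * BN" by (simp add: E_def sum_distrib_right distrib_right)
      also have "\<dots> = C2 * (1 + 4 * R) powr - (2 * a + 3)"
        unfolding C2_def powr_minus[of "1 + 4 * R"] using R by simp
      also have "\<dots> \<le> C2 * (1 + D) powr - (2 * a + 3)"
        using False C0 a by (intro mult_left_mono powr_mono2') (auto simp: D_def add_pos_nonneg)
      finally show ?thesis by blast
    qed
    then show "\<bar>?err\<bar> \<le> (C1 + C2) * (1 + norm (x - q)) powr - (2 * a + 3)"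
      unfolding distrib_right D_def[symmetric] using mult_nonneg_nonneg[OF C0(1), of "(1 + D) powr - (2 * a + 3)"] 
        mult_nonneg_nonneg[OF C0(2), of "(1 + D) powr - (2 * a + 3)"] by auto
  qed
qed

text \<open>Dyadic comparison: the ball of radius 2^k has volume of order 2^(k d) and carries weight
  of order 2^(- k (d + 1)), which leaves a geometric series.\<close>

lemma integrable_decay:
  "integrable lborel (\<lambda>y::'a::euclidean_space. (1 + norm y) powr - (real DIM('a) + 1))"
proof (rule integrableI_nonneg)
  let ?d = "DIM('a)"
  define c :: "nat \<Rightarrow> real" where "c = (\<lambda>k. 2 ^ (?d + 1) * (1 / 2) ^ (k * (?d + 1)))"
  have c0: "0 \<le> c k" for k by (simp add: c_def)
  have term_le: "F k \<le> (\<Sum>k. F k)" for F :: "nat \<Rightarrow> ennreal" and k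
    using sum_le_suminf[OF summableI, of "{k}" F] by simp
  have le: "ennreal ((1 + norm y) powr - (real ?d + 1)) \<le> (\<Sum>k. ennreal (c k) * indicator (ball 0 (2 ^ k)) y)" for y :: 'a
  proof -
    have ex: "\<exists>k. norm y < 2 ^ k" by (rule real_arch_pow) simp
    define k where "k = (LEAST k. norm y < 2 ^ k)"
    have k: "norm y < 2 ^ k" unfolding k_def using ex by (rule LeastI_ex)
    \<comment> \<open>Minimality of k bounds the norm below by 2^(k - 1), except for k = 0, where
      the added 1 takes over.\<close>
    have k2: "2 ^ k / 2 \<le> 1 + norm y"
    proof (cases k)
      case (Suc j)
      then have "\<not> norm y < 2 ^ j" unfolding k_def using not_less_Least[of j] by (metis lessI)
      then show ?thesis using Suc by simp
    qed (use norm_ge_zero[of y] in simp)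
    have "(1 + norm y) powr - (real ?d + 1) = inverse ((1 + norm y) ^ (?d + 1))"
    proof -
      have "(1 + norm y) powr (real (?d + 1)) = (1 + norm y) ^ (?d + 1)"
        by (rule powr_realpow) (use norm_ge_zero[of y] in linarith)
      then show ?thesis using powr_minus[of "1 + norm y" "real (?d + 1)"] by (simp add: algebra_simps)
    qed
    also have "\<dots> \<le> inverse ((2 ^ k / 2) ^ (?d + 1))"
      using k2 by (intro le_imp_inverse_le power_mono) auto
    also have "\<dots> = c k"
      by (simp only: c_def power_mult power_one_over power_divide inverse_divide times_divide_eq_right mult_1_right power_one)
    finally have "ennreal ((1 + norm y) powr - (real ?d + 1)) \<le> ennreal (c k) * indicator (ball 0 (2 ^ k)) y"
      using k by (simp add: ennreal_leI)
    also have "\<dots> \<le> (\<Sum>k. ennreal (c k) * indicator (ball 0 (2 ^ k)) y)"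
      by (rule term_le)
    finally show ?thesis .
  qed
  have "(\<integral>\<^sup>+ y. ennreal ((1 + norm y) powr - (real ?d + 1)) \<partial>(lborel :: 'a measure))
     \<le> (\<integral>\<^sup>+ y. (\<Sum>k. ennreal (c k) * indicator (ball 0 (2 ^ k)) y) \<partial>(lborel :: 'a measure))"
    by (intro nn_integral_mono le)
  also have "\<dots> = (\<Sum>k. \<integral>\<^sup>+ y. ennreal (c k) * indicator (ball 0 (2 ^ k)) y \<partial>(lborel :: 'a measure))"
    by (rule nn_integral_suminf)
      (intro borel_measurable_times_ennreal borel_measurable_const borel_measurable_indicator, simp)
  also have "\<dots> = (\<Sum>k. ennreal (2 ^ (?d + 1) * unit_ball_vol ?d * (1 / 2) ^ k))"
  proof (intro suminf_cong)
    fix k :: nat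
    have "(\<integral>\<^sup>+ y. ennreal (c k) * indicator (ball 0 (2 ^ k)) y \<partial>(lborel :: 'a measure)) = ennreal (c k) * ennreal (unit_ball_vol ?d * (2 ^ k) ^ ?d)"
      by (simp add: nn_integral_cmult_indicator emeasure_ball)
    also have "\<dots> = ennreal (c k * (unit_ball_vol ?d * (2 ^ k) ^ ?d))"
      by (rule ennreal_mult[symmetric]) (auto simp: c0)
    also have "c k * (unit_ball_vol ?d * (2 ^ k) ^ ?d) = 2 ^ (?d + 1) * unit_ball_vol ?d * (1 / 2) ^ k"
      by (simp add: c_def power_divide power_mult[symmetric] power_add field_simps)
    finally show "(\<integral>\<^sup>+ y. ennreal (c k) * indicator (ball 0 (2 ^ k)) y \<partial>(lborel :: 'a measure)) = ennreal (2 ^ (?d + 1) * unit_ball_vol ?d * (1 / 2) ^ k)" .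
  qed
  also have "\<dots> < \<infinity>"
    unfolding less_top[symmetric] infinity_ennreal_def
    by (intro ennreal_suminf_neq_top summable_mult summable_geometric) auto
  finally show "(\<integral>\<^sup>+ y. ennreal ((1 + norm y) powr - (real ?d + 1)) \<partial>(lborel :: 'a measure)) < \<infinity>" .
qed auto

section \<open>Approximation at unit scale\<close>

lemma lborel_integrable_translate:
  fixes f :: "'a::euclidean_space \<Rightarrow> real"
  assumes "integrable lborel f"
  shows "integrable lborel (\<lambda>y. f (y + c))"
proof -
  have "integrable (distr lborel borel ((+) c)) f" using assms by (simp add: lborel_distr_plus)
  then have "integrable lborel (\<lambda>y. f (c + y))" by (subst (asm) integrable_distr_eq) (use assms in auto)
  then show ?thesis by (simp add: add.commute)
qed

lemma integrable_mult_bounded: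
  fixes f h :: "'a::euclidean_space \<Rightarrow> real"
  assumes f: "integrable lborel f" and [measurable]: "h \<in> borel_measurable borel" and B: "\<And>x. \<bar>h x\<bar> \<le> B"
  shows "integrable lborel (\<lambda>x. h x * f x)"
proof (rule Bochner_Integration.integrable_bound)
  show "integrable lborel (\<lambda>x. B * f x)" using f by simp
  have [measurable]: "f \<in> borel_measurable borel" using f by simp
  show "(\<lambda>x. h x * f x) \<in> borel_measurable lborel" by measurable
  show "AE x in lborel. norm (h x * f x) \<le> norm (B * f x)"
    by (intro AE_I2) (auto simp: abs_mult intro!: mult_right_mono order_trans[OF B])
qed

lemma convolution_even:
  fixes f e :: "'a::euclidean_space \<Rightarrow> real"
  assumes [measurable]: "f \<in> borel_measurable borel" "e \<in> borel_measurable borel"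
    and even: "\<And>x. e (- x) = e x"
  shows "(\<integral>w. f w * e (y - w) \<partial>lborel) = (\<integral>v. f (y + v) * e v \<partial>lborel)"
proof -
  have "(\<integral>w. f w * e (y - w) \<partial>lborel) = (\<integral>v. f (v + y) * e (y - (v + y)) \<partial>lborel)"
    by (rule lborel_integral_translate[symmetric]) measurable
  then show ?thesis using even by (simp add: add.commute)
qed

text \<open>The constant is moved under the integral. The weight \<open>e\<close> may change sign or
  have mean zero, so the same estimate serves the bump, its Laplacian and the mass of the
  regularized kernel.\<close>

lemma averaging_error:
  fixes g e :: "'a::euclidean_space \<Rightarrow> real"
  assumes e: "integrable lborel e" "\<And>v. 1 \<le> norm v \<Longrightarrow> e v = 0"
    and [measurable]: "g \<in> borel_measurable borel" and B: "\<And>x. \<bar>g x\<bar> \<le> B"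
    and W: "\<And>v. norm v \<le> 1 \<Longrightarrow> \<bar>g (x + v) - c\<bar> \<le> W"
  shows "\<bar>(\<integral>v. g (x + v) * e v \<partial>lborel) - c * integral\<^sup>L lborel e\<bar> \<le> W * (\<integral>v. \<bar>e v\<bar> \<partial>lborel)"
proof -
  have int: "integrable lborel (\<lambda>v. g (x + v) * e v)"
    by (rule integrable_mult_bounded[OF e(1) _ B]) measurable
  have "(\<integral>v. g (x + v) * e v \<partial>lborel) - c * integral\<^sup>L lborel e = (\<integral>v. (g (x + v) - c) * e v \<partial>lborel)"
    using int e(1) by (simp add: left_diff_distrib)
  also have "\<bar>\<dots>\<bar> \<le> (\<integral>v. W * \<bar>e v\<bar> \<partial>lborel)"
  proof (rule integral_abs_bound_integral)
    show "integrable lborel (\<lambda>v. (g (x + v) - c) * e v)" using int e(1) by (simp add: left_diff_distrib)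
    show "integrable lborel (\<lambda>v. W * \<bar>e v\<bar>)" using e(1) by simp
    show "\<bar>(g (x + v) - c) * e v\<bar> \<le> W * \<bar>e v\<bar>" for v
      by (cases "norm v \<le> 1") (auto simp: abs_mult e(2) intro!: mult_right_mono W)
  qed
  finally show ?thesis by simp
qed

lemma reg_newton_even: "reg_newton a t (- x) = reg_newton a t x"
  and reg_mass_even: "reg_mass a t (- x) = reg_mass a t x"
  and bump_even: "bump (- x) = bump x"
  and bump_laplacian_even: "bump_laplacian (- x) = bump_laplacian x"
  by (simp_all add: reg_newton_def reg_mass_def bump_def bump_laplacian_def)

text \<open>\<rho> is the Laplacian of the convolution \<open>f1\<close> of f with the bump. Moving
  it onto the kernel turns the potential of \<rho> into minus the average of \<open>f1\<close> with
  weight \<open>reg_mass a 1\<close>. Each of the two averagings over unit balls displaces values by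
  at most W, up to normalization, hence the 2.\<close>

lemma smoothed_potential:
  fixes f :: "'a::euclidean_space \<Rightarrow> real" and a :: real
  assumes a: "0 < a" and dim: "2 * a + 2 = DIM('a)"
    and cont: "continuous_on UNIV f" and supp: "\<And>x. r < norm x \<Longrightarrow> f x = 0"
    and W: "\<And>x y. dist x y \<le> 1 \<Longrightarrow> \<bar>f x - f y\<bar> \<le> W"
  defines "\<rho> \<equiv> \<lambda>y. \<integral>w. f w * bump_laplacian (y - w) \<partial>lborel"
  defines "\<eta> \<equiv> integral\<^sup>L lborel (bump :: 'a \<Rightarrow> real)" and "\<kappa> \<equiv> integral\<^sup>L lborel (reg_mass a 1 :: 'a \<Rightarrow> real)"
  shows "\<rho> \<in> borel_measurable borel"
    and "\<bar>\<rho> y\<bar> \<le> W * (\<integral>v. \<bar>bump_laplacian (v::'a)\<bar> \<partial>lborel)"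
    and "r + 1 < norm y \<Longrightarrow> \<rho> y = 0"
    and "\<bar>(\<integral>y. \<rho> y * reg_newton a 1 (x - y) \<partial>lborel) + \<eta> * \<kappa> * f x\<bar> \<le> 2 * W * \<eta> * \<kappa>"
proof -
  have [measurable]: "f \<in> borel_measurable borel" using cont by (rule continuous_borel)
  have "compact (f ` cball 0 r)" by (intro compact_continuous_image continuous_on_subset[OF cont]) auto
  then obtain B0 where B0: "\<And>x. x \<in> cball 0 r \<Longrightarrow> \<bar>f x\<bar> \<le> B0"
    by (metis bounded_real compact_imp_bounded imageI)
  \<comment> \<open>The maximum with 0 covers the points where \<open>f\<close> vanishes, also when
    the ball is empty and \<open>B0\<close> arbitrary. This bound serves integrability; the
    conclusions are expressed through \<open>W\<close>.\<close>
  define B where "B = max 0 B0"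
  have Bf: "\<bar>f x\<bar> \<le> B" for x using B0[of x] supp[of x] by (cases "norm x \<le> r") (auto simp: B_def)
  have intf: "integrable lborel f" by (rule integrable_bounded_support[OF _ Bf supp]) measurable
  define f1 where "f1 = (\<lambda>y. \<integral>w. f w * bump (y - w) \<partial>lborel)"
  have f1: "f1 y = (\<integral>v. f (y + v) * bump v \<partial>lborel)" for y
    unfolding f1_def by (rule convolution_even) (auto simp: bump_even)
  have \<rho>: "\<rho> y = (\<integral>v. f (y + v) * bump_laplacian v \<partial>lborel)" for y
    unfolding \<rho>_def by (rule convolution_even) (auto simp: bump_laplacian_even)
  have lap: "has_weak_laplacian f1 \<rho>"
    unfolding f1_def \<rho>_def by (rule has_weak_laplacian_convolution[OF bump_laplacian _ bump_bounded intf]) measurable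
  show [measurable]: "\<rho> \<in> borel_measurable borel" unfolding \<rho>_def by measurable
  have f1m [measurable]: "f1 \<in> borel_measurable borel" unfolding f1_def by measurable
  have f1_avg: "\<bar>f1 y - f y * \<eta>\<bar> \<le> W * \<eta>" for y
  proof -
    have "\<bar>f1 y - f y * \<eta>\<bar> \<le> W * (\<integral>v. \<bar>bump (v::'a)\<bar> \<partial>lborel)"
      unfolding f1 \<eta>_def
      by (rule averaging_error[OF bump_integrable(1) bump_eq_0(1) _ Bf]) (auto intro!: W simp: dist_norm)
    then show ?thesis by (simp add: \<eta>_def abs_of_nonneg[OF bump_nonneg])
  qed
  show "\<bar>\<rho> y\<bar> \<le> W * (\<integral>v. \<bar>bump_laplacian (v::'a)\<bar> \<partial>lborel)" for y
  proof -
    have "\<bar>\<rho> y - f y * integral\<^sup>L lborel (bump_laplacian :: 'a \<Rightarrow> real)\<bar> \<le> W * (\<integral>v. \<bar>bump_laplacian (v::'a)\<bar> \<partial>lborel)"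
      unfolding \<rho> by (rule averaging_error[OF bump_integrable(2) bump_eq_0(2) _ Bf]) (auto intro!: W simp: dist_norm)
    then show ?thesis by (simp add: bump_laplacian_integral)
  qed
  have far: "f (y + v) = 0" if "r + 1 < norm y" "norm v < 1" for y v
    using that norm_triangle_ineq4[of "y + v" v] by (intro supp) auto
  have z: "f (y + v) * bump v = 0" "f (y + v) * bump_laplacian v = 0" if "r + 1 < norm y" for y v
    using far[OF that, of v] bump_eq_0[of v] by (cases "norm v < 1"; simp)+
  show "\<rho> y = 0" if "r + 1 < norm y" for y unfolding \<rho> z(2)[OF that] by simp
  have f1_supp: "f1 y = 0" if "r + 1 < norm y" for y unfolding f1 z(1)[OF that] by simp
  have \<eta>0: "0 < \<eta>" unfolding \<eta>_def by (rule bump_integral_pos)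
  have f1_bd: "\<bar>f1 y\<bar> \<le> W * \<eta> + B * \<eta>" for y
  proof -
    have "\<bar>f y * \<eta>\<bar> \<le> B * \<eta>" unfolding abs_mult using Bf[of y] \<eta>0 by (intro mult_mono) auto
    then show ?thesis using f1_avg[of y] by linarith
  qed
  have "(\<integral>y. \<rho> y * reg_newton a 1 (x - y) \<partial>lborel) = (\<integral>y. f1 y * - reg_mass a 1 (x - y) \<partial>lborel)"
    by (rule weak_laplacian_ibp[OF lap has_weak_laplacian_reflect[OF reg_newton_laplacian[OF a _ dim]] _ _ f1_bd reg_newton_bounded[OF a] f1_supp])
      (auto)
  also have "\<dots> = - (\<integral>v. f1 (x + v) * reg_mass a 1 v \<partial>lborel)"
    by (simp add: convolution_even[of f1 "reg_mass a 1"] reg_mass_even)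
  finally have eq: "(\<integral>y. \<rho> y * reg_newton a 1 (x - y) \<partial>lborel) = - (\<integral>v. f1 (x + v) * reg_mass a 1 v \<partial>lborel)" .
  have "\<bar>(\<integral>v. f1 (x + v) * reg_mass a 1 v \<partial>lborel) - \<eta> * f x * \<kappa>\<bar> \<le> (2 * W * \<eta>) * (\<integral>v. \<bar>reg_mass a 1 (v::'a)\<bar> \<partial>lborel)"
    unfolding \<kappa>_def
  proof (rule averaging_error[OF reg_mass_integrable[OF a] _ f1m f1_bd])
    fix v :: 'a assume v: "norm v \<le> 1"
    have "\<bar>f (x + v) * \<eta> - f x * \<eta>\<bar> \<le> W * \<eta>"
      unfolding left_diff_distrib[symmetric] abs_mult using W[of "x + v" x] v \<eta>0
      by (intro mult_mono) (auto simp: dist_norm)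
    then show "\<bar>f1 (x + v) - \<eta> * f x\<bar> \<le> 2 * W * \<eta>"
      using f1_avg[of "x + v"] unfolding mult.commute[of \<eta>] by linarith
  qed (auto intro: reg_mass_eq_0)
  also have "(\<integral>v. \<bar>reg_mass a 1 (v::'a)\<bar> \<partial>lborel) = \<kappa>"
    unfolding \<kappa>_def by (simp add: abs_of_nonneg[OF reg_mass_nonneg[OF a]])
  finally show "\<bar>(\<integral>y. \<rho> y * reg_newton a 1 (x - y) \<partial>lborel) + \<eta> * \<kappa> * f x\<bar> \<le> 2 * W * \<eta> * \<kappa>"
    unfolding eq by (simp add: mult_ac abs_minus_commute)
qed

section \<open>Discretization into finitely many poles\<close>

lemma finite_measurable_partition:
  fixes S :: "'a::euclidean_space set"
  assumes "compact S" "0 < \<epsilon>"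
  shows "\<exists>(n::nat) q A. (\<forall>i<n. A i \<in> sets borel \<and> A i \<subseteq> ball (q i) \<epsilon>) \<and> (\<forall>y\<in>S. \<exists>i<n. \<forall>j<n. y \<in> A j \<longleftrightarrow> j = i)"
proof -
  have "S \<subseteq> (\<Union>x\<in>S. ball x \<epsilon>)" using assms(2) by auto
  then obtain k where k: "finite k" "S \<subseteq> (\<Union>x\<in>k. ball x \<epsilon>)"
    by (rule compactE_image[OF assms(1) open_ball]) (rule that)
  obtain n and q :: "nat \<Rightarrow> 'a" where q: "k = q ` {i. i < n}"
    using finite_imp_nat_seg_image_inj_on[OF k(1)] by metis
  define A where "A = (\<lambda>i. ball (q i) \<epsilon> - (\<Union>j<i. ball (q j) \<epsilon>))"
  have "\<exists>i<n. \<forall>j<n. y \<in> A j \<longleftrightarrow> j = i" if "y \<in> S" for y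
  proof -
    have ex: "\<exists>i. i < n \<and> y \<in> ball (q i) \<epsilon>" using subsetD[OF k(2) that] unfolding q by blast
    define i where "i = (LEAST i. i < n \<and> y \<in> ball (q i) \<epsilon>)"
    have i: "i < n \<and> y \<in> ball (q i) \<epsilon>" unfolding i_def using ex by (rule LeastI_ex)
    have least: "\<not> (j < n \<and> y \<in> ball (q j) \<epsilon>)" if "j < i" for j
      using that not_less_Least unfolding i_def by blast
    have "y \<in> A j \<longleftrightarrow> j = i" if "j < n" for j
    proof -
      consider "j < i" | "j = i" | "i < j" by linarith
      then show ?thesis using least[of j] least i that by cases (auto simp: A_def)
    qed
    then show ?thesis using i by blast
  qed
  moreover have "A i \<in> sets borel \<and> A i \<subseteq> ball (q i) \<epsilon>" for i
    unfolding A_def by (intro conjI sets.Diff sets.finite_UN) auto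
  ultimately show ?thesis by blast
qed

text \<open>The poles are indexed by a cell and an extrapolation node.\<close>

definition newton_sum :: "real \<Rightarrow> (nat \<times> nat) set \<Rightarrow> (nat \<times> nat \<Rightarrow> real) \<Rightarrow> (nat \<times> nat \<Rightarrow> 'a::euclidean_space) \<Rightarrow> 'a \<Rightarrow> real" where
  "newton_sum a I m p x = (\<Sum>i\<in>I. m i * ((x - p i) \<bullet> (x - p i)) powr (- a))"

text \<open>\<open>C\<close> is fixed before \<open>K\<close>, \<open>f\<close> and
  \<open>W\<close>, because rescaling to another \<delta> changes all three. No estimate that enters
  it may therefore use the size of \<open>K\<close> or of the support of \<open>f\<close>; these may
  influence only the fineness of the partition.\<close>

lemma unit_scale_approximation:
  fixes a R :: real
  assumes a: "0 < a" and dim: "2 * a + 2 = DIM('a::euclidean_space)" and R: "1 \<le> R"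
  obtains C where "0 < C"
    and "\<And>(K::'a set) f W. bounded K \<Longrightarrow> \<forall>q. \<exists>z. dist q z \<le> R \<and> (\<forall>k\<in>K. 4 \<le> dist z k) \<Longrightarrow>
     0 < W \<Longrightarrow> continuous_on UNIV f \<Longrightarrow> \<exists>r. \<forall>x. r < norm x \<longrightarrow> f x = 0 \<Longrightarrow>
     \<forall>x y. dist x y \<le> 1 \<longrightarrow> \<bar>f x - f y\<bar> \<le> W \<Longrightarrow>
     \<exists>I m p. finite I \<and> (\<forall>i\<in>I. \<forall>k\<in>K. 3 \<le> dist (p i) k) \<and>
        (\<forall>x. (\<exists>k\<in>K. dist x k < 2) \<longrightarrow> \<bar>f x - newton_sum a I m p x\<bar> \<le> C * W)"
proof -
  define \<eta> where "\<eta> = integral\<^sup>L lborel (bump :: 'a \<Rightarrow> real)"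
  define \<kappa> where "\<kappa> = integral\<^sup>L lborel (reg_mass a 1 :: 'a \<Rightarrow> real)"
  define A where "A = (\<integral>v. \<bar>bump_laplacian (v::'a)\<bar> \<partial>lborel)"
  define decay where "decay = (\<lambda>y::'a. (1 + norm y) powr - (2 * a + 3))"
  define J where "J = integral\<^sup>L lborel decay"
  obtain CE where CE: "0 \<le> CE" "\<And>x q z :: 'a. norm (q - z) \<le> R \<Longrightarrow>
     (\<forall>k<3. 1 \<le> norm (x - (z + (real k / (2 * R)) *\<^sub>R (q - z)))) \<Longrightarrow>
     \<bar>reg_newton a 1 (x - q) - (\<Sum>k<3. extrapolation_coeff (2 * R) k * reg_newton a 1 (x - (z + (real k / (2 * R)) *\<^sub>R (q - z))))\<bar>
      \<le> CE * decay (x - q)"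
    using newton_extrapolation[OF a R, where 'a = 'a] unfolding decay_def by blast
  have \<eta>0: "0 < \<eta>" and \<kappa>0: "0 < \<kappa>" unfolding \<eta>_def \<kappa>_def
    by (auto intro: bump_integral_pos reg_mass_integral_pos[OF a])
  have A0: "0 \<le> A" unfolding A_def by (intro Bochner_Integration.integral_nonneg) auto
  have decay0: "0 \<le> decay y" for y by (simp add: decay_def)
  have dimeq: "2 * a + 3 = real DIM('a) + 1" using dim by simp
  have decay_int: "integrable lborel decay"
    unfolding decay_def dimeq by (rule integrable_decay)
  have J0: "0 \<le> J" unfolding J_def by (intro Bochner_Integration.integral_nonneg decay0)
  \<comment> \<open>The factor pays for evaluating the decay at y instead of at the center q of its
    cell, less than 1 away: 1 + |x - q| is at least half of 1 + |x - y|.\<close>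
  define CD where "CD = CE * 2 powr (2 * a + 3)"
  have CD0: "0 \<le> CD" using CE(1) by (simp add: CD_def)
  \<comment> \<open>The 2 comes from the two averagings, the 1 from discretization, and
    \<open>A * CD * J\<close> from extrapolation, integrated over the whole space.\<close>
  define C where "C = 2 + (1 + A * CD * J) / (\<eta> * \<kappa>)"
  have C0: "0 < C" unfolding C_def using \<eta>0 \<kappa>0 A0 CD0 J0 by (intro add_pos_nonneg divide_nonneg_pos) auto
  show thesis
  proof (rule that[OF C0])
    fix K :: "'a set" and f :: "'a \<Rightarrow> real" and W :: real
    assume K: "bounded K" and holes: "\<forall>q. \<exists>z. dist q z \<le> R \<and> (\<forall>k\<in>K. 4 \<le> dist z k)"
      and W: "0 < W" and cont: "continuous_on UNIV f" and "\<exists>r. \<forall>x. r < norm x \<longrightarrow> f x = 0"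
      and osc: "\<forall>x y. dist x y \<le> 1 \<longrightarrow> \<bar>f x - f y\<bar> \<le> W"
    then obtain r where supp: "\<And>x. r < norm x \<Longrightarrow> f x = 0" by blast
    obtain Z where Z: "\<And>q. dist q (Z q) \<le> R" "\<And>q k. k \<in> K \<Longrightarrow> 4 \<le> dist (Z q) k"
      using holes by metis
    obtain k0 where k0: "\<And>k. k \<in> K \<Longrightarrow> norm k \<le> k0" using K by (auto simp: bounded_iff)
    define \<rho> where "\<rho> = (\<lambda>y. \<integral>w. f w * bump_laplacian (y - w) \<partial>lborel)"
    have sm: "\<rho> \<in> borel_measurable borel" "\<And>y. \<bar>\<rho> y\<bar> \<le> W * A" "\<And>y. r + 1 < norm y \<Longrightarrow> \<rho> y = 0"
      "\<And>x. \<bar>(\<integral>y. \<rho> y * reg_newton a 1 (x - y) \<partial>lborel) + \<eta> * \<kappa> * f x\<bar> \<le> 2 * W * \<eta> * \<kappa>"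
      unfolding \<rho>_def A_def \<eta>_def \<kappa>_def
      using smoothed_potential[OF a dim cont supp, of r W] osc by auto
    have [measurable]: "\<rho> \<in> borel_measurable borel" by (rule sm(1))
    have \<rho>_int: "integrable lborel \<rho>" by (rule integrable_bounded_support[OF sm(1,2,3)])
    define L where "L = (\<integral>y. \<bar>\<rho> y\<bar> \<partial>lborel)"
    have L0: "0 \<le> L" unfolding L_def by (intro Bochner_Integration.integral_nonneg) auto
    \<comment> \<open>Discretization costs \<open>e\<close> times the integral \<open>L\<close> of
      |\<rho>|. As \<open>L\<close> depends on \<open>f\<close> and must not enter \<open>C\<close>,
      the tolerance absorbs it; the added 1 allows L = 0.\<close>
    define e where "e = W / (L + 1)"
    have e0: "0 < e" using W L0 by (simp add: e_def)
    have eL: "e * L \<le> W" using W L0 by (simp add: e_def field_simps)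
    let ?N = "reg_newton a 1 :: 'a \<Rightarrow> real"
    \<comment> \<open>The ball contains all arguments to be compared: |x| is at most k0 + 2, |y| at
      most r + 1, and a cell center is less than 1 away from y.\<close>
    have "uniformly_continuous_on (cball 0 (k0 + 2 + (r + 1) + 1)) ?N"
      by (intro compact_uniformly_continuous reg_newton_continuous compact_cball)
    then obtain d where d: "0 < d" "\<And>u v. u \<in> cball 0 (k0 + 2 + (r + 1) + 1) \<Longrightarrow> v \<in> cball 0 (k0 + 2 + (r + 1) + 1)
        \<Longrightarrow> dist v u < d \<Longrightarrow> dist (?N v) (?N u) < e"
      unfolding uniformly_continuous_on_def using e0 by metis
    define \<epsilon> where "\<epsilon> = min d 1"
    have \<epsilon>: "0 < \<epsilon>" "\<epsilon> \<le> d" "\<epsilon> \<le> 1" using d(1) by (auto simp: \<epsilon>_def)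
    obtain n :: nat and q :: "nat \<Rightarrow> 'a" and P where P: "\<And>i. i < n \<Longrightarrow> P i \<in> sets borel" "\<And>i. i < n \<Longrightarrow> P i \<subseteq> ball (q i) \<epsilon>"
      "\<And>y. y \<in> cball 0 (r + 1) \<Longrightarrow> \<exists>i<n. \<forall>j<n. y \<in> P j \<longleftrightarrow> j = i"
      using finite_measurable_partition[OF compact_cball \<epsilon>(1), of 0 "r + 1"] by metis
    define pt where "pt = (\<lambda>(i, k::nat). Z (q i) + (real k / (2 * R)) *\<^sub>R (q i - Z (q i)))"
    define H where "H = (\<lambda>x i. \<Sum>k<3. extrapolation_coeff (2 * R) k * ?N (x - pt (i, k)))"
    define mass where "mass = (\<lambda>i. \<integral>y. \<rho> y * indicator (P i) y \<partial>lborel)"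
    \<comment> \<open>The potential of \<rho> is close to - \<eta> \<kappa> f, which explains the
      sign and the divisor.\<close>
    define m where "m = (\<lambda>(i, k). - (mass i * extrapolation_coeff (2 * R) k) / (\<eta> * \<kappa>))"
    define I where "I = {..<n} \<times> {..<3::nat}"
    have pt3: "3 \<le> dist (pt (i, j)) k" if "k \<in> K" "j < 3" for i j k
    proof -
      have "dist (pt (i, j)) (Z (q i)) \<le> (2 / (2 * R)) * R"
        using Z(1)[of "q i"] that(2) R unfolding pt_def dist_norm by (auto intro!: mult_mono divide_right_mono)
      then have "dist (pt (i, j)) (Z (q i)) \<le> 1" using R by simp
      then show ?thesis using Z(2)[OF that(1), of "q i"] dist_triangle3[of "Z (q i)" k "pt (i, j)"] by linarith
    qed
    show "\<exists>I m p. finite I \<and> (\<forall>i\<in>I. \<forall>k\<in>K. 3 \<le> dist (p i) k) \<and>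
        (\<forall>x. (\<exists>k\<in>K. dist x k < 2) \<longrightarrow> \<bar>f x - newton_sum a I m p x\<bar> \<le> C * W)"
    proof (intro exI[of _ I] exI[of _ m] exI[of _ pt] conjI ballI allI impI)
      show "finite I" by (simp add: I_def)
      show "3 \<le> dist (pt i) k" if "i \<in> I" "k \<in> K" for i k
        using that pt3 by (auto simp: I_def)
      fix x assume "\<exists>k\<in>K. dist x k < 2"
      then obtain k where k: "k \<in> K" "dist x k < 2" by blast
      have x1: "1 \<le> norm (x - pt (i, j))" if "j < 3" for i j
        using pt3[OF k(1) that, of i] k(2) dist_triangle3[of "pt (i, j)" k x] by (simp add: dist_norm norm_minus_commute)
      have nx: "norm x \<le> k0 + 2"
        using k0[OF k(1)] k(2) norm_triangle_ineq2[of x k] by (simp add: dist_norm)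
      have HE: "\<bar>?N (x - q i) - H x i\<bar> \<le> CE * decay (x - q i)" for i
        using CE(2)[of "q i" "Z (q i)" x] Z(1)[of "q i"] x1[of _ i] by (auto simp: H_def pt_def dist_norm)
      \<comment> \<open>As a function of y this is a step function, and its integral against \<rho>
        is a finite sum of kernels. It replaces \<open>?N (x - y)\<close> in two moves: from y to
        the center of its cell, and from there to the nodes in the hole.\<close>
      define Hs where "Hs = (\<lambda>y. \<Sum>i<n. indicator (P i) y * H x i)"
      have Hs_eq: "Hs y = H x i" if "i < n" "\<forall>j<n. y \<in> P j \<longleftrightarrow> j = i" for y i
      proof -
        have "Hs y = (\<Sum>j<n. if j = i then H x j else 0)"
          unfolding Hs_def using that(2) by (intro sum.cong) auto
        then show ?thesis using that(1) by simp
      qed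
      have Hs_err: "\<bar>\<rho> y * ?N (x - y) - \<rho> y * Hs y\<bar> \<le> e * \<bar>\<rho> y\<bar> + W * A * CD * decay (y - x)" for y
      proof (cases "norm y \<le> r + 1")
        case False
        then show ?thesis using sm(3)[of y] W A0 CD0 decay0[of "y - x"] by simp
      next
        case True
        then obtain i where i: "i < n" "\<forall>j<n. y \<in> P j \<longleftrightarrow> j = i" using P(3)[of y] by auto
        have yq: "dist (q i) y < \<epsilon>" using i P(2)[OF i(1)] by auto
        have "norm (x - y) \<le> k0 + 2 + (r + 1)" using nx True norm_triangle_ineq4[of x y] by linarith
        moreover have "norm (x - q i) \<le> norm (x - y) + dist (q i) y"
          using norm_triangle_ineq[of "x - y" "y - q i"] by (simp add: dist_norm norm_minus_commute)
        ultimately have "dist (?N (x - y)) (?N (x - q i)) < e"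
          using yq \<epsilon> by (intro d(2)) (auto simp: dist_norm norm_minus_commute)
        then have 1: "\<bar>?N (x - y) - ?N (x - q i)\<bar> \<le> e" by (simp add: dist_real_def)
        have "norm (x - y) \<le> norm (x - q i) + 1"
          using norm_triangle_ineq[of "x - q i" "q i - y"] yq \<epsilon> by (simp add: dist_norm)
        then have le: "(1 + norm (y - x)) / 2 \<le> 1 + norm (x - q i)"
        proof -
          have "u \<le> v + 1 \<Longrightarrow> 0 \<le> v \<Longrightarrow> (1 + u) / 2 \<le> 1 + v" for u v :: real by simp
          then show ?thesis
            using \<open>norm (x - y) \<le> norm (x - q i) + 1\<close> by (simp only: norm_minus_commute[of y x] norm_ge_zero)
        qed
        have "decay (x - q i) \<le> ((1 + norm (y - x)) / 2) powr - (2 * a + 3)"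
          unfolding decay_def using le a by (intro powr_mono2') (auto simp: add_pos_nonneg)
        also have "\<dots> = 2 powr (2 * a + 3) * decay (y - x)"
          unfolding decay_def powr_minus[of "(1 + norm (y - x)) / 2"] powr_minus[of "1 + norm (y - x)"]
          by (subst powr_divide) (auto simp: field_simps)
        finally have "CE * decay (x - q i) \<le> CD * decay (y - x)"
          unfolding CD_def using CE(1) by (simp add: mult_left_mono mult.assoc)
        then have 2: "\<bar>?N (x - q i) - Hs y\<bar> \<le> CD * decay (y - x)"
          using HE[of i] Hs_eq[OF i] by simp
        have "\<bar>\<rho> y * ?N (x - y) - \<rho> y * Hs y\<bar> = \<bar>\<rho> y\<bar> * \<bar>?N (x - y) - Hs y\<bar>"
          by (simp add: abs_mult flip: right_diff_distrib)
        also have "\<dots> \<le> \<bar>\<rho> y\<bar> * (e + CD * decay (y - x))"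
          using 1 2 by (intro mult_left_mono) auto
        also have "\<dots> = e * \<bar>\<rho> y\<bar> + \<bar>\<rho> y\<bar> * (CD * decay (y - x))" by (simp add: algebra_simps)
        also have "\<bar>\<rho> y\<bar> * (CD * decay (y - x)) \<le> (W * A) * (CD * decay (y - x))"
          using sm(2)[of y] CD0 decay0[of "y - x"] by (intro mult_right_mono) auto
        finally show ?thesis by (simp add: mult_ac)
      qed
      have int1: "integrable lborel (\<lambda>y. \<rho> y * ?N (x - y))"
        using integrable_mult_bounded[OF \<rho>_int _ reg_newton_bounded[OF a, of 1 "x - _"]] by (simp add: mult.commute)
      have int_i: "integrable lborel (\<lambda>y. \<rho> y * indicator (P i) y)" if "i < n" for i
        using integrable_mult_indicator[of "P i" lborel \<rho>] P(1)[OF that] \<rho>_int by (simp add: mult.commute)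
      have Hs': "\<rho> y * Hs y = (\<Sum>i<n. \<rho> y * indicator (P i) y * H x i)" for y
        by (simp only: Hs_def sum_distrib_left mult.assoc)
      have int2: "integrable lborel (\<lambda>y. \<rho> y * Hs y)"
        unfolding Hs' by (intro Bochner_Integration.integrable_sum integrable_mult_left int_i) auto
      have Hs_mass: "(\<integral>y. \<rho> y * Hs y \<partial>lborel) = (\<Sum>i<n. mass i * H x i)"
        unfolding Hs' mass_def by (subst Bochner_Integration.integral_sum) (auto intro!: integrable_mult_left int_i sum.cong)
      have decay_int': "integrable lborel (\<lambda>y. decay (y - x))" 
        using lborel_integrable_translate[OF decay_int, of "- x"] by simp
      have "\<bar>(\<integral>y. \<rho> y * ?N (x - y) \<partial>lborel) - (\<integral>y. \<rho> y * Hs y \<partial>lborel)\<bar>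
          = \<bar>\<integral>y. \<rho> y * ?N (x - y) - \<rho> y * Hs y \<partial>lborel\<bar>"
        using int1 int2 by simp
      also have "\<dots> \<le> (\<integral>y. e * \<bar>\<rho> y\<bar> + W * A * CD * decay (y - x) \<partial>lborel)"
        using int1 int2 \<rho>_int decay_int' Hs_err by (intro integral_abs_bound_integral) auto
      also have "\<dots> = e * L + W * A * CD * (\<integral>y. decay (y - x) \<partial>lborel)"
        using \<rho>_int decay_int' by (simp add: L_def)
      also have "(\<integral>y. decay (y - x) \<partial>lborel) = J"
        using lborel_integral_translate[of decay "- x"] decay_int by (simp add: J_def)
      finally have err: "\<bar>(\<integral>y. \<rho> y * ?N (x - y) \<partial>lborel) - (\<integral>y. \<rho> y * Hs y \<partial>lborel)\<bar> \<le> W + W * A * CD * J"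
        using eL by linarith
      have "newton_sum a I m pt x = (\<Sum>i<n. \<Sum>k<3. m (i, k) * ((x - pt (i, k)) \<bullet> (x - pt (i, k))) powr (- a))"
        unfolding newton_sum_def I_def sum.cartesian_product by (intro sum.cong) auto
      also have "\<dots> = (\<Sum>i<n. \<Sum>k<3. m (i, k) * ?N (x - pt (i, k)))"
        using x1 by (intro sum.cong refl) (simp add: reg_newton_eq)
      also have "\<dots> = - (\<Sum>i<n. mass i * H x i) / (\<eta> * \<kappa>)"
        unfolding m_def H_def by (simp add: sum_distrib_left sum_divide_distrib sum_negf mult_ac)
      finally have F: "newton_sum a I m pt x = - (\<integral>y. \<rho> y * Hs y \<partial>lborel) / (\<eta> * \<kappa>)"
        unfolding Hs_mass .
      have "\<bar>\<eta> * \<kappa> * f x + (\<integral>y. \<rho> y * Hs y \<partial>lborel)\<bar> \<le> 2 * W * \<eta> * \<kappa> + (W + W * A * CD * J)"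
        using err sm(4)[of x] by linarith
      then have "\<bar>\<eta> * \<kappa> * f x + (\<integral>y. \<rho> y * Hs y \<partial>lborel)\<bar> / (\<eta> * \<kappa>) \<le> (2 * W * \<eta> * \<kappa> + (W + W * A * CD * J)) / (\<eta> * \<kappa>)"
        using \<eta>0 \<kappa>0 by (intro divide_right_mono) auto
      also have "\<dots> = C * W" using \<eta>0 \<kappa>0 by (simp add: C_def field_simps)
      also have "\<bar>\<eta> * \<kappa> * f x + (\<integral>y. \<rho> y * Hs y \<partial>lborel)\<bar> / (\<eta> * \<kappa>) = \<bar>f x - newton_sum a I m pt x\<bar>"
      proof -
        have "f x - newton_sum a I m pt x = (\<eta> * \<kappa> * f x + (\<integral>y. \<rho> y * Hs y \<partial>lborel)) / (\<eta> * \<kappa>)"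
          unfolding F using \<eta>0 \<kappa>0 by (simp add: field_simps)
        then show ?thesis using \<eta>0 \<kappa>0 by (simp add: abs_mult)
      qed
      finally show "\<bar>f x - newton_sum a I m pt x\<bar> \<le> C * W" .
    qed
  qed
qed

section \<open>Lipschitz bounds from the mean value property\<close>

lemma truncated_square_lipschitz:
  fixes s t :: real
  assumes "0 \<le> s" "0 \<le> t"
  shows "\<bar>max 0 (1 - s\<^sup>2) - max 0 (1 - t\<^sup>2)\<bar> \<le> 2 * \<bar>s - t\<bar>"
  using assms
proof (induction s t rule: linorder_wlog)
  case (le s t)
  consider "t \<le> 1" | "s \<le> 1" "1 < t" | "1 < s" by linarith
  then show ?case
  proof cases
    case 1
    then have "s\<^sup>2 \<le> 1" "t\<^sup>2 \<le> 1" "s\<^sup>2 \<le> t\<^sup>2" using le by (auto simp: abs_square_le_1 power_mono)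
    then have "\<bar>max 0 (1 - s\<^sup>2) - max 0 (1 - t\<^sup>2)\<bar> = t\<^sup>2 - s\<^sup>2" by simp
    also have "\<dots> = (t + s) * (t - s)" by (simp add: algebra_simps power2_eq_square)
    also have "\<dots> \<le> 2 * (t - s)" using 1 le by (intro mult_right_mono) auto
    finally show ?thesis using le by simp
  next
    case 2
    then have "s\<^sup>2 \<le> 1" "1 < t\<^sup>2" using le by (auto simp: abs_square_le_1 one_less_power)
    then have "\<bar>max 0 (1 - s\<^sup>2) - max 0 (1 - t\<^sup>2)\<bar> = 1 - s\<^sup>2" by simp
    also have "\<dots> = (1 + s) * (1 - s)" by (simp add: algebra_simps power2_eq_square)
    also have "\<dots> \<le> 2 * (1 - s)" using 2 le by (intro mult_right_mono) auto
    finally show ?thesis using 2 by simp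
  next
    case 3
    then have "1 < s\<^sup>2" "1 < t\<^sup>2" using le by (auto simp: one_less_power)
    then show ?thesis by (simp add: max_def)
  qed
next
  case (sym s t)
  then show ?case by (simp add: abs_minus_commute)
qed

lemma reg_mass_lipschitz:
  assumes a: "0 < a"
  shows "\<bar>reg_mass a 1 v - reg_mass a 1 w\<bar> \<le> 8 * a * (a + 1) * (a + 2) * norm (v - w)"
proof -
  let ?c = "4 * a * (a + 1) * (a + 2)"
  have "\<bar>reg_mass a 1 v - reg_mass a 1 w\<bar> = ?c * \<bar>max 0 (1 - (norm v)\<^sup>2) - max 0 (1 - (norm w)\<^sup>2)\<bar>"
    using a by (simp add: reg_mass_def dot_square_norm abs_mult flip: right_diff_distrib)
  also have "\<dots> \<le> ?c * (2 * \<bar>norm v - norm w\<bar>)"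
    using a by (intro mult_left_mono truncated_square_lipschitz) auto
  also have "\<dots> \<le> ?c * (2 * norm (v - w))"
    using a by (intro mult_left_mono norm_triangle_ineq3) auto
  finally show ?thesis by simp
qed

text \<open>By the mean value property the Lipschitz bound needs only the uniform bound on a larger neighborhood, so no
  gradients of the kernel have to be estimated.\<close>

lemma newton_sum_lipschitz:
  fixes a C :: real
  assumes a: "0 < a" and dim: "2 * a + 2 = DIM('a::euclidean_space)" and C: "0 \<le> C"
  obtains L where "0 < L"
    and "\<And>(K::'a set) f W I m p x y. finite I \<Longrightarrow> \<forall>i\<in>I. \<forall>k\<in>K. 3 \<le> dist (p i) k \<Longrightarrow> 0 \<le> W \<Longrightarrow>
     \<forall>x y. dist x y \<le> 1 \<longrightarrow> \<bar>f x - f y\<bar> \<le> W \<Longrightarrow>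
     \<forall>x. (\<exists>k\<in>K. dist x k < 2) \<longrightarrow> \<bar>f x - newton_sum a I m p x\<bar> \<le> C * W \<Longrightarrow>
     \<exists>k\<in>K. dist x k < 1 \<Longrightarrow> \<exists>k\<in>K. dist y k < 1 \<Longrightarrow> dist x y \<le> 1 \<Longrightarrow>
     \<bar>newton_sum a I m p x - newton_sum a I m p y\<bar> \<le> L * W * dist x y"
proof -
  define \<kappa> where "\<kappa> = integral\<^sup>L lborel (reg_mass a 1 :: 'a \<Rightarrow> real)"
  define c where "c = 8 * a * (a + 1) * (a + 2)"
  define V where "V = unit_ball_vol (DIM('a)) * 2 ^ DIM('a)"
  \<comment> \<open>\<open>C + 2\<close> bounds U - f x in units of W, \<open>c\<close> is the
    Lipschitz constant of the averaging weight, and \<open>V\<close> is the volume of a ball of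
    radius 2, which contains both unit balls.\<close>
  define L where "L = (C + 2) * c * V / \<kappa>"
  have \<kappa>0: "0 < \<kappa>" unfolding \<kappa>_def by (rule reg_mass_integral_pos[OF a])
  have c0: "0 < c" using a by (simp add: c_def)
  have V0: "0 < V" by (simp add: V_def)
  have L0: "0 < L" using \<kappa>0 c0 V0 C by (simp add: L_def)
  show thesis
  proof (rule that[OF L0])
    fix K :: "'a set" and f :: "'a \<Rightarrow> real" and W :: real and I m and p :: "nat \<times> nat \<Rightarrow> 'a" and x y :: 'a
    assume I: "finite I" and p3: "\<forall>i\<in>I. \<forall>k\<in>K. 3 \<le> dist (p i) k" and W: "0 \<le> W"
      and osc: "\<forall>x y. dist x y \<le> 1 \<longrightarrow> \<bar>f x - f y\<bar> \<le> W"
      and app: "\<forall>x. (\<exists>k\<in>K. dist x k < 2) \<longrightarrow> \<bar>f x - newton_sum a I m p x\<bar> \<le> C * W"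
      and x: "\<exists>k\<in>K. dist x k < 1" and y: "\<exists>k\<in>K. dist y k < 1" and xy: "dist x y \<le> 1"
    \<comment> \<open>The regularized sum is continuous and bounded on the whole space, so its
      averages exist everywhere; agreement with \<open>newton_sum\<close> is needed near
      \<open>K\<close> only.\<close>
    define U where "U = (\<lambda>w. \<Sum>i\<in>I. m i * reg_newton a 1 (w - p i))"
    have U_eq: "newton_sum a I m p w = U w" if w: "\<exists>k\<in>K. dist w k < 2" for w
    proof -
      have "1 \<le> norm (w - p i)" if i: "i \<in> I" for i
      proof -
        obtain k where k: "k \<in> K" "dist w k < 2" using w by blast
        show ?thesis using p3[rule_format, OF i k(1)] k(2) dist_triangle3[of "p i" k w] by (simp add: dist_norm norm_minus_commute)
      qed
      then show ?thesis unfolding newton_sum_def U_def by (intro sum.cong refl) (simp add: reg_newton_eq)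
    qed
    have U_cont: "continuous_on UNIV U"
      unfolding U_def by (intro continuous_intros continuous_on_compose2[OF reg_newton_continuous[of UNIV]]) auto
    have [measurable]: "U \<in> borel_measurable borel" by (rule continuous_borel[OF U_cont])
    have U_bd: "\<bar>U w\<bar> \<le> (\<Sum>i\<in>I. \<bar>m i\<bar> * (1 + a + a * (a + 1)))" for w
      unfolding U_def using reg_newton_bounded[OF a, of 1 "w - p _"]
      by (intro order_trans[OF sum_abs] sum_mono) (auto simp: abs_mult intro!: mult_left_mono)
    have \<psi>_int: "integrable lborel (\<lambda>w. reg_mass a 1 (z - w))" for z :: 'a
    proof -
      have "(\<lambda>w. reg_mass a 1 (z - w)) = (\<lambda>w. reg_mass a 1 (w + - z))"
        using reg_mass_even[of a 1 "_ - z"] by simp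
      then show ?thesis using lborel_integrable_translate[OF reg_mass_integrable[OF a, of 1], of "- z"] by simp
    qed
    have U\<psi>_int: "integrable lborel (\<lambda>w. U w * reg_mass a 1 (z - w))" for z
      by (rule integrable_mult_bounded[OF \<psi>_int _ U_bd]) measurable
    have total: "(\<integral>w. reg_mass a 1 (z - w) \<partial>lborel) = \<kappa>" for z :: 'a
      using convolution_even[of "\<lambda>_. 1" "reg_mass a 1" z] by (simp add: reg_mass_even \<kappa>_def)
    have mean: "(\<integral>w. U w * reg_mass a 1 (z - w) \<partial>lborel) = \<kappa> * U z" if z: "\<exists>k\<in>K. dist z k < 1" for z
    proof -
      have far: "2 \<le> norm (p i - z)" if i: "i \<in> I" for i
      proof -
        obtain k where k: "k \<in> K" "dist z k < 1" using z by blast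
        show ?thesis using p3[rule_format, OF i k(1)] k(2) dist_triangle3[of "p i" k z] by (simp add: dist_norm norm_minus_commute)
      qed
      have N_flip: "reg_newton a 1 (z + v - p i) = reg_newton a 1 (p i - z - v)" for v i
        using reg_newton_even[of a 1 "p i - z - v"] by (simp add: algebra_simps)
      have "integrable lborel (\<lambda>v. reg_newton a 1 (p i - z - v) * reg_mass a 1 v)" for i
        by (rule integrable_mult_bounded[OF reg_mass_integrable[OF a] _ reg_newton_bounded[OF a]]) auto
      then have int_i: "integrable lborel (\<lambda>v. reg_mass a 1 v * reg_newton a 1 (p i - z - v))" for i
        by (simp add: mult.commute)
      have "(\<integral>w. U w * reg_mass a 1 (z - w) \<partial>lborel) = (\<integral>v. U (z + v) * reg_mass a 1 v \<partial>lborel)"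
        by (rule convolution_even) (auto simp: reg_mass_even)
      also have "\<dots> = (\<integral>v. (\<Sum>i\<in>I. m i * (reg_mass a 1 v * reg_newton a 1 (p i - z - v))) \<partial>lborel)"
        unfolding U_def N_flip sum_distrib_right by (simp add: mult_ac)
      also have "\<dots> = (\<Sum>i\<in>I. m i * (\<kappa> * reg_newton a 1 (p i - z)))"
        using int_i far by (simp add: reg_newton_mean_value[OF a dim] \<kappa>_def)
      also have "\<dots> = \<kappa> * U z"
        unfolding U_def sum_distrib_left using N_flip[of 0] by (intro sum.cong) (auto simp: mult_ac)
      finally show ?thesis .
    qed
    have xK: "\<exists>k\<in>K. dist x k < 2" and yK: "\<exists>k\<in>K. dist y k < 2" using x y by force+
    \<comment> \<open>Both weights have total mass \<kappa>, so \<open>f x\<close> can be subtracted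
      from \<open>U\<close> without changing the difference of the averages. What remains is of size
      W, however large \<open>f\<close> is.\<close>
    define g where "g = (\<lambda>w. (U w - f x) * (reg_mass a 1 (x - w) - reg_mass a 1 (y - w)))"
    have g_eq: "g = (\<lambda>w. (U w * reg_mass a 1 (x - w) - U w * reg_mass a 1 (y - w)) - f x * (reg_mass a 1 (x - w) - reg_mass a 1 (y - w)))"
      by (simp add: g_def algebra_simps)
    have g_int: "integrable lborel g" unfolding g_eq using U\<psi>_int \<psi>_int by simp
    have "\<kappa> * (U x - U y) = integral\<^sup>L lborel g"
      unfolding g_eq using U\<psi>_int \<psi>_int by (simp add: mean[OF x] mean[OF y] total right_diff_distrib)
    also have "\<bar>\<dots>\<bar> \<le> (\<integral>w. ((C + 2) * W * (c * dist x y)) * indicator (cball x 2) w \<partial>lborel)"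
    proof (rule integral_abs_bound_integral[OF g_int])
      show "integrable lborel (\<lambda>w. ((C + 2) * W * (c * dist x y)) * indicator (cball x 2) w)"
        using emeasure_lborel_cball_finite[of x 2] by (intro integrable_mult_right integrable_real_indicator) auto
      fix w
      show "\<bar>g w\<bar> \<le> ((C + 2) * W * (c * dist x y)) * indicator (cball x 2) w"
      proof (cases "dist x w < 1 \<or> dist y w < 1")
        case False
        then have "g w = 0" by (simp add: g_def reg_mass_eq_0 dist_norm)
        then show ?thesis using C W c0 by simp
      next
        case True
        then have "dist x w \<le> 2" using xy dist_triangle[of x w y] by auto
        \<comment> \<open>A point near y but not near x is reached from x in two unit steps, by way
          of y.\<close>
        have "\<bar>f w - f x\<bar> \<le> 2 * W"
        proof (cases "dist x w < 1")
          case True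
          then show ?thesis using osc[rule_format, of w x] W by (simp add: dist_commute)
        next
          case False
          then have "dist y w < 1" using True by simp
          then show ?thesis using osc[rule_format, of w y] osc[rule_format, of y x] xy by (simp add: dist_commute)
        qed
        moreover have "\<exists>k\<in>K. dist w k < 2"
        proof -
          have "dist w k \<le> dist x w + dist x k" "dist w k \<le> dist y w + dist y k" for k
            using dist_triangle3[of w k x] dist_triangle3[of w k y] by (simp_all add: dist_commute)
          note le = this
          obtain k k' where "k \<in> K" "dist x k < 1" "k' \<in> K" "dist y k' < 1" using x y by blast
          then show ?thesis using True le(1)[of k] le(2)[of k'] by (metis add_strict_mono le_less_trans one_add_one)
        qed
        then have "\<bar>f w - U w\<bar> \<le> C * W" using app[rule_format, of w] U_eq[of w] by simp
        ultimately have "\<bar>U w - f x\<bar> \<le> (C + 2) * W" by (simp add: distrib_right)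
        moreover have "\<bar>reg_mass a 1 (x - w) - reg_mass a 1 (y - w)\<bar> \<le> c * dist x y"
          using reg_mass_lipschitz[OF a, of "x - w" "y - w"] by (simp add: c_def dist_norm)
        ultimately show ?thesis using \<open>dist x w \<le> 2\<close> unfolding g_def abs_mult
          using C W by (auto intro!: mult_mono)
      qed
    qed
    also have "\<dots> = (C + 2) * W * (c * dist x y) * V"
      using content_cball[of 2 x] by (simp add: V_def)
    finally have "\<kappa> * \<bar>U x - U y\<bar> \<le> (C + 2) * W * (c * dist x y) * V" using \<kappa>0 by (simp add: abs_mult)
    then have "\<bar>U x - U y\<bar> \<le> (C + 2) * W * (c * dist x y) * V / \<kappa>" using \<kappa>0 by (simp add: field_simps)
    then show "\<bar>newton_sum a I m p x - newton_sum a I m p y\<bar> \<le> L * W * dist x y"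
      unfolding U_eq[OF xK] U_eq[OF yK] by (simp add: L_def mult_ac)
  qed
qed

section \<open>Harmonicity of sums of Newton kernels\<close>

lemma has_derivative_powr_norm:
  fixes x :: "'a::euclidean_space"
  assumes "x \<noteq> p"
  shows "((\<lambda>y. ((y - p) \<bullet> (y - p)) powr s) has_derivative
     (\<lambda>h. 2 * s * ((x - p) \<bullet> (x - p)) powr (s - 1) * ((x - p) \<bullet> h))) (at x)"
proof -
  have pos: "0 < (x - p) \<bullet> (x - p)" using assms by simp
  have "((\<lambda>y. (y - p) \<bullet> (y - p)) has_derivative (\<lambda>h. 2 * ((x - p) \<bullet> h))) (at x)"
    by (auto intro!: derivative_eq_intros simp: inner_commute algebra_simps)
  from has_derivative_compose[OF this has_real_derivative_powr[OF pos, unfolded has_field_derivative_def]]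
  show ?thesis by (simp add: mult_ac)
qed

text \<open>\<open>grad F\<close> is a total function that is known to equal \<open>G\<close> on
  \<open>U\<close> only; openness of \<open>U\<close> is what lets the derivative of one be taken
  for that of the other.\<close>

lemma harmonic_onI:
  fixes F :: "'a::euclidean_space \<Rightarrow> real" and G :: "'a \<Rightarrow> 'a"
  assumes U: "open U" and F: "\<And>x. x \<in> U \<Longrightarrow> (F has_derivative (\<lambda>h. G x \<bullet> h)) (at x)"
    and G: "\<And>x. x \<in> U \<Longrightarrow> (G has_derivative D x) (at x)"
    and cont: "\<And>b. b \<in> Basis \<Longrightarrow> continuous_on U (\<lambda>x. D x b)"
    and trace: "\<And>x. x \<in> U \<Longrightarrow> (\<Sum>b\<in>Basis. D x b \<bullet> b) = 0"
  shows "harmonic_on F U"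
proof -
  have gr: "grad F x = G x" if "x \<in> U" for x
  proof -
    have "frechet_derivative F (at x) = (\<lambda>h. G x \<bullet> h)" using frechet_derivative_at[OF F[OF that]] by simp
    then show ?thesis unfolding grad_def by (simp add: euclidean_representation)
  qed
  have dgr: "(grad F has_derivative D x) (at x)" if "x \<in> U" for x
    using has_derivative_transform_within_open[OF G[OF that] U that] gr by auto
  have fd: "frechet_derivative (grad F) (at x) = D x" if "x \<in> U" for x
    using frechet_derivative_at[OF dgr[OF that]] by simp
  show ?thesis unfolding harmonic_on_def laplacian_def
  proof (intro conjI ballI U)
    show "F differentiable_on U" "grad F differentiable_on U"
      unfolding differentiable_on_def differentiable_def using F dgr has_derivative_at_withinI by blast+
    show "continuous_on U (\<lambda>x. frechet_derivative (grad F) (at x) b)" if "b \<in> Basis" for b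
      using cont[OF that] by (rule continuous_on_eq) (simp add: fd)
    show "(\<Sum>b\<in>Basis. frechet_derivative (grad F) (at x) b \<bullet> b) = 0" if "x \<in> U" for x
      using trace[OF that] by (simp add: fd[OF that])
  qed
qed

text \<open>The Hessian of each summand has a trace proportional to d - 2 * (a + 1), which is 0. The
  constant \<open>c\<close> makes room for the shift introduced by the extension of
  \<open>f\<close>.\<close>

lemma newton_sum_harmonic:
  fixes p :: "nat \<times> nat \<Rightarrow> 'a::euclidean_space" and a :: real
  assumes dim: "2 * a + 2 = DIM('a)" and "open U" and p: "\<And>i. i \<in> I \<Longrightarrow> p i \<notin> U"
  shows "harmonic_on (\<lambda>x. c + newton_sum a I m p x) U"
proof -
  let ?q = "\<lambda>i x. (x - p i) \<bullet> (x - p i)"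
  define G where "G = (\<lambda>x. \<Sum>i\<in>I. (m i * (2 * - a) * ?q i x powr (- a - 1)) *\<^sub>R (x - p i))"
  define D where "D = (\<lambda>x h. \<Sum>i\<in>I. (m i * (2 * - a) * ?q i x powr (- a - 1)) *\<^sub>R h +
     (m i * (2 * - a) * (2 * (- a - 1) * ?q i x powr (- a - 1 - 1) * ((x - p i) \<bullet> h))) *\<^sub>R (x - p i))"
  have ne: "x \<noteq> p i" if "x \<in> U" "i \<in> I" for x i using p that by metis
  show ?thesis
  proof (rule harmonic_onI[OF \<open>open U\<close>])
    fix x assume x: "x \<in> U"
    have "((\<lambda>x. c + newton_sum a I m p x) has_derivative
       (\<lambda>h. 0 + (\<Sum>i\<in>I. m i * (2 * - a * ?q i x powr (- a - 1) * ((x - p i) \<bullet> h))))) (at x)"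
      unfolding newton_sum_def
      by (intro has_derivative_add has_derivative_const has_derivative_sum has_derivative_mult_right has_derivative_powr_norm ne x)
    also have "(\<lambda>h. 0 + (\<Sum>i\<in>I. m i * (2 * - a * ?q i x powr (- a - 1) * ((x - p i) \<bullet> h)))) = (\<lambda>h. G x \<bullet> h)"
      by (simp add: G_def inner_sum_left mult_ac)
    finally show "((\<lambda>x. c + newton_sum a I m p x) has_derivative (\<lambda>h. G x \<bullet> h)) (at x)" .
    show "(G has_derivative D x) (at x)"
      unfolding G_def D_def
    proof (rule has_derivative_sum)
      fix i assume i: "i \<in> I"
      have "((\<lambda>x. x - p i) has_derivative (\<lambda>h. h)) (at x)" by (auto intro!: derivative_eq_intros)
      from has_derivative_scaleR[OF has_derivative_mult_right[OF has_derivative_powr_norm[OF ne[OF x i], of "- a - 1"]] this]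
      show "((\<lambda>x. (m i * (2 * - a) * ?q i x powr (- a - 1)) *\<^sub>R (x - p i)) has_derivative
        (\<lambda>h. (m i * (2 * - a) * ?q i x powr (- a - 1)) *\<^sub>R h +
         (m i * (2 * - a) * (2 * (- a - 1) * ?q i x powr (- a - 1 - 1) * ((x - p i) \<bullet> h))) *\<^sub>R (x - p i))) (at x)" .
    qed
    show "(\<Sum>b\<in>Basis. D x b \<bullet> b) = 0"
    proof -
      have "(\<Sum>b\<in>Basis. D x b \<bullet> b) = (\<Sum>i\<in>I. \<Sum>b\<in>Basis. m i * (2 * - a) * ?q i x powr (- a - 1) +
        m i * (2 * - a) * (2 * (- a - 1) * ?q i x powr (- a - 1 - 1)) * (((x - p i) \<bullet> b) * ((x - p i) \<bullet> b)))"
        unfolding D_def inner_sum_left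
        by (subst sum.swap) (intro sum.cong refl, simp add: inner_add_left inner_diff_left inner_Basis algebra_simps)
      also have "\<dots> = (\<Sum>i\<in>I. 0)"
      proof (intro sum.cong refl)
        fix i assume i: "i \<in> I"
        let ?z = "x - p i"
        have "(\<Sum>b\<in>Basis. m i * (2 * - a) * ?q i x powr (- a - 1) +
          m i * (2 * - a) * (2 * (- a - 1) * ?q i x powr (- a - 1 - 1)) * ((?z \<bullet> b) * (?z \<bullet> b)))
          = DIM('a) * (m i * (2 * - a) * ?q i x powr (- a - 1)) + m i * (2 * - a) * (2 * (- a - 1) * ?q i x powr (- a - 1 - 1)) * (?z \<bullet> ?z)"
          unfolding sum.distrib sum_distrib_left[symmetric] euclidean_inner[of ?z ?z, symmetric] by simp
        also have "\<dots> = m i * (2 * - a) * (DIM('a) * ?q i x powr (- a - 1) + 2 * (- a - 1) * (?q i x * ?q i x powr (- a - 1 - 1)))"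
          by (simp add: algebra_simps)
        also have "?q i x * ?q i x powr (- a - 1 - 1) = ?q i x powr (1 + (- a - 1 - 1))"
          by (rule powr_mult_base) simp
        also have "1 + (- a - 1 - 1) = - a - 1" by simp
        also have "m i * (2 * - a) * (DIM('a) * ?q i x powr (- a - 1) + 2 * (- a - 1) * ?q i x powr (- a - 1)) = 0"
          unfolding dim[symmetric] by (simp add: algebra_simps)
        finally show "(\<Sum>b\<in>Basis. m i * (2 * - a) * ?q i x powr (- a - 1) +
          m i * (2 * - a) * (2 * (- a - 1) * ?q i x powr (- a - 1 - 1)) * ((?z \<bullet> b) * (?z \<bullet> b))) = 0" .
      qed
      finally show ?thesis by simp
    qed
  next
    fix b :: 'a assume "b \<in> Basis"
    show "continuous_on U (\<lambda>x. D x b)"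
      unfolding D_def using ne by (intro continuous_intros) (auto simp: inner_eq_zero_iff)
  qed
qed

section \<open>Extension, rescaling and the converse\<close>

text \<open>By concavity and the value 0 at 0, the graph lies above its chord from the origin to s +
  t; the chord values at s and t add up to the left side.\<close>

lemma modulus_subadditive:
  assumes \<omega>: "modulus_of_continuity \<omega>" and "0 \<le> s" "0 \<le> t"
  shows "\<omega> (s + t) \<le> \<omega> s + \<omega> t"
proof (cases "s + t = 0")
  case True
  then show ?thesis using assms by (simp add: modulus_of_continuity_def add_nonneg_eq_0_iff)
next
  case False
  then have pos: "0 < s + t" using assms by simp
  have part: "u / (s + t) * \<omega> (s + t) \<le> \<omega> u" if u: "0 \<le> u" "u \<le> s + t" for u
  proof -
    have c: "concave_on {0..} \<omega>" and "\<omega> 0 = 0" using \<omega> by (auto simp: modulus_of_continuity_def)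
    have "(1 - u / (s + t)) * \<omega> 0 + u / (s + t) * \<omega> (s + t) \<le> \<omega> ((1 - u / (s + t)) *\<^sub>R 0 + (u / (s + t)) *\<^sub>R (s + t))"
      by (rule concave_onD[OF c]) (use u pos in auto)
    then show ?thesis using \<open>\<omega> 0 = 0\<close> pos by simp
  qed
  have "s / (s + t) + t / (s + t) = 1" using pos by (simp flip: add_divide_distrib)
  then have "\<omega> (s + t) = s / (s + t) * \<omega> (s + t) + t / (s + t) * \<omega> (s + t)"
    by (metis distrib_right mult_1)
  also have "\<dots> \<le> \<omega> s + \<omega> t" by (intro add_mono part) (use assms in auto)
  finally show ?thesis .
qed

lemma modulus_mono: "modulus_of_continuity \<omega> \<Longrightarrow> 0 \<le> s \<Longrightarrow> s \<le> t \<Longrightarrow> \<omega> s \<le> \<omega> t"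
  using mono_onD[of "{0..}" \<omega> s t] by (simp add: modulus_of_continuity_def)

lemma modulus_nonneg: "modulus_of_continuity \<omega> \<Longrightarrow> 0 \<le> s \<Longrightarrow> 0 \<le> \<omega> s"
  using modulus_mono[of \<omega> 0 s] by (simp add: modulus_of_continuity_def)

lemma continuous_of_modulus:
  fixes g :: "'a::euclidean_space \<Rightarrow> real"
  assumes \<omega>: "modulus_of_continuity \<omega>" and g: "\<And>x y. \<bar>g x - g y\<bar> \<le> M * \<omega> (dist x y)"
  shows "continuous_on UNIV g"
proof (intro continuous_at_imp_continuous_on ballI)
  fix x :: 'a
  have \<omega>c: "continuous_on {0..} \<omega>" and "\<omega> 0 = 0" using \<omega> by (auto simp: modulus_of_continuity_def)
  have "continuous_on UNIV (\<lambda>y. dist y x)" by (intro continuous_intros)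
  then have "continuous_on UNIV (\<lambda>y. \<omega> (dist y x))"
    by (rule continuous_on_compose2[OF \<omega>c]) auto
  then have "continuous_on UNIV (\<lambda>y. M * \<omega> (dist y x))" by (rule continuous_on_mult_left)
  then have "isCont (\<lambda>y. M * \<omega> (dist y x)) x" by (simp add: continuous_on_eq_continuous_at)
  then have "((\<lambda>y. M * \<omega> (dist y x)) \<longlongrightarrow> 0) (at x)"
    using \<open>\<omega> 0 = 0\<close> by (simp add: isCont_def)
  then have "((\<lambda>y. g y - g x) \<longlongrightarrow> 0) (at x)"
    by (rule Lim_null_comparison[rotated]) (simp add: g)
  then show "isCont g x" by (simp add: isCont_def LIM_zero_iff)
qed

text \<open>Shifting \<open>f\<close> by its minimum and truncating McShane's extension at \<open>0\<close> makes the support bounded, even when \<open>\<omega>\<close>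
  is bounded.\<close>

lemma lipschitz_extension:
  fixes K :: "'a::euclidean_space set" and f :: "'a \<Rightarrow> real"
  assumes K: "compact K" "K \<noteq> {}" and cont: "continuous_on K f" and M: "0 < M"
    and \<omega>: "modulus_of_continuity \<omega>"
    and f: "\<And>x y. x \<in> K \<Longrightarrow> y \<in> K \<Longrightarrow> \<bar>f x - f y\<bar> \<le> M * \<omega> (dist x y)"
  obtains g c r where "\<And>x. x \<in> K \<Longrightarrow> g x = f x - c" and "\<And>x y. \<bar>g x - g y\<bar> \<le> M * \<omega> (dist x y)"
    and "\<And>x. r < norm x \<Longrightarrow> g x = 0"
proof -
  obtain y0 where y0: "y0 \<in> K" "\<And>y. y \<in> K \<Longrightarrow> f y0 \<le> f y"
    using continuous_attains_inf[OF K cont] by blast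
  obtain k0 where k0: "\<And>k. k \<in> K \<Longrightarrow> norm k \<le> k0" using compact_imp_bounded[OF K(1)] by (auto simp: bounded_iff)
  have k00: "0 \<le> k0" using k0[OF y0(1)] norm_ge_zero[of y0] by linarith
  have \<omega>0: "\<omega> 0 = 0" using \<omega> by (simp add: modulus_of_continuity_def)
  define h where "h = (\<lambda>x y. max 0 (f y - f y0 - M * \<omega> (dist x y)))"
  define g where "g = (\<lambda>x. SUP y\<in>K. h x y)"
  have diam: "f y - f y0 \<le> M * \<omega> (2 * k0)" if y: "y \<in> K" for y
  proof -
    have "dist y y0 \<le> 2 * k0" using k0[OF y] k0[OF y0(1)] norm_triangle_ineq4[of y y0] by (simp add: dist_norm)
    then have "M * \<omega> (dist y y0) \<le> M * \<omega> (2 * k0)" using M by (intro mult_left_mono modulus_mono[OF \<omega>]) auto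
    then show ?thesis using f[OF y y0(1)] by linarith
  qed
  have \<omega>nn: "0 \<le> M * \<omega> (dist x y)" for x y :: 'a using M modulus_nonneg[OF \<omega>] by simp
  have h_bd: "h x y \<le> M * \<omega> (2 * k0)" if y: "y \<in> K" for x y
    using diam[OF y] \<omega>nn[of x y] M modulus_nonneg[OF \<omega>, of "2 * k0"] k00 by (auto simp: h_def)
  have bdd: "bdd_above (h x ` K)" for x using h_bd by (intro bdd_aboveI2) auto
  have le: "g x \<le> g x' + M * \<omega> (dist x x')" for x x'
    unfolding g_def
  proof (rule cSUP_least[OF K(2)])
    fix y assume y: "y \<in> K"
    have "\<omega> (dist x' y) \<le> \<omega> (dist x x' + dist x y)"
      by (intro modulus_mono[OF \<omega>]) (auto intro: dist_triangle3[of x' y x, unfolded dist_commute[of x' y]] simp: dist_triangle3)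
    also have "\<dots> \<le> \<omega> (dist x x') + \<omega> (dist x y)" by (intro modulus_subadditive[OF \<omega>]) auto
    finally have "M * \<omega> (dist x' y) \<le> M * \<omega> (dist x x') + M * \<omega> (dist x y)"
      using M by (simp flip: distrib_left)
    then have "h x y \<le> h x' y + M * \<omega> (dist x x')" using \<omega>nn[of x x'] unfolding h_def by linarith
    also have "h x' y \<le> (SUP y\<in>K. h x' y)" by (rule cSUP_upper[OF y bdd])
    finally show "h x y \<le> (SUP y\<in>K. h x' y) + M * \<omega> (dist x x')" by simp
  qed
  have on_K: "g x = f x - f y0" if x: "x \<in> K" for x
  proof (rule antisym)
    show "g x \<le> f x - f y0" unfolding g_def
    proof (rule cSUP_least[OF K(2)])
      fix y assume y: "y \<in> K"
      show "h x y \<le> f x - f y0" using f[OF y x] y0(2)[OF x] by (auto simp: h_def dist_commute)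
    qed
    have "f x - f y0 = h x x" using y0(2)[OF x] by (simp add: h_def \<omega>0)
    also have "\<dots> \<le> g x" unfolding g_def by (rule cSUP_upper[OF x bdd])
    finally show "f x - f y0 \<le> g x" .
  qed
  have modulus: "\<bar>g x - g y\<bar> \<le> M * \<omega> (dist x y)" for x y
    using le[of x y] le[of y x] by (simp add: dist_commute)
  \<comment> \<open>Beyond 3 * k0 every point of \<open>K\<close> is at least 2 * k0 away. There the
    subtracted modulus is at least the bound \<open>diam\<close> on the oscillation of
    \<open>f\<close>, so all truncated cones have reached 0.\<close>
  have "g x = 0" if x: "3 * k0 < norm x" for x
  proof -
    have "h x y = 0" if y: "y \<in> K" for y
    proof -
      have "2 * k0 \<le> dist x y" using k0[OF y] x norm_triangle_ineq2[of x y] by (simp add: dist_norm)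
      then have "M * \<omega> (2 * k0) \<le> M * \<omega> (dist x y)" using M k00 by (intro mult_left_mono modulus_mono[OF \<omega>]) auto
      then show ?thesis using diam[OF y] by (simp add: h_def)
    qed
    then have "h x ` K = {0}" using K(2) by (auto simp: image_iff)
    then show ?thesis unfolding g_def by simp
  qed
  from that[OF on_K modulus this] show thesis .
qed

text \<open>Volumes are proportional to d-th powers of radii, and c^d is at most c for c below 1.
  The constant for volumes thus serves for radii too, without extracting a root.\<close>

lemma porous_holes:
  fixes K :: "'a::euclidean_space set"
  assumes "porous K"
  shows "\<exists>c. 0 < c \<and> c < 1 \<and> (\<forall>x r. 0 < r \<longrightarrow> (\<exists>z. dist x z \<le> r \<and> (\<forall>k\<in>K. c * r \<le> dist z k)))"
proof -
  obtain c where c: "0 < c" "c < 1" and balls: "\<And>x r. 0 < r \<Longrightarrow>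
     \<exists>y s. 0 < s \<and> ball y s \<subseteq> ball x r \<and> ball y s \<inter> K = {} \<and> c * measure lebesgue (ball x r) \<le> measure lebesgue (ball y s)"
    using assms unfolding porous_def by blast
  have "\<exists>z. dist x z \<le> r \<and> (\<forall>k\<in>K. c * r \<le> dist z k)" if r: "0 < r" for x r
  proof -
    obtain y s where ys: "0 < s" "ball y s \<subseteq> ball x r" "ball y s \<inter> K = {}" "c * measure lebesgue (ball x r) \<le> measure lebesgue (ball y s)"
      using balls[OF r] by metis
    have m: "measure lebesgue (ball z t) = unit_ball_vol (DIM('a)) * t ^ DIM('a)" if "0 \<le> t" for z :: 'a and t
      using content_ball[OF that, of z] by simp
    have "unit_ball_vol (DIM('a)) * (c * r ^ DIM('a)) \<le> unit_ball_vol (DIM('a)) * s ^ DIM('a)"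
      using ys(4) unfolding m[OF less_imp_le[OF r]] m[OF less_imp_le[OF ys(1)]] by (simp only: mult_ac)
    then have vol: "c * r ^ DIM('a) \<le> s ^ DIM('a)" by (simp only: mult_le_cancel_left_pos unit_ball_vol_pos of_nat_0_le_iff)
    have "c * r \<le> s"
    proof (rule ccontr)
      assume "\<not> c * r \<le> s"
      then have "s ^ DIM('a) < (c * r) ^ DIM('a)" using ys(1) by (intro power_strict_mono) auto
      also have "\<dots> = c ^ DIM('a) * r ^ DIM('a)" by (rule power_mult_distrib)
      also have "\<dots> \<le> c ^ 1 * r ^ DIM('a)"
        using c r DIM_positive[where 'a = 'a] by (intro mult_right_mono power_decreasing) (auto simp: Suc_le_eq)
      finally show False using vol by simp
    qed
    moreover have "s \<le> dist y k" if "k \<in> K" for k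
      using ys(3) that by (auto simp: disjoint_iff not_less)
    moreover have "y \<in> ball x r" using ys(1) subsetD[OF ys(2), of y] by simp
    ultimately show ?thesis by (intro exI[of _ y]) force
  qed
  then show ?thesis using c by blast
qed

section \<open>Gradients and the converse implication\<close>

lemma has_derivative_grad:
  assumes "F differentiable (at x)"
  shows "(F has_derivative (\<lambda>h. grad F x \<bullet> h)) (at x)"
proof -
  let ?D = "frechet_derivative F (at x)"
  have D: "(F has_derivative ?D) (at x)" using assms by (simp add: frechet_derivative_works)
  have lin: "linear ?D" using D has_derivative_linear by blast
  have "?D h = grad F x \<bullet> h" for h
  proof -
    have "?D h = ?D (\<Sum>b\<in>Basis. (h \<bullet> b) *\<^sub>R b)" by (simp add: euclidean_representation)
    also have "\<dots> = (\<Sum>b\<in>Basis. (h \<bullet> b) * ?D b)" using lin by (simp add: linear_sum linear_scale)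
    finally show ?thesis by (simp add: grad_def inner_sum_left inner_commute[of h] mult.commute)
  qed
  then have "?D = (\<lambda>h. grad F x \<bullet> h)" by (intro ext)
  then show ?thesis using D by simp
qed

text \<open>Along the gradient itself the difference quotients tend to its squared norm while
  staying below L times its norm. The case of a zero gradient is settled by L being
  nonnegative.\<close>

lemma norm_grad_le_lipschitz:
  assumes diff: "F differentiable (at x)" and "0 < d"
    and lip: "\<And>y. dist y x < d \<Longrightarrow> \<bar>F y - F x\<bar> \<le> L * dist y x"
  shows "norm (grad F x) \<le> L"
proof -
  let ?g = "grad F x"
  have line: "((\<lambda>t. x + t *\<^sub>R ?g) has_derivative (\<lambda>t. t *\<^sub>R ?g)) (at 0)"
    by (auto intro!: derivative_eq_intros)
  have "((\<lambda>t. F (x + t *\<^sub>R ?g)) has_derivative (\<lambda>t. ?g \<bullet> (t *\<^sub>R ?g))) (at 0)"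
    using has_derivative_compose[OF line, of F "\<lambda>h. ?g \<bullet> h"] has_derivative_grad[OF diff] by simp
  then have "((\<lambda>t. F (x + t *\<^sub>R ?g)) has_real_derivative (?g \<bullet> ?g)) (at 0)"
    by (simp add: has_field_derivative_def mult_commute_abs)
  then have lim: "((\<lambda>t. (F (x + t *\<^sub>R ?g) - F x) / t) \<longlongrightarrow> ?g \<bullet> ?g) (at 0)"
    by (simp add: has_field_derivative_iff)
  have "((\<lambda>t. dist (x + t *\<^sub>R ?g) x) \<longlongrightarrow> dist (x + 0 *\<^sub>R ?g) x) (at (0::real))"
    by (intro tendsto_intros)
  then have "((\<lambda>t. dist (x + t *\<^sub>R ?g) x) \<longlongrightarrow> 0) (at (0::real))" by simp
  then have "eventually (\<lambda>t. dist (x + t *\<^sub>R ?g) x < d) (at (0::real))"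
    using \<open>0 < d\<close> by (rule order_tendstoD)
  then have "eventually (\<lambda>t. (F (x + t *\<^sub>R ?g) - F x) / t \<le> L * norm ?g) (at (0::real))"
    using eventually_neq_at_within[of 0 0 UNIV]
  proof eventually_elim
    case (elim t)
    have "\<bar>F (x + t *\<^sub>R ?g) - F x\<bar> \<le> \<bar>t\<bar> * (L * norm ?g)" using lip[OF elim(1)] by (simp add: dist_norm mult_ac)
    then have "\<bar>(F (x + t *\<^sub>R ?g) - F x) / t\<bar> \<le> L * norm ?g" using elim(2) by (simp add: divide_simps mult_ac)
    then show ?case by linarith
  qed
  then have "?g \<bullet> ?g \<le> L * norm ?g" by (intro tendsto_upperbound[OF lim]) auto
  then have "norm ?g * norm ?g \<le> L * norm ?g" by (simp add: dot_square_norm power2_eq_square)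
  moreover have "0 \<le> L"
  proof -
    obtain b :: 'a where b: "b \<in> Basis" using nonempty_Basis by blast
    have "dist (x + (d / 2) *\<^sub>R b) x = d / 2" using b \<open>0 < d\<close> by (simp add: dist_norm)
    then have "0 \<le> L * (d / 2)" using lip[of "x + (d / 2) *\<^sub>R b"] \<open>0 < d\<close> by (metis abs_ge_zero field_sum_of_halves less_add_same_cancel1 half_gt_zero order_trans)
    then show ?thesis using \<open>0 < d\<close> by (simp add: zero_le_mult_iff)
  qed
  ultimately show ?thesis by (cases "?g = 0") auto
qed

lemma open_nbhd: "open (nbhd K \<delta>)"
  unfolding nbhd_def by (intro open_Collect_less continuous_intros)

lemma harmonic_approx_imp_Lip:
  assumes \<omega>: "modulus_of_continuity \<omega>" and cont: "continuous_on K f"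
    and app: "harmonic_approx \<omega> K f (ennreal A\<^sub>1) (ennreal A\<^sub>2)"
  shows "f \<in> Lip \<omega> K"
proof -
  \<comment> \<open>\<open>ennreal\<close> sends negative numbers to 0, hence the truncations. Each
    end point contributes an approximation error, the segment between them the gradient
    term.\<close>
  define A where "A = 2 * max 0 A\<^sub>1 + max 0 A\<^sub>2"
  have bound: "\<bar>f x - f y\<bar> \<le> A * \<omega> (dist x y)" if x: "x \<in> K" and y: "y \<in> K" and ne: "x \<noteq> y" for x y
  proof -
    define \<delta> where "\<delta> = dist x y"
    have \<delta>: "0 < \<delta>" using ne by (simp add: \<delta>_def)
    have \<omega>\<delta>: "0 < \<omega> \<delta>" using \<omega> \<delta> by (simp add: modulus_of_continuity_def)
    obtain F where F: "harmonic_on F (nbhd K \<delta>)"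
      and F1: "(SUP x\<in>K. ennreal \<bar>f x - F x\<bar>) \<le> ennreal A\<^sub>1 * ennreal (\<omega> \<delta>)"
      and F2: "(SUP x\<in>nbhd K \<delta>. ennreal (norm (grad F x))) \<le> ennreal A\<^sub>2 * ennreal (\<omega> \<delta> / \<delta>)"
      using app \<delta> unfolding harmonic_approx_def by blast
    have mx: "ennreal A = ennreal (max 0 A)" for A
      by (cases "0 \<le> A") (auto simp: ennreal_neg max_def)
    have near: "\<bar>f z - F z\<bar> \<le> max 0 A\<^sub>1 * \<omega> \<delta>" if "z \<in> K" for z
    proof -
      have "ennreal \<bar>f z - F z\<bar> \<le> ennreal (max 0 A\<^sub>1 * \<omega> \<delta>)"
        using order_trans[OF SUP_upper[OF that] F1] \<omega>\<delta> by (simp add: mx[of A\<^sub>1] ennreal_mult)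
      then show ?thesis using \<omega>\<delta> by (simp add: ennreal_le_iff)
    qed
    have gr: "norm (grad F z) \<le> max 0 A\<^sub>2 * (\<omega> \<delta> / \<delta>)" if "z \<in> nbhd K \<delta>" for z
    proof -
      have "ennreal (norm (grad F z)) \<le> ennreal (max 0 A\<^sub>2 * (\<omega> \<delta> / \<delta>))"
        using order_trans[OF SUP_upper[OF that] F2]
        by (subst ennreal_mult) (use \<omega>\<delta> \<delta> in \<open>auto simp flip: mx[of A\<^sub>2]\<close>)
      then show ?thesis by (rule iffD1[OF ennreal_le_iff, rotated]) (use \<omega>\<delta> \<delta> in simp)
    qed
    \<comment> \<open>The distances to the two end points add up to \<delta> > 0, so at least one is
      strictly below \<delta>, except that at an end point the distance to that point itself is 0,
      which is again below \<delta>.\<close>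
    have seg: "z \<in> nbhd K \<delta>" if z: "z \<in> closed_segment x y" for z
    proof -
      have "dist x z + dist z y = dist x y" using z by (simp add: between_mem_segment[symmetric] between)
      then have "dist z x < \<delta> \<or> dist z y < \<delta>" using \<delta> unfolding \<delta>_def dist_commute[of z x] by linarith
      then show ?thesis unfolding nbhd_def using infdist_le[OF x, of z] infdist_le[OF y, of z] by auto
    qed
    have "norm (F x - F y) \<le> (max 0 A\<^sub>2 * (\<omega> \<delta> / \<delta>)) * norm (x - y)"
    proof (rule differentiable_bound[of "closed_segment x y" F "\<lambda>z h. grad F z \<bullet> h"])
      fix z assume z: "z \<in> closed_segment x y"
      have "F differentiable (at z within nbhd K \<delta>)"
        using F seg[OF z] unfolding harmonic_on_def differentiable_on_def by blast
      then have "F differentiable (at z)" using at_within_open[OF seg[OF z] open_nbhd] by metis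
      then show "(F has_derivative (\<lambda>h. grad F z \<bullet> h)) (at z within closed_segment x y)"
        by (rule has_derivative_at_withinI[OF has_derivative_grad])
      show "onorm (\<lambda>h. grad F z \<bullet> h) \<le> max 0 A\<^sub>2 * (\<omega> \<delta> / \<delta>)"
      proof (rule onorm_bound)
        show "0 \<le> max 0 A\<^sub>2 * (\<omega> \<delta> / \<delta>)" using \<omega>\<delta> \<delta> by simp
        show "norm (grad F z \<bullet> h) \<le> max 0 A\<^sub>2 * (\<omega> \<delta> / \<delta>) * norm h" for h
          using order_trans[OF Cauchy_Schwarz_ineq2 mult_right_mono[OF gr[OF seg[OF z]] norm_ge_zero]] by simp
      qed
    qed auto
    also have "\<dots> = max 0 A\<^sub>2 * \<omega> \<delta>" using \<delta> by (simp add: \<delta>_def dist_norm)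
    finally have "\<bar>F x - F y\<bar> \<le> max 0 A\<^sub>2 * \<omega> \<delta>" by simp
    then show ?thesis using near[OF x] near[OF y] unfolding A_def \<delta>_def[symmetric] distrib_right by linarith
  qed
  have "lip_seminorm \<omega> K f \<le> ennreal A"
    unfolding lip_seminorm_def
  proof (intro SUP_least ennreal_leI)
    fix x y assume "x \<in> K" "y \<in> K - {x}"
    then have "\<bar>f x - f y\<bar> \<le> A * \<omega> (dist x y)" "0 < \<omega> (dist x y)"
      using bound[of x y] \<omega> by (auto simp: modulus_of_continuity_def)
    then show "\<bar>f x - f y\<bar> / \<omega> (dist x y) \<le> A" by (simp add: divide_simps)
  qed
  then show ?thesis unfolding Lip_def using cont by (auto simp: le_less_trans)
qed

section \<open>Rescaling and the direct implication\<close>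

lemma lip_seminormD:
  assumes \<omega>: "modulus_of_continuity \<omega>" and f: "f \<in> Lip \<omega> K" and x: "x \<in> K" and y: "y \<in> K"
  shows "\<bar>f x - f y\<bar> \<le> enn2real (lip_seminorm \<omega> K f) * \<omega> (dist x y)"
proof (cases "x = y")
  case True
  then show ?thesis using \<omega> by (simp add: modulus_of_continuity_def)
next
  case False
  let ?q = "\<bar>f x - f y\<bar> / \<omega> (dist x y)"
  have pos: "0 < \<omega> (dist x y)" using \<omega> False by (simp add: modulus_of_continuity_def)
  have fin: "lip_seminorm \<omega> K f < top" using f by (simp add: Lip_def)
  have "ennreal ?q \<le> (SUP y\<in>K - {x}. ennreal (\<bar>f x - f y\<bar> / \<omega> (dist x y)))"
    by (rule SUP_upper) (use False y in auto)
  also have "\<dots> \<le> lip_seminorm \<omega> K f"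
    unfolding lip_seminorm_def by (rule SUP_upper[OF x])
  finally have "enn2real (ennreal ?q) \<le> enn2real (lip_seminorm \<omega> K f)"
    by (rule enn2real_mono[OF _ fin])
  then show ?thesis using pos by (simp add: divide_simps)
qed

text \<open>The kernel is homogeneous of degree - 2 * a, so a dilated sum is again a sum of Newton
  kernels, with new masses and poles. Its harmonicity then needs no chain rule.\<close>

lemma newton_sum_scale:
  assumes "0 < \<delta>"
  shows "newton_sum a I m p (x /\<^sub>R \<delta>) = newton_sum a I (\<lambda>i. \<delta> powr (2 * a) * m i) (\<lambda>i. \<delta> *\<^sub>R p i) x"
  unfolding newton_sum_def
proof (intro sum.cong refl)
  fix i
  let ?z = "x - \<delta> *\<^sub>R p i"
  have "x /\<^sub>R \<delta> - p i = ?z /\<^sub>R \<delta>" using assms by (simp add: scaleR_diff_right)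
  then have "(x /\<^sub>R \<delta> - p i) \<bullet> (x /\<^sub>R \<delta> - p i) = (?z \<bullet> ?z) / \<delta>\<^sup>2"
    by (simp add: power2_eq_square divide_inverse mult_ac)
  also have "\<dots> powr (- a) = (?z \<bullet> ?z) powr (- a) / (\<delta>\<^sup>2) powr (- a)"
    using assms by (simp add: powr_divide)
  also have "(\<delta>\<^sup>2) powr (- a) = inverse (\<delta> powr (2 * a))"
    using assms by (simp add: powr_powr powr_minus flip: powr_numeral)
  finally show "m i * ((x /\<^sub>R \<delta> - p i) \<bullet> (x /\<^sub>R \<delta> - p i)) powr - a = \<delta> powr (2 * a) * m i * (?z \<bullet> ?z) powr - a"
    by (simp add: divide_inverse)
qed

text \<open>Porosity is invariant under dilation, so one radius \<open>R\<close> serves all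
  \<delta>, while the modulus condition becomes an oscillation of at most M * \<omega> \<delta> at
  unit distance. \<open>M\<close> stands for a positive seminorm.\<close>

lemma newton_approximation:
  fixes K :: "'a::euclidean_space set" and a :: real
  assumes a: "0 < a" and dim: "2 * a + 2 = DIM('a)" and K: "compact K" "K \<noteq> {}" and "porous K"
    and \<omega>: "modulus_of_continuity \<omega>"
  obtains C L where "0 < C" "0 < L"
    and "\<And>f M \<delta>. continuous_on K f \<Longrightarrow> 0 < M \<Longrightarrow> 0 < \<delta> \<Longrightarrow>
     \<forall>x\<in>K. \<forall>y\<in>K. \<bar>f x - f y\<bar> \<le> M * \<omega> (dist x y) \<Longrightarrow>
     \<exists>F. harmonic_on F (nbhd K \<delta>) \<and> (\<forall>x\<in>K. \<bar>f x - F x\<bar> \<le> C * M * \<omega> \<delta>) \<and>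
       (\<forall>x\<in>nbhd K \<delta>. norm (grad F x) \<le> L * M * (\<omega> \<delta> / \<delta>))"
proof -
  obtain c where c: "0 < c" "c < 1" and holes: "\<And>x r. 0 < r \<Longrightarrow> \<exists>z. dist x z \<le> r \<and> (\<forall>k\<in>K. c * r \<le> dist z k)"
    using porous_holes[OF \<open>porous K\<close>] by blast
  \<comment> \<open>In every ball of radius R this leaves a point at distance at least c * R = 4
    from \<open>K\<close>.\<close>
  define R where "R = 4 / c"
  have R: "1 \<le> R" using c by (simp add: R_def divide_simps)
  obtain C where C: "0 < C" and approx: "\<And>(K::'a set) f W. bounded K \<Longrightarrow> \<forall>q. \<exists>z. dist q z \<le> R \<and> (\<forall>k\<in>K. 4 \<le> dist z k) \<Longrightarrow>
     0 < W \<Longrightarrow> continuous_on UNIV f \<Longrightarrow> \<exists>r. \<forall>x. r < norm x \<longrightarrow> f x = 0 \<Longrightarrow>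
     \<forall>x y. dist x y \<le> 1 \<longrightarrow> \<bar>f x - f y\<bar> \<le> W \<Longrightarrow>
     \<exists>I m p. finite I \<and> (\<forall>i\<in>I. \<forall>k\<in>K. 3 \<le> dist (p i) k) \<and>
        (\<forall>x. (\<exists>k\<in>K. dist x k < 2) \<longrightarrow> \<bar>f x - newton_sum a I m p x\<bar> \<le> C * W)"
    by (rule unit_scale_approximation[OF a dim R]) (rule that)
  obtain L where L: "0 < L" and lip: "\<And>(K::'a set) f W I m p x y. finite I \<Longrightarrow> \<forall>i\<in>I. \<forall>k\<in>K. 3 \<le> dist (p i) k \<Longrightarrow> 0 \<le> W \<Longrightarrow>
     \<forall>x y. dist x y \<le> 1 \<longrightarrow> \<bar>f x - f y\<bar> \<le> W \<Longrightarrow>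
     \<forall>x. (\<exists>k\<in>K. dist x k < 2) \<longrightarrow> \<bar>f x - newton_sum a I m p x\<bar> \<le> C * W \<Longrightarrow>
     \<exists>k\<in>K. dist x k < 1 \<Longrightarrow> \<exists>k\<in>K. dist y k < 1 \<Longrightarrow> dist x y \<le> 1 \<Longrightarrow>
     \<bar>newton_sum a I m p x - newton_sum a I m p y\<bar> \<le> L * W * dist x y"
    by (rule newton_sum_lipschitz[OF a dim less_imp_le[OF C]]) (rule that)
  show thesis
  proof (rule that[OF C L])
    fix f :: "'a \<Rightarrow> real" and M \<delta> :: real
    assume cont: "continuous_on K f" and M: "0 < M" and \<delta>: "0 < \<delta>"
      and f: "\<forall>x\<in>K. \<forall>y\<in>K. \<bar>f x - f y\<bar> \<le> M * \<omega> (dist x y)"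
    obtain g and b r :: real where g_eq: "\<And>x. x \<in> K \<Longrightarrow> g x = f x - b"
      and g: "\<And>x y. \<bar>g x - g y\<bar> \<le> M * \<omega> (dist x y)" and g_supp: "\<And>x. r < norm x \<Longrightarrow> g x = 0"
      by (rule lipschitz_extension[OF K cont M \<omega>]) (simp add: f, rule that)
    define W where "W = M * \<omega> \<delta>"
    have W: "0 < W" using M \<delta> \<omega> by (simp add: W_def modulus_of_continuity_def)
    define K' where "K' = (\<lambda>k. k /\<^sub>R \<delta>) ` K"
    define g' where "g' = (\<lambda>x. g (\<delta> *\<^sub>R x))"
    have dist_scale: "dist (\<delta> *\<^sub>R x) (\<delta> *\<^sub>R y) = \<delta> * dist x y" for x y :: 'a
      using \<delta> by (simp add: dist_norm flip: scaleR_diff_right)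
    have dist_K': "dist x (k /\<^sub>R \<delta>) = dist (\<delta> *\<^sub>R x) k / \<delta>" for x k :: 'a
      using \<delta> dist_scale[of x "k /\<^sub>R \<delta>"] by simp
    have "bounded K'" unfolding K'_def using compact_imp_bounded[OF K(1)] by (rule bounded_scaling)
    moreover have "\<forall>q. \<exists>z. dist q z \<le> R \<and> (\<forall>k\<in>K'. 4 \<le> dist z k)"
    proof
      fix q
      obtain z where z: "dist (\<delta> *\<^sub>R q) z \<le> R * \<delta>" "\<And>k. k \<in> K \<Longrightarrow> c * (R * \<delta>) \<le> dist z k"
        using holes[of "R * \<delta>" "\<delta> *\<^sub>R q"] R \<delta> by auto
      have "dist q (z /\<^sub>R \<delta>) \<le> R" unfolding dist_K' using z(1) \<delta> by (simp add: divide_le_eq)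
      moreover have "4 \<le> dist (z /\<^sub>R \<delta>) (k /\<^sub>R \<delta>)" if "k \<in> K" for k
        unfolding dist_K' using z(2)[OF that] \<delta> c by (simp add: R_def le_divide_eq)
      ultimately show "\<exists>z. dist q z \<le> R \<and> (\<forall>k\<in>K'. 4 \<le> dist z k)"
        unfolding K'_def by (intro exI[of _ "z /\<^sub>R \<delta>"]) auto
    qed
    moreover have "continuous_on UNIV g'"
      unfolding g'_def by (intro continuous_on_compose2[OF continuous_of_modulus[OF \<omega> g]] continuous_intros) auto
    moreover have "\<exists>r. \<forall>x. r < norm x \<longrightarrow> g' x = 0"
      using g_supp \<delta> by (intro exI[of _ "r / \<delta>"]) (auto simp: g'_def divide_less_eq mult.commute)
    moreover have osc: "\<forall>x y. dist x y \<le> 1 \<longrightarrow> \<bar>g' x - g' y\<bar> \<le> W"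
    proof (intro allI impI)
      fix x y :: 'a assume that: "dist x y \<le> 1"
      have "dist (\<delta> *\<^sub>R x) (\<delta> *\<^sub>R y) \<le> \<delta>" using that \<delta> by (simp add: dist_scale mult_left_le)
      then have "M * \<omega> (dist (\<delta> *\<^sub>R x) (\<delta> *\<^sub>R y)) \<le> W"
        unfolding W_def using M by (intro mult_left_mono modulus_mono[OF \<omega>]) auto
      then show "\<bar>g' x - g' y\<bar> \<le> W" using g[of "\<delta> *\<^sub>R x" "\<delta> *\<^sub>R y"] by (simp add: g'_def)
    qed
    ultimately obtain I m p where I: "finite I" and p3: "\<forall>i\<in>I. \<forall>k\<in>K'. 3 \<le> dist (p i) k"
      and app: "\<forall>x. (\<exists>k\<in>K'. dist x k < 2) \<longrightarrow> \<bar>g' x - newton_sum a I m p x\<bar> \<le> C * W"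
      using approx[of K' W g'] W by blast
    define F where "F = (\<lambda>x. b + newton_sum a I m p (x /\<^sub>R \<delta>))"
    \<comment> \<open>A nearest point of the compact set exists, so the strict inequality for the
      infimum passes to an actual point of \<open>K'\<close>.\<close>
    have nbhdE: "\<exists>k\<in>K'. dist (x /\<^sub>R \<delta>) k < 1" if "x \<in> nbhd K \<delta>" for x
    proof -
      have "infdist x K < \<delta>" using that by (simp add: nbhd_def)
      moreover obtain k where "k \<in> K" "infdist x K = dist x k"
        by (rule infdist_attains_inf[OF compact_imp_closed[OF K(1)] K(2)])
      ultimately show ?thesis using \<delta> unfolding K'_def by (intro bexI[of _ "k /\<^sub>R \<delta>"]) (auto simp: dist_K')
    qed
    have harm: "harmonic_on F (nbhd K \<delta>)"
      unfolding F_def newton_sum_scale[OF \<delta>]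
    proof (rule newton_sum_harmonic[OF dim open_nbhd])
      fix i assume i: "i \<in> I"
      show "\<delta> *\<^sub>R p i \<notin> nbhd K \<delta>"
        using nbhdE[of "\<delta> *\<^sub>R p i"] p3 i \<delta> by force
    qed
    show "\<exists>F. harmonic_on F (nbhd K \<delta>) \<and> (\<forall>x\<in>K. \<bar>f x - F x\<bar> \<le> C * M * \<omega> \<delta>) \<and>
       (\<forall>x\<in>nbhd K \<delta>. norm (grad F x) \<le> L * M * (\<omega> \<delta> / \<delta>))"
    proof (intro exI[of _ F] conjI harm ballI)
      fix x assume x: "x \<in> K"
      then have "\<exists>k\<in>K'. dist (x /\<^sub>R \<delta>) k < 2" unfolding K'_def by force
      then have "\<bar>g' (x /\<^sub>R \<delta>) - newton_sum a I m p (x /\<^sub>R \<delta>)\<bar> \<le> C * W" using app by blast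
      then show "\<bar>f x - F x\<bar> \<le> C * M * \<omega> \<delta>"
        using \<delta> g_eq[OF x] by (simp add: g'_def F_def W_def algebra_simps)
    next
      fix x assume x: "x \<in> nbhd K \<delta>"
      obtain e where e: "0 < e" "ball x e \<subseteq> nbhd K \<delta>" using openE[OF open_nbhd x] by blast
      have "F differentiable (at x within nbhd K \<delta>)"
        using harm x unfolding harmonic_on_def differentiable_on_def by blast
      then have diff: "F differentiable (at x)" using at_within_open[OF x open_nbhd] by metis
      \<comment> \<open>\<open>e\<close> keeps y inside the neighborhood, and \<delta> keeps the
        rescaled points within distance 1, as the Lipschitz bound requires.\<close>
      show "norm (grad F x) \<le> L * M * (\<omega> \<delta> / \<delta>)"
      proof (rule norm_grad_le_lipschitz[OF diff, of "min e \<delta>"])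
        show "0 < min e \<delta>" using e \<delta> by simp
        fix y assume y: "dist y x < min e \<delta>"
        then have y': "y \<in> nbhd K \<delta>" using e(2) by (auto simp: dist_commute)
        have d: "dist (y /\<^sub>R \<delta>) (x /\<^sub>R \<delta>) = dist y x / \<delta>" using \<delta> by (simp add: dist_K')
        have "\<bar>newton_sum a I m p (y /\<^sub>R \<delta>) - newton_sum a I m p (x /\<^sub>R \<delta>)\<bar> \<le> L * W * dist (y /\<^sub>R \<delta>) (x /\<^sub>R \<delta>)"
          using y \<delta> W by (intro lip[OF I p3 _ osc app nbhdE[OF y'] nbhdE[OF x]]) (auto simp: d)
        then show "\<bar>F y - F x\<bar> \<le> L * M * (\<omega> \<delta> / \<delta>) * dist y x"
          unfolding d by (simp add: F_def W_def mult_ac)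
      qed
    qed
  qed
qed

lemma harmonic_on_const: "open U \<Longrightarrow> harmonic_on (\<lambda>_. c) U"
  by (rule harmonic_onI[where G = "\<lambda>_. 0" and D = "\<lambda>_ _. 0"]) simp_all

lemma grad_const: "grad (\<lambda>_. c :: real) x = 0"
  by (simp add: grad_def)

text \<open>For \<open>f\<close> outside \<open>Lip \<omega> K\<close> the seminorm is infinite, and
  bounds in terms of it would hold for any harmonic function. The equivalence is therefore stated
  with finite constants that may depend on \<open>f\<close>, and the uniform constants are given for
  members of \<open>Lip \<omega> K\<close>.\<close>

theorem theorem1p1:
  fixes K :: "'a::euclidean_space set" and \<omega> :: "real \<Rightarrow> real"
  assumes "DIM('a) > 2"
    and "compact K" and "porous K"
    and "modulus_of_continuity \<omega>"
  shows "\<exists>C\<^sub>1 C\<^sub>2 :: real. 0 < C\<^sub>1 \<and> 0 < C\<^sub>2 \<and>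
    (\<forall>f. continuous_on K f \<longrightarrow>
      (f \<in> Lip \<omega> K \<longleftrightarrow> (\<exists>A\<^sub>1 A\<^sub>2 :: real. harmonic_approx \<omega> K f (ennreal A\<^sub>1) (ennreal A\<^sub>2))) \<and>
      (f \<in> Lip \<omega> K \<longrightarrow>
         harmonic_approx \<omega> K f (ennreal C\<^sub>1 * lip_seminorm \<omega> K f) (ennreal C\<^sub>2 * lip_seminorm \<omega> K f)))"
proof -
  note \<omega> = assms(4)
  \<comment> \<open>2 * a is the decay exponent d - 2 of the Newton kernel, positive because d >
    2.\<close>
  define a where "a = (real DIM('a) - 2) / 2"
  have a: "0 < a" and dim: "2 * a + 2 = DIM('a)" using assms(1) by (simp_all add: a_def field_simps)
  obtain C L where C: "0 < C" and L: "0 < L"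
    and approx: "\<And>f M \<delta>. K \<noteq> {} \<Longrightarrow> continuous_on K f \<Longrightarrow> 0 < M \<Longrightarrow> 0 < \<delta> \<Longrightarrow>
     \<forall>x\<in>K. \<forall>y\<in>K. \<bar>f x - f y\<bar> \<le> M * \<omega> (dist x y) \<Longrightarrow>
     \<exists>F. harmonic_on F (nbhd K \<delta>) \<and> (\<forall>x\<in>K. \<bar>f x - F x\<bar> \<le> C * M * \<omega> \<delta>) \<and>
       (\<forall>x\<in>nbhd K \<delta>. norm (grad F x) \<le> L * M * (\<omega> \<delta> / \<delta>))"
  proof (cases "K = {}")
    case True
    then show ?thesis by (intro that[of 1 1]) auto
  next
    case False
    show ?thesis
      by (rule newton_approximation[OF a dim assms(2) False assms(3) \<omega>]) (rule that)
  qed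
  have main: "harmonic_approx \<omega> K f (ennreal C * lip_seminorm \<omega> K f) (ennreal L * lip_seminorm \<omega> K f)"
    if f: "f \<in> Lip \<omega> K" for f
    unfolding harmonic_approx_def
  proof (intro allI impI)
    fix \<delta> :: real assume \<delta>: "0 < \<delta>"
    define M where "M = enn2real (lip_seminorm \<omega> K f)"
    have M0: "0 \<le> M" by (simp add: M_def)
    have lip: "lip_seminorm \<omega> K f = ennreal M" using f by (simp add: M_def Lip_def)
    have fM: "\<bar>f x - f y\<bar> \<le> M * \<omega> (dist x y)" if "x \<in> K" "y \<in> K" for x y
      unfolding M_def by (rule lip_seminormD[OF \<omega> f that])
    have \<omega>\<delta>: "0 < \<omega> \<delta>" using \<omega> \<delta> by (simp add: modulus_of_continuity_def)
    have "\<exists>F. harmonic_on F (nbhd K \<delta>) \<and> (\<forall>x\<in>K. \<bar>f x - F x\<bar> \<le> C * M * \<omega> \<delta>) \<and>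
       (\<forall>x\<in>nbhd K \<delta>. norm (grad F x) \<le> L * M * (\<omega> \<delta> / \<delta>))"
    proof (cases "K = {} \<or> M = 0")
      case True
      \<comment> \<open>With zero seminorm the bounds demand exact agreement and zero gradient;
        \<open>f\<close> is then constant on \<open>K\<close>, and that constant serves. For empty
        \<open>K\<close> any value does.\<close>
      define c where "c = f (SOME x. x \<in> K)"
      have "f x = c" if "x \<in> K" for x
        using True fM[OF that someI[of "\<lambda>x. x \<in> K", OF that]] that by (auto simp: c_def)
      then show ?thesis using C L M0 \<omega>\<delta> \<delta>
        by (intro exI[of _ "\<lambda>_. c"]) (simp add: harmonic_on_const open_nbhd grad_const)
    next
      case False
      then have "K \<noteq> {}" "0 < M" using M0 by auto
      then show ?thesis using approx[of f M \<delta>] f fM \<delta> by (simp add: Lip_def)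
    qed
    then obtain F where F: "harmonic_on F (nbhd K \<delta>)" "\<And>x. x \<in> K \<Longrightarrow> \<bar>f x - F x\<bar> \<le> C * M * \<omega> \<delta>"
      "\<And>x. x \<in> nbhd K \<delta> \<Longrightarrow> norm (grad F x) \<le> L * M * (\<omega> \<delta> / \<delta>)" by blast
    have e: "ennreal C * ennreal M * ennreal (\<omega> \<delta>) = ennreal (C * M * \<omega> \<delta>)"
      "ennreal L * ennreal M * ennreal (\<omega> \<delta> / \<delta>) = ennreal (L * M * (\<omega> \<delta> / \<delta>))"
      using C L M0 \<omega>\<delta> \<delta> by (simp_all add: ennreal_mult[symmetric])
    show "\<exists>F. harmonic_on F (nbhd K \<delta>) \<and>
        (SUP x\<in>K. ennreal \<bar>f x - F x\<bar>) \<le> ennreal C * lip_seminorm \<omega> K f * ennreal (\<omega> \<delta>) \<and>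
        (SUP x\<in>nbhd K \<delta>. ennreal (norm (grad F x))) \<le> ennreal L * lip_seminorm \<omega> K f * ennreal (\<omega> \<delta> / \<delta>)"
      unfolding lip e using F by (intro exI[of _ F]) (auto intro!: SUP_least ennreal_leI)
  qed
  have "f \<in> Lip \<omega> K \<longleftrightarrow> (\<exists>A\<^sub>1 A\<^sub>2 :: real. harmonic_approx \<omega> K f (ennreal A\<^sub>1) (ennreal A\<^sub>2))" if cont: "continuous_on K f" for f
  proof
    assume f: "f \<in> Lip \<omega> K"
    define M where "M = enn2real (lip_seminorm \<omega> K f)"
    have lip: "lip_seminorm \<omega> K f = ennreal M" using f by (simp add: M_def Lip_def)
    have M0: "0 \<le> M" by (simp add: M_def)
    have "harmonic_approx \<omega> K f (ennreal (C * M)) (ennreal (L * M))"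
      using main[OF f] C L M0 unfolding lip by (simp add: ennreal_mult)
    then show "\<exists>A\<^sub>1 A\<^sub>2 :: real. harmonic_approx \<omega> K f (ennreal A\<^sub>1) (ennreal A\<^sub>2)" by blast
  next
    assume "\<exists>A\<^sub>1 A\<^sub>2 :: real. harmonic_approx \<omega> K f (ennreal A\<^sub>1) (ennreal A\<^sub>2)"
    then show "f \<in> Lip \<omega> K" using harmonic_approx_imp_Lip[OF \<omega> cont] by blast
  qed
  then show ?thesis using C L main by blast
qed

end
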